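(* Let $m\ge 1$, let $D\subset\mathbb R^{2m+1}$ be an open set, let $1<p\le\infty$, and let $u\in C(D)$. The asymptotic mean value formula $$u(X,Y,t)=\mathcal M_\epsilon u(X,Y,t)+o(\epsilon^2)\quad\text{as }\epsilon\to0,$$ where \begin{align*} \mathcal M_\epsilon u(X,Y,t)&=\frac{\alpha}{2}\,\frac{1}{\epsilon^2|B_{\epsilon^3}(Y)|}\int_{B_{\epsilon^3}(Y)}\int_{t-\epsilon^2}^t\Big\{\sup_{\tilde X\in B_\epsilon(X)}u(\tilde X,\tilde Y-(\tilde t-t)X,\tilde t)+\inf_{\tilde X\in B_\epsilon(X)}u(\tilde X,\tilde Y-(\tilde t-t)X,\tilde t)\Big\}\,d\tilde t\,d\tilde Y\\ &\quad+\beta\,\frac{1}{\epsilon^2|B_\epsilon(X)||B_{\epsilon^3}(Y)|}\int_{B_\epsilon(X)}\int_{B_{\epsilon^3}(Y)}\int_{t-\epsilon^2}^t u(\tilde X,\tilde Y-(\tilde t-t)X,\tilde t)\,d\tilde t\,d\tilde Y\,d\tilde X, \end{align*} holds for every $(X,Y,t)\in D$ in the viscosity sense if and only if $u$ is a viscosity solution to $\mathcal K_p u=0$ in $D$.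
   Context: Points of $\mathbb R^{2m+1}$ are written $(X,Y,t)\in\mathbb R^m\times\mathbb R^m\times\mathbb R$. $B_r(\cdot)$ denotes an open Euclidean ball in $\mathbb R^m$. The constants are $\alpha=1,\beta=0$ if $p=\infty$, and $\alpha=\frac{p-2}{m+p},\ \beta=\frac{m+2}{m+p}$ if $p<\infty$. Operators. $\nabla_X,\nabla_Y$ are gradients in $X$ and $Y$, $\nabla_X^2\phi$ is the Hessian in the $X$ variables, $\Delta_X$ the Laplacian in $X$, and, where $\nabla_X\phi\ne0$, $\Delta^N_{\infty,X}\phi=|\nabla_X\phi|^{-2}\langle\nabla_X^2\phi\,\nabla_X\phi,\nabla_X\phi\rangle$. For $1<p<\infty$, $\mathcal K_pu=((p-2)\Delta^N_{\infty,X}+\Delta_X)u+(m+p)(X\cdot\nabla_Yu-\partial_tu)$; and $\mathcal K_\infty u=\Delta^N_{\infty,X}u+X\cdot\nabla_Yu-\partial_tu$. For a symmetric matrix $A$, $\lambda(A)$ and $\Lambda(A)$ are its smallest and largest eigenvalues. Touching. $\phi\in C^2(D)$ touches $u$ from below (resp. above) at $(\hat X,\hat Y,\hat t)\in D$ if $u=\phi$ at $(\hat X,\hat Y,\hat t)$ and $u>\phi$ (resp. $u<\phi$) at all other points of $D$. Viscosity solutions. For $1<p<\infty$, a lower semicontinuous $u$ on $D$ is a viscosity supersolution to $\mathcal K_pu=0$ in $D$ if whenever $\phi\in C^2(D)$ touches $u$ from below at $(\hat X,\hat Y,\hat t)\in D$, then at that point $(m+p)(\partial_t\phi-\hat X\cdot\nabla_Y\phi)\ge((p-2)\Delta^N_{\infty,X}+\Delta_X)\phi$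 if $\nabla_X\phi\ne0$, and $(m+p)(\partial_t\phi-\hat X\cdot\nabla_Y\phi)\ge\lambda((p-2)\nabla_X^2\phi)+\Delta_X\phi$ if $\nabla_X\phi=0$. An upper semicontinuous $u$ is a viscosity subsolution if whenever $\phi\in C^2(D)$ touches $u$ from above at $(\hat X,\hat Y,\hat t)\in D$, then at that point $(m+p)(\partial_t\phi-\hat X\cdot\nabla_Y\phi)\le((p-2)\Delta^N_{\infty,X}+\Delta_X)\phi$ if $\nabla_X\phi\ne0$, and $(m+p)(\partial_t\phi-\hat X\cdot\nabla_Y\phi)\le\Lambda((p-2)\nabla_X^2\phi)+\Delta_X\phi$ if $\nabla_X\phi=0$. For $p=\infty$ the same definitions are used with the left sides replaced by $\partial_t\phi-\hat X\cdot\nabla_Y\phi$ and the right sides by $\Delta^N_{\infty,X}\phi$ if $\nabla_X\phi\neq0$, and by $\lambda(\nabla_X^2\phi)$ (supersolution), $\Lambda(\nabla_X^2\phi)$ (subsolution) if $\nabla_X\phi=0$. $u\in C(D)$ is a viscosity solution if it is both a super- and a subsolution. Mean value formula in the viscosity sense. $u\in C(D)$ satisfies $u=\mathcal M_\epsilon u+o(\epsilon^2)$ in the viscosity sense at $(X,Y,t)\in D$ if: for every $\phi\in C^2(D)$ touching $u$ from below at $(X,Y,t)$ such that either $\nabla_X\phi(X,Y,t)\ne0$, or both $\nabla_X\phi(X,Y,t)=0$ and $\nabla_X^2\phi(X,Y,t)=0$, one has $\phi(X,Y,t)\ge\mathcal M_\epsilon\phi(X,Y,t)+o(\epsilon^2)$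 as $\epsilon\to0$; and for every $\phi\in C^2(D)$ touching $u$ from above at $(X,Y,t)$ with the same alternative for its derivatives, one has $\phi(X,Y,t)\le\mathcal M_\epsilon\phi(X,Y,t)+o(\epsilon^2)$ as $\epsilon\to0$. *)

theory Defs
  imports "HOL-Analysis.Analysis" "HOL-Library.Landau_Symbols"
begin

type_synonym 'm point = "(real^'m) \<times> (real^'m) \<times> real"

section \<open>Differential operators\<close>

text \<open>Functions on \<open>D\<close> are represented by total functions on the whole space; every notion below
  is used for open \<open>D\<close> and depends only on the values in \<open>D\<close>.\<close>

definition C2_on :: "'a::euclidean_space set \<Rightarrow> ('a \<Rightarrow> real) \<Rightarrow> bool" where
  "C2_on D \<phi> \<longleftrightarrow>
     (\<exists>(\<phi>' :: 'a \<Rightarrow> 'a \<Rightarrow>\<^sub>L real) (\<phi>'' :: 'a \<Rightarrow> 'a \<Rightarrow>\<^sub>L 'a \<Rightarrow>\<^sub>L real).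
        (\<forall>z\<in>D. (\<phi> has_derivative blinfun_apply (\<phi>' z)) (at z)) \<and>
        (\<forall>z\<in>D. (\<phi>' has_derivative blinfun_apply (\<phi>'' z)) (at z)) \<and>
        continuous_on D \<phi>'')"

definition gradient :: "(real^'m \<Rightarrow> real) \<Rightarrow> real^'m \<Rightarrow> real^'m" where
  "gradient f x = (\<chi> i. frechet_derivative f (at x) (axis i 1))"

definition hessian :: "(real^'m \<Rightarrow> real) \<Rightarrow> real^'m \<Rightarrow> real^'m^'m" where
  "hessian f x = jacobian (gradient f) (at x)"

definition grad_X :: "('m::finite point \<Rightarrow> real) \<Rightarrow> 'm point \<Rightarrow> real^'m" where
  "grad_X \<phi> = (\<lambda>(X, Y, t). gradient (\<lambda>x. \<phi> (x, Y, t)) X)"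

definition grad_Y :: "('m::finite point \<Rightarrow> real) \<Rightarrow> 'm point \<Rightarrow> real^'m" where
  "grad_Y \<phi> = (\<lambda>(X, Y, t). gradient (\<lambda>y. \<phi> (X, y, t)) Y)"

definition d_t :: "('m::finite point \<Rightarrow> real) \<Rightarrow> 'm point \<Rightarrow> real" where
  "d_t \<phi> = (\<lambda>(X, Y, t). deriv (\<lambda>s. \<phi> (X, Y, s)) t)"

definition hess_X :: "('m::finite point \<Rightarrow> real) \<Rightarrow> 'm point \<Rightarrow> real^'m^'m" where
  "hess_X \<phi> = (\<lambda>(X, Y, t). hessian (\<lambda>x. \<phi> (x, Y, t)) X)"

definition laplace_X :: "('m::finite point \<Rightarrow> real) \<Rightarrow> 'm point \<Rightarrow> real" where
  "laplace_X \<phi> z = trace (hess_X \<phi> z)"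

text \<open>Only meaningful where \<open>grad_X \<phi> z \<noteq> 0\<close>.\<close>

definition inf_laplace_X :: "('m::finite point \<Rightarrow> real) \<Rightarrow> 'm point \<Rightarrow> real" where
  "inf_laplace_X \<phi> z =
     inner (hess_X \<phi> z *v grad_X \<phi> z) (grad_X \<phi> z) / (norm (grad_X \<phi> z))\<^sup>2"

definition is_eigenvalue :: "real^'m^'m \<Rightarrow> real \<Rightarrow> bool" where
  "is_eigenvalue A \<mu> \<longleftrightarrow> (\<exists>v. v \<noteq> 0 \<and> A *v v = \<mu> *\<^sub>R v)"

definition min_eigenvalue :: "real^'m^'m \<Rightarrow> real" where
  "min_eigenvalue A = (LEAST \<mu>. is_eigenvalue A \<mu>)"

definition max_eigenvalue :: "real^'m^'m \<Rightarrow> real" where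
  "max_eigenvalue A = (GREATEST \<mu>. is_eigenvalue A \<mu>)"

section \<open>Viscosity solutions\<close>

definition lower_semicontinuous_on :: "'a::topological_space set \<Rightarrow> ('a \<Rightarrow> real) \<Rightarrow> bool" where
  "lower_semicontinuous_on D u \<longleftrightarrow> (\<forall>a. openin (top_of_set D) {z \<in> D. a < u z})"

definition upper_semicontinuous_on :: "'a::topological_space set \<Rightarrow> ('a \<Rightarrow> real) \<Rightarrow> bool" where
  "upper_semicontinuous_on D u \<longleftrightarrow> (\<forall>a. openin (top_of_set D) {z \<in> D. u z < a})"

definition touches_below ::
  "'a::euclidean_space set \<Rightarrow> ('a \<Rightarrow> real) \<Rightarrow> ('a \<Rightarrow> real) \<Rightarrow> 'a \<Rightarrow> bool" where
  "touches_below D \<phi> u z \<longleftrightarrow>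
     C2_on D \<phi> \<and> z \<in> D \<and> u z = \<phi> z \<and> (\<forall>w\<in>D - {z}. u w > \<phi> w)"

definition touches_above ::
  "'a::euclidean_space set \<Rightarrow> ('a \<Rightarrow> real) \<Rightarrow> ('a \<Rightarrow> real) \<Rightarrow> 'a \<Rightarrow> bool" where
  "touches_above D \<phi> u z \<longleftrightarrow>
     C2_on D \<phi> \<and> z \<in> D \<and> u z = \<phi> z \<and> (\<forall>w\<in>D - {z}. u w < \<phi> w)"

text \<open>Throughout, \<open>p :: ereal\<close> ranges over \<open>1 < p \<le> \<infinity>\<close>. The operators are, with \<open>m = CARD('m)\<close>,
  \<open>\<K>\<^sub>p u = ((p - 2) \<Delta>\<^sub>\<infinity>\<^sub>,\<^sub>X + \<Delta>\<^sub>X) u + (m + p) (X \<bullet> \<nabla>\<^sub>Y u - \<partial>\<^sub>t u)\<close> for \<open>p < \<infinity>\<close> and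
  \<open>\<K>\<^sub>\<infinity> u = \<Delta>\<^sub>\<infinity>\<^sub>,\<^sub>X u + X \<bullet> \<nabla>\<^sub>Y u - \<partial>\<^sub>t u\<close>, where \<open>\<Delta>\<^sub>\<infinity>\<^sub>,\<^sub>X\<close> is the normalized infinity Laplacian. The
  viscosity inequalities have the first-order part, with reversed sign, on the left (\<open>transport\<close>) and
  the second-order part (\<open>diffusion\<close>), relaxed where the \<open>X\<close>-gradient vanishes, on the right.\<close>

definition transport :: "ereal \<Rightarrow> ('m::finite point \<Rightarrow> real) \<Rightarrow> 'm point \<Rightarrow> real" where
  "transport p \<phi> z =
     (if p = \<infinity> then 1 else real CARD('m) + real_of_ereal p) *
     (d_t \<phi> z - inner (fst z) (grad_Y \<phi> z))"

definition diffusion :: "ereal \<Rightarrow> ('m::finite point \<Rightarrow> real) \<Rightarrow> 'm point \<Rightarrow> real" where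
  "diffusion p \<phi> z =
     (if p = \<infinity> then inf_laplace_X \<phi> z
      else (real_of_ereal p - 2) * inf_laplace_X \<phi> z + laplace_X \<phi> z)"

definition diffusion_lower :: "ereal \<Rightarrow> ('m::finite point \<Rightarrow> real) \<Rightarrow> 'm point \<Rightarrow> real" where
  "diffusion_lower p \<phi> z =
     (if p = \<infinity> then min_eigenvalue (hess_X \<phi> z)
      else min_eigenvalue ((real_of_ereal p - 2) *\<^sub>R hess_X \<phi> z) + laplace_X \<phi> z)"

definition diffusion_upper :: "ereal \<Rightarrow> ('m::finite point \<Rightarrow> real) \<Rightarrow> 'm point \<Rightarrow> real" where
  "diffusion_upper p \<phi> z =
     (if p = \<infinity> then max_eigenvalue (hess_X \<phi> z)
      else max_eigenvalue ((real_of_ereal p - 2) *\<^sub>R hess_X \<phi> z) + laplace_X \<phi> z)"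

definition viscosity_supersolution ::
  "ereal \<Rightarrow> 'm::finite point set \<Rightarrow> ('m point \<Rightarrow> real) \<Rightarrow> bool" where
  "viscosity_supersolution p D u \<longleftrightarrow>
     lower_semicontinuous_on D u \<and>
     (\<forall>\<phi> z. touches_below D \<phi> u z \<longrightarrow>
        (grad_X \<phi> z \<noteq> 0 \<longrightarrow> transport p \<phi> z \<ge> diffusion p \<phi> z) \<and>
        (grad_X \<phi> z = 0 \<longrightarrow> transport p \<phi> z \<ge> diffusion_lower p \<phi> z))"

definition viscosity_subsolution ::
  "ereal \<Rightarrow> 'm::finite point set \<Rightarrow> ('m point \<Rightarrow> real) \<Rightarrow> bool" where
  "viscosity_subsolution p D u \<longleftrightarrow>
     upper_semicontinuous_on D u \<and>
     (\<forall>\<phi> z. touches_above D \<phi> u z \<longrightarrow>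
        (grad_X \<phi> z \<noteq> 0 \<longrightarrow> transport p \<phi> z \<le> diffusion p \<phi> z) \<and>
        (grad_X \<phi> z = 0 \<longrightarrow> transport p \<phi> z \<le> diffusion_upper p \<phi> z))"

definition viscosity_solution ::
  "ereal \<Rightarrow> 'm::finite point set \<Rightarrow> ('m point \<Rightarrow> real) \<Rightarrow> bool" where
  "viscosity_solution p D u \<longleftrightarrow>
     continuous_on D u \<and> viscosity_supersolution p D u \<and> viscosity_subsolution p D u"

section \<open>The asymptotic mean value formula\<close>

definition mv_alpha :: "ereal \<Rightarrow> nat \<Rightarrow> real" where
  "mv_alpha p m = (if p = \<infinity> then 1 else (real_of_ereal p - 2) / (real m + real_of_ereal p))"

definition mv_beta :: "ereal \<Rightarrow> nat \<Rightarrow> real" where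
  "mv_beta p m = (if p = \<infinity> then 0 else (real m + 2) / (real m + real_of_ereal p))"

definition mean_value ::
  "ereal \<Rightarrow> real \<Rightarrow> ('m::finite point \<Rightarrow> real) \<Rightarrow> 'm point \<Rightarrow> real" where
  "mean_value p \<epsilon> u = (\<lambda>(X, Y, t).
     mv_alpha p CARD('m) / 2 * (1 / (\<epsilon>\<^sup>2 * measure lborel (ball Y (\<epsilon>^3)))) *
       (LINT Y':ball Y (\<epsilon>^3)|lborel. LINT t':{t - \<epsilon>\<^sup>2..t}|lborel.
          (SUP X'\<in>ball X \<epsilon>. u (X', Y' - (t' - t) *\<^sub>R X, t')) +
          (INF X'\<in>ball X \<epsilon>. u (X', Y' - (t' - t) *\<^sub>R X, t')))
   + mv_beta p CARD('m) *
       (1 / (\<epsilon>\<^sup>2 * measure lborel (ball X \<epsilon>) * measure lborel (ball Y (\<epsilon>^3)))) *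
       (LINT X':ball X \<epsilon>|lborel. LINT Y':ball Y (\<epsilon>^3)|lborel. LINT t':{t - \<epsilon>\<^sup>2..t}|lborel.
          u (X', Y' - (t' - t) *\<^sub>R X, t')))"

text \<open>The inequality with error term \<open>\<phi> z \<ge> mean_value p \<epsilon> \<phi> z + o(\<epsilon>\<^sup>2)\<close> means that it holds for all
  small \<open>\<epsilon> > 0\<close> with some function \<open>r \<in> o(\<epsilon>\<^sup>2)\<close> in place of the error term. For small \<open>\<epsilon>\<close>, only
  values of \<open>\<phi>\<close> inside the open set \<open>D\<close> enter the mean value.\<close>

definition mean_value_formula_viscosity ::
  "ereal \<Rightarrow> 'm::finite point set \<Rightarrow> ('m point \<Rightarrow> real) \<Rightarrow> 'm point \<Rightarrow> bool" where
  "mean_value_formula_viscosity p D u z \<longleftrightarrow>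
     (\<forall>\<phi>. touches_below D \<phi> u z \<and>
          (grad_X \<phi> z \<noteq> 0 \<or> grad_X \<phi> z = 0 \<and> hess_X \<phi> z = 0) \<longrightarrow>
        (\<exists>r \<in> o[at_right 0](\<lambda>\<epsilon>. \<epsilon>\<^sup>2).
           \<forall>\<^sub>F \<epsilon> in at_right 0. \<phi> z \<ge> mean_value p \<epsilon> \<phi> z + r \<epsilon>)) \<and>
     (\<forall>\<phi>. touches_above D \<phi> u z \<and>
          (grad_X \<phi> z \<noteq> 0 \<or> grad_X \<phi> z = 0 \<and> hess_X \<phi> z = 0) \<longrightarrow>
        (\<exists>r \<in> o[at_right 0](\<lambda>\<epsilon>. \<epsilon>\<^sup>2).
           \<forall>\<^sub>F \<epsilon> in at_right 0. \<phi> z \<le> mean_value p \<epsilon> \<phi> z + r \<epsilon>))"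

end

theory Submission
  imports Defs
begin

text \<open>
Both sides of the equivalence constrain functions \<open>\<phi>\<close> of class \<open>C\<^sup>2\<close> that touch \<open>u\<close> at a point
\<open>z = (X, Y, t)\<close>, so the proof starts from a Taylor expansion of \<open>\<phi>\<close> at \<open>z\<close>. Let \<open>g\<close> and \<open>H\<close> be gradient and
Hessian of \<open>\<phi>\<close> in the \<open>X\<close> variables at \<open>z\<close>, and let \<open>\<tau> = \<partial>\<^sub>t \<phi> - X \<bullet> \<nabla>\<^sub>Y \<phi>\<close>. On the sheared cylinder over which
the mean value is formed, with \<open>h = X' - X\<close>,
\<open>\<phi> (X', Y' - (t' - t) X, t') = \<phi> z + \<tau> (t' - t) + g \<bullet> h + (H h \<bullet> h) / 2 + o(\<epsilon>\<^sup>2)\<close>.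
Averaging over \<open>t'\<close> turns the second term into \<open>- \<epsilon>\<^sup>2 \<tau> / 2\<close>. Averaging over the ball in \<open>X\<close> turns the
quadratic term into \<open>\<epsilon>\<^sup>2 tr H / (2 (m + 2))\<close>. The sum of supremum and infimum contributes
\<open>\<epsilon>\<^sup>2 (H g \<bullet> g) / |g|\<^sup>2\<close> if \<open>g \<noteq> 0\<close>, and nothing if \<open>g\<close> and \<open>H\<close> both vanish. With the weights \<open>\<alpha>\<close> and \<open>\<beta>\<close> the
mean value is therefore \<open>\<phi> z\<close> plus a positive multiple of \<open>\<epsilon>\<^sup>2\<close> times diffusion minus transport, up to
\<open>o(\<epsilon>\<^sup>2)\<close> (\<open>mean_value_expansion\<close>). For such \<open>\<phi>\<close> the mean value inequality and the viscosity inequality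
are thus the same condition (\<open>mean_value_inequality_iff\<close>).

The viscosity inequalities also constrain test functions with \<open>g = 0\<close> and \<open>H \<noteq> 0\<close>, on which the mean
value formula is silent. They follow from the other ones (\<open>degenerate_test_inequality\<close>). Shift \<open>\<phi>\<close> by
small vectors \<open>a\<close> in the \<open>X\<close> direction and let \<open>f a\<close> be the minimum of \<open>u\<close> minus the shifted function
near \<open>z\<close>. If there are arbitrarily small \<open>a\<close> for which the gradient at a minimizer is nonzero, then the
unrelaxed inequality holds there, and its limit is the relaxed inequality at \<open>z\<close>, because Rayleigh
quotients are bounded by eigenvalues. Otherwise \<open>f\<close> has derivative zero, hence is constantly zero
(\<open>shifted_minimum_constant\<close>), and so \<open>\<phi> (X + a, Y, t) \<le> u (X, Y, t)\<close> near \<open>z\<close> for all small \<open>a\<close>. This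
forces \<open>H \<le> 0\<close>, and it makes \<open>\<phi>\<close> with its \<open>X\<close> variable fixed at the contact point a test function with
vanishing gradient and Hessian, so \<open>\<tau> \<ge> 0\<close>; together these give the relaxed inequality.

Test functions have to touch \<open>u\<close> strictly on all of \<open>D\<close>, whereas the constructions above are local.
A cutoff interpolates between the local function and the given \<open>\<phi>\<close> (\<open>touches_below_localize\<close>).
All of this is done for contact from below; the other half follows by passing to \<open>- u\<close>.
\<close>

section \<open>Derivatives of twice continuously differentiable functions\<close>

text \<open>The gradient of \<open>\<phi>\<close> is carried by a vector field \<open>g\<close> and the Hessian by the operators \<open>G z\<close>. With
vectors in place of bounded linear functionals, the product and chain rules below are instances of
the ordinary derivative rules, and continuity of the Hessian can be tested on basis vectors.\<close>

definition C2_jet :: "'a::euclidean_space set \<Rightarrow> ('a \<Rightarrow> real) \<Rightarrow> ('a \<Rightarrow> 'a) \<Rightarrow> ('a \<Rightarrow> 'a \<Rightarrow> 'a) \<Rightarrow> bool" where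
  "C2_jet D \<phi> g G \<longleftrightarrow>
     (\<forall>z\<in>D. (\<phi> has_derivative (\<lambda>h. g z \<bullet> h)) (at z)) \<and>
     (\<forall>z\<in>D. (g has_derivative G z) (at z)) \<and>
     (\<forall>b\<in>Basis. continuous_on D (\<lambda>z. G z b))"

lemma C2_jetD:
  assumes "C2_jet D \<phi> g G"
  shows "\<And>z. z \<in> D \<Longrightarrow> (\<phi> has_derivative (\<lambda>h. g z \<bullet> h)) (at z)"
    and "\<And>z. z \<in> D \<Longrightarrow> (g has_derivative G z) (at z)"
    and "\<And>b. b \<in> Basis \<Longrightarrow> continuous_on D (\<lambda>z. G z b)"
    and "\<And>z. z \<in> D \<Longrightarrow> linear (G z)"
    and "continuous_on D \<phi>" "continuous_on D g"
  using assms unfolding C2_jet_def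
  by (auto intro: has_derivative_linear has_derivative_continuous
      intro!: continuous_at_imp_continuous_on)

lemma C2_jet_continuous_hessian:
  assumes "C2_jet D \<phi> g G"
  shows "continuous_on D (\<lambda>z. G z v)"
proof -
  have "continuous_on D (\<lambda>z. \<Sum>b\<in>Basis. (v \<bullet> b) *\<^sub>R G z b)"
    by (intro continuous_intros C2_jetD(3)[OF assms])
  moreover have "(\<Sum>b\<in>Basis. (v \<bullet> b) *\<^sub>R G z b) = G z v" if "z \<in> D" for z
  proof -
    have "G z v = G z (\<Sum>b\<in>Basis. (v \<bullet> b) *\<^sub>R b)" by (simp add: euclidean_representation)
    also have "\<dots> = (\<Sum>b\<in>Basis. (v \<bullet> b) *\<^sub>R G z b)"
      using C2_jetD(4)[OF assms that] by (simp add: linear_sum linear_scale)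
    finally show ?thesis by simp
  qed
  ultimately show ?thesis by (simp cong: continuous_on_cong)
qed

lemma C2_on_iff_jet: "C2_on D \<phi> \<longleftrightarrow> (\<exists>g G. C2_jet D \<phi> g G)"
proof
  assume "C2_on D \<phi>"
  then obtain \<phi>' :: "'a \<Rightarrow> 'a \<Rightarrow>\<^sub>L real" and \<phi>'' :: "'a \<Rightarrow> 'a \<Rightarrow>\<^sub>L 'a \<Rightarrow>\<^sub>L real"
    where 1: "\<And>z. z \<in> D \<Longrightarrow> (\<phi> has_derivative blinfun_apply (\<phi>' z)) (at z)"
      and 2: "\<And>z. z \<in> D \<Longrightarrow> (\<phi>' has_derivative blinfun_apply (\<phi>'' z)) (at z)"
      and 3: "continuous_on D \<phi>''"
    unfolding C2_on_def by blast
  define g where "g z = (\<Sum>b\<in>Basis. \<phi>' z b *\<^sub>R b)" for z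
  define G where "G z h = (\<Sum>b\<in>Basis. \<phi>'' z h b *\<^sub>R b)" for z h
  have gi: "blinfun_apply (\<phi>' z) = (\<bullet>) (g z)" for z
  proof
    fix h
    have "\<phi>' z h = \<phi>' z (\<Sum>b\<in>Basis. (h \<bullet> b) *\<^sub>R b)" by (simp add: euclidean_representation)
    also have "\<dots> = g z \<bullet> h"
      by (simp only: g_def blinfun.sum_right blinfun.scaleR_right inner_sum_left inner_scaleR_left real_scaleR_def)
        (simp add: inner_commute mult.commute)
    finally show "\<phi>' z h = g z \<bullet> h" .
  qed
  have "(g has_derivative G z) (at z)" if "z \<in> D" for z
    unfolding g_def G_def
    by (auto intro!: derivative_eq_intros 2[OF that] simp: blinfun.bilinear_simps)
  moreover have "continuous_on D (\<lambda>z. G z b)" for b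
    unfolding G_def by (intro continuous_intros 3)
  ultimately have "C2_jet D \<phi> g G" using 1 gi unfolding C2_jet_def by auto
  then show "\<exists>g G. C2_jet D \<phi> g G" by blast
next
  assume "\<exists>g G. C2_jet D \<phi> g G"
  then obtain g G where j: "C2_jet D \<phi> g G" by blast
  have bl: "bounded_linear (\<lambda>h. blinfun_inner_right (G z h))" if "z \<in> D" for z
    using C2_jetD(4)[OF j that] bounded_linear_compose[OF bounded_linear_blinfun_inner_right]
    by (simp add: linear_conv_bounded_linear)
  show "C2_on D \<phi>" unfolding C2_on_def
  proof (intro exI conjI ballI)
    fix z assume z: "z \<in> D"
    show "(\<phi> has_derivative blinfun_apply (blinfun_inner_right (g z))) (at z)"
      using C2_jetD(1)[OF j z] by simp
    have "((\<lambda>z. blinfun_inner_right (g z)) has_derivative (\<lambda>h. blinfun_inner_right (G z h))) (at z)"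
      by (rule bounded_linear.has_derivative[OF bounded_linear_blinfun_inner_right C2_jetD(2)[OF j z]])
    then show "((\<lambda>z. blinfun_inner_right (g z)) has_derivative
       blinfun_apply (Blinfun (\<lambda>h. blinfun_inner_right (G z h)))) (at z)"
      using bounded_linear_Blinfun_apply[OF bl[OF z]] by simp
  next
    show "continuous_on D (\<lambda>z. Blinfun (\<lambda>h. blinfun_inner_right (G z h)))"
    proof (rule continuous_on_blinfun_componentwise)
      fix b :: 'a assume "b \<in> Basis"
      have "continuous_on D (\<lambda>z. blinfun_inner_right (G z b))"
        by (rule bounded_linear.continuous_on[OF bounded_linear_blinfun_inner_right C2_jetD(3)[OF j \<open>b \<in> Basis\<close>]])
      then show "continuous_on D (\<lambda>z. Blinfun (\<lambda>h. blinfun_inner_right (G z h)) b)"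
        using bounded_linear_Blinfun_apply[OF bl] by (simp cong: continuous_on_cong)
    qed
  qed
qed

text \<open>Uniqueness of derivatives on open sets is what allows functions given by different formulas on
overlapping open sets to be glued.\<close>

lemma C2_jet_unique:
  assumes "C2_jet N \<phi> g G" "C2_jet N' \<phi> g' G'" "open N" "open N'" "z \<in> N" "z \<in> N'"
  shows "g z = g' z" "G z = G' z"
proof -
  have eq: "g w = g' w" if "w \<in> N \<inter> N'" for w
  proof -
    have "(\<lambda>h. g w \<bullet> h) = (\<lambda>h. g' w \<bullet> h)"
      using that C2_jetD(1)[OF assms(1)] C2_jetD(1)[OF assms(2)] has_derivative_unique
      by (metis IntD1 IntD2)
    then show ?thesis by (metis vector_eq_rdot)
  qed
  show "g z = g' z" using eq assms by auto
  have "(g has_derivative G' z) (at z)"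
    by (rule has_derivative_transform_within_open[OF C2_jetD(2)[OF assms(2)], of _ "N \<inter> N'"])
      (use assms eq in auto)
  then show "G z = G' z"
    using C2_jetD(2)[OF assms(1)] assms(5) has_derivative_unique by blast
qed

lemma C2_jet_cong:
  assumes "C2_jet N \<phi> g G" "open N" "\<And>w. w \<in> N \<Longrightarrow> \<psi> w = \<phi> w"
  shows "C2_jet N \<psi> g G"
  using assms unfolding C2_jet_def
  by (metis has_derivative_transform_within_open)

lemma C2_jet_subset: "C2_jet D \<phi> g G \<Longrightarrow> N \<subseteq> D \<Longrightarrow> C2_jet N \<phi> g G"
  unfolding C2_jet_def by (auto intro: continuous_on_subset)

text \<open>Local derivatives agree where their domains overlap, so any choice of them at each point produces
globally defined fields. Test functions built with a cutoff are regular for this reason: away from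
the support of the cutoff they are given by another formula.\<close>

lemma C2_on_local:
  assumes "\<And>z. z \<in> D \<Longrightarrow> \<exists>N. open N \<and> z \<in> N \<and> C2_on N \<phi>"
  shows "C2_on D \<phi>"
proof -
  define P where "P z N g G \<longleftrightarrow> open N \<and> z \<in> N \<and> C2_jet N \<phi> g G" for z N g G
  have "\<forall>z\<in>D. \<exists>N g G. P z N g G" using assms unfolding P_def C2_on_iff_jet by metis
  then obtain N g G where NgG: "\<And>z. z \<in> D \<Longrightarrow> P z (N z) (g z) (G z)" by metis
  \<comment> \<open>by uniqueness, the chosen values coincide with those of every local pair of derivatives\<close>
  define h where "h z = (SOME v. \<exists>N g G. P z N g G \<and> v = g z)" for z
  define H where "H z = (SOME V. \<exists>N g G. P z N g G \<and> V = G z)" for z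
  have h: "h w = g' w \<and> H w = G' w" if "P w N' g' G'" for w N' g' G'
  proof -
    have "\<exists>v. \<exists>N g G. P w N g G \<and> v = g w" "\<exists>V. \<exists>N g G. P w N g G \<and> V = G w"
      using that by blast+
    from someI_ex[OF this(1)] someI_ex[OF this(2)]
    obtain N1 g1 G1 N2 g2 G2 where 1: "P w N1 g1 G1" "h w = g1 w" "P w N2 g2 G2" "H w = G2 w"
      unfolding h_def H_def by blast
    then show ?thesis
      using that C2_jet_unique[of N1 \<phi> g1 G1 N' g' G' w] C2_jet_unique[of N2 \<phi> g2 G2 N' g' G' w]
      unfolding P_def by auto
  qed
  have j: "C2_jet (N z) \<phi> h H" if "z \<in> D" for z
  proof -
    have *: "C2_jet (N z) \<phi> (g z) (G z)" "open (N z)" using NgG[OF that] unfolding P_def by auto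
    have eq: "h w = g z w" "H w = G z w" if "w \<in> N z" for w
      using h[of w "N z" "g z" "G z"] * that unfolding P_def by auto
    show ?thesis unfolding C2_jet_def
    proof (intro conjI ballI)
      fix w assume w: "w \<in> N z"
      show "(\<phi> has_derivative (\<bullet>) (h w)) (at w)" using C2_jetD(1)[OF *(1) w] eq[OF w] by simp
      show "(h has_derivative H w) (at w)"
        using has_derivative_transform_within_open[OF C2_jetD(2)[OF *(1) w] *(2) w, of h] eq[OF w] eq(1)
        by (metis)
    next
      fix b :: 'a assume "b \<in> Basis"
      show "continuous_on (N z) (\<lambda>w. H w b)"
        using C2_jetD(3)[OF *(1) \<open>b \<in> Basis\<close>] eq by (simp cong: continuous_on_cong)
    qed
  qed
  have "C2_jet D \<phi> h H" unfolding C2_jet_def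
  proof (intro conjI ballI)
    fix z assume "z \<in> D"
    moreover from this have "z \<in> N z" using NgG unfolding P_def by auto
    ultimately show "(\<phi> has_derivative (\<bullet>) (h z)) (at z)" "(h has_derivative H z) (at z)"
      using C2_jetD(1,2)[OF j] by blast+
  next
    fix b :: 'a assume b: "b \<in> Basis"
    show "continuous_on D (\<lambda>w. H w b)"
    proof (rule continuous_at_imp_continuous_on, intro ballI)
      fix z assume z: "z \<in> D"
      then have "z \<in> N z" "open (N z)" using NgG unfolding P_def by auto
      then show "isCont (\<lambda>w. H w b) z"
        using C2_jetD(3)[OF j[OF z] b] continuous_on_eq_continuous_at by blast
    qed
  qed
  then show ?thesis unfolding C2_on_iff_jet by blast
qed

lemma C2_jet_const: "C2_jet D (\<lambda>z. c) (\<lambda>z. 0) (\<lambda>z h. 0)"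
  unfolding C2_jet_def by (auto intro!: derivative_eq_intros)

lemma C2_jet_add:
  assumes "C2_jet D \<phi> g G" "C2_jet D \<psi> g' G'"
  shows "C2_jet D (\<lambda>z. \<phi> z + \<psi> z) (\<lambda>z. g z + g' z) (\<lambda>z h. G z h + G' z h)"
  unfolding C2_jet_def
  by (auto intro!: derivative_eq_intros continuous_intros C2_jetD[OF assms(1)] C2_jetD[OF assms(2)]
      simp: inner_add_left)

lemma C2_jet_minus:
  assumes "C2_jet D \<phi> g G"
  shows "C2_jet D (\<lambda>z. - \<phi> z) (\<lambda>z. - g z) (\<lambda>z h. - G z h)"
  unfolding C2_jet_def
  by (auto intro!: derivative_eq_intros continuous_intros C2_jetD[OF assms(1)])

lemma C2_jet_mult:
  assumes "C2_jet D \<phi> g G" "C2_jet D \<psi> g' G'"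
  shows "C2_jet D (\<lambda>z. \<phi> z * \<psi> z) (\<lambda>z. \<phi> z *\<^sub>R g' z + \<psi> z *\<^sub>R g z)
     (\<lambda>z h. \<phi> z *\<^sub>R G' z h + (g z \<bullet> h) *\<^sub>R g' z + (\<psi> z *\<^sub>R G z h + (g' z \<bullet> h) *\<^sub>R g z))"
  unfolding C2_jet_def
  by (auto intro!: derivative_eq_intros continuous_intros C2_jetD[OF assms(1)] C2_jetD[OF assms(2)]
      simp: algebra_simps)

lemma C2_jet_compose:
  fixes q :: "real \<Rightarrow> real"
  assumes "C2_jet D \<phi> g G"
    and "\<And>s. (q has_real_derivative q' s) (at s)" "\<And>s. (q' has_real_derivative q'' s) (at s)"
    and "continuous_on UNIV q''"
  shows "C2_jet D (\<lambda>z. q (\<phi> z)) (\<lambda>z. q' (\<phi> z) *\<^sub>R g z)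
     (\<lambda>z h. q' (\<phi> z) *\<^sub>R G z h + (q'' (\<phi> z) * (g z \<bullet> h)) *\<^sub>R g z)"
proof -
  have q: "((\<lambda>z. q (\<phi> z)) has_derivative (\<lambda>h. q' (\<phi> z) * (g z \<bullet> h))) (at z)"
    "((\<lambda>z. q' (\<phi> z)) has_derivative (\<lambda>h. q'' (\<phi> z) * (g z \<bullet> h))) (at z)" if "z \<in> D" for z
    using has_derivative_compose[OF C2_jetD(1)[OF assms(1) that]] assms(2,3)
    unfolding has_field_derivative_def by blast+
  have [continuous_intros]: "continuous_on D (\<lambda>z. q' (\<phi> z))" "continuous_on D (\<lambda>z. q'' (\<phi> z))"
    subgoal using q(2) by (auto intro!: continuous_at_imp_continuous_on has_derivative_continuous)
    subgoal using assms(4) C2_jetD(5)[OF assms(1)] by (rule continuous_on_compose2) auto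
    done
  have e: "(\<bullet>) (q' (\<phi> z) *\<^sub>R g z) = (\<lambda>h. q' (\<phi> z) * (g z \<bullet> h))" for z by auto
  show ?thesis
    unfolding C2_jet_def e
    by (auto intro!: derivative_eq_intros continuous_intros q C2_jetD[OF assms(1)])
qed

lemma C2_jet_translate:
  assumes "C2_jet D \<phi> g G" "\<And>z. z \<in> D' \<Longrightarrow> z + a \<in> D"
  shows "C2_jet D' (\<lambda>z. \<phi> (z + a)) (\<lambda>z. g (z + a)) (\<lambda>z. G (z + a))"
proof -
  have "((\<lambda>z. \<phi> (z + a)) has_derivative (\<bullet>) (g (z + a))) (at z)"
    "((\<lambda>z. g (z + a)) has_derivative G (z + a)) (at z)" if "z \<in> D'" for z
  proof -
    have "((\<lambda>z. z + a) has_derivative (\<lambda>h. h)) (at z)" by (auto intro!: derivative_eq_intros)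
    from has_derivative_compose[OF this] C2_jetD(1,2)[OF assms(1) assms(2)[OF that]]
    show "((\<lambda>z. \<phi> (z + a)) has_derivative (\<bullet>) (g (z + a))) (at z)"
      "((\<lambda>z. g (z + a)) has_derivative G (z + a)) (at z)" by blast+
  qed
  moreover have "continuous_on D' (\<lambda>z. G (z + a) b)" if "b \<in> Basis" for b
    by (rule continuous_on_compose2[OF C2_jetD(3)[OF assms(1) that]])
      (use assms(2) in \<open>auto intro!: continuous_intros\<close>)
  ultimately show ?thesis unfolding C2_jet_def by auto
qed

lemma C2_jet_norm_power2: "C2_jet D (\<lambda>z. (norm (z - a))\<^sup>2) (\<lambda>z. 2 *\<^sub>R (z - a)) (\<lambda>z h. 2 *\<^sub>R h)"
  unfolding C2_jet_def power2_norm_eq_inner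
  by (auto intro!: derivative_eq_intros continuous_intros simp: inner_commute)

lemma C2_jet_norm_power4:
  "C2_jet D (\<lambda>z. (norm (z - a))^4) (\<lambda>z. (4 * (norm (z - a))\<^sup>2) *\<^sub>R (z - a))
     (\<lambda>z h. (4 * (norm (z - a))\<^sup>2) *\<^sub>R h + (8 * ((z - a) \<bullet> h)) *\<^sub>R (z - a))"
proof -
  have "C2_jet D (\<lambda>z. ((norm (z - a))\<^sup>2)\<^sup>2) (\<lambda>z. (2 * (norm (z - a))\<^sup>2) *\<^sub>R 2 *\<^sub>R (z - a))
     (\<lambda>z h. (2 * (norm (z - a))\<^sup>2) *\<^sub>R 2 *\<^sub>R h + (2 * (2 *\<^sub>R (z - a) \<bullet> h)) *\<^sub>R 2 *\<^sub>R (z - a))"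
    by (rule C2_jet_compose[OF C2_jet_norm_power2, where q = "\<lambda>s. s\<^sup>2" and q' = "\<lambda>s. 2 * s" and q'' = "\<lambda>s. 2"])
      (auto intro!: derivative_eq_intros)
  then show ?thesis by simp
qed

text \<open>The third power is the smallest one that keeps two continuous derivatives across the origin.\<close>

definition pos3 :: "real \<Rightarrow> real" where "pos3 s = (max 0 s)^3"

lemma pos3_derivs:
  "(pos3 has_real_derivative 3 * (max 0 s)\<^sup>2) (at s)"
  "((\<lambda>s. 3 * (max 0 s)\<^sup>2) has_real_derivative 6 * max 0 s) (at s)"
proof -
  have *: "((\<lambda>s. (max 0 s) ^ Suc (Suc n)) has_real_derivative real (Suc (Suc n)) * (max 0 s) ^ Suc n) (at s)"
    for n :: nat and s :: real
  proof (rule linorder_cases[of s 0])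
    assume s: "s < 0"
    have "((\<lambda>s. 0) has_real_derivative real (Suc (Suc n)) * (max 0 s) ^ Suc n) (at s)"
      using s by simp
    then show ?thesis
      by (rule has_field_derivative_transform_within_open[of _ _ _ "{..<0}"]) (use s in auto)
  next
    assume s: "s > 0"
    have "((\<lambda>s. s ^ Suc (Suc n)) has_real_derivative real (Suc (Suc n)) * (max 0 s) ^ Suc n) (at s)"
      using DERIV_pow[of "Suc (Suc n)" s] s by (simp add: max_def)
    then show ?thesis
      by (rule has_field_derivative_transform_within_open[of _ _ _ "{0<..}"]) (use s in auto)
  next
    assume s: "s = 0"
    have "(\<lambda>h. (max 0 h) ^ Suc n) \<midarrow>0\<rightarrow> (max 0 (0::real)) ^ Suc n"
      by (intro tendsto_intros)
    then have lim: "(\<lambda>h. (max 0 h) ^ Suc n) \<midarrow>0\<rightarrow> (0::real)" by simp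
    have "(\<lambda>h. (max 0 (0 + h)) ^ Suc (Suc n) / h) \<midarrow>0\<rightarrow> (0::real)"
      by (rule Lim_transform_eventually[OF lim]) 
        (auto simp: eventually_at_filter max_def intro!: always_eventually)
    then show ?thesis using s by (simp add: DERIV_def)
  qed
  have p: "pos3 = (\<lambda>s. (max 0 s)^3)" by (auto simp: pos3_def)
  show "(pos3 has_real_derivative 3 * (max 0 s)\<^sup>2) (at s)"
    unfolding p using *[of 1 s] by (simp add: eval_nat_numeral)
  show "((\<lambda>s. 3 * (max 0 s)\<^sup>2) has_real_derivative 6 * max 0 s) (at s)"
    using DERIV_cmult[OF *[of 0 s], of 3] by (simp add: eval_nat_numeral algebra_simps)
qed

text \<open>With \<open>s = |z - a|\<^sup>2 / r\<^sup>2\<close> and \<open>q = pos3\<close>, the cutoff is \<open>1 - q (1 - q (2 - s))\<close>: for \<open>s \<le> 1\<close> the inner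
cube is at least \<open>1\<close> and the outer one vanishes, and for \<open>s \<ge> 2\<close> the inner cube vanishes and the
outer one is \<open>1\<close>; in particular this holds at distance \<open>2 r\<close> from \<open>a\<close>. Using the squared norm keeps the composition smooth at \<open>a\<close>.\<close>

lemma C2_on_cutoff:
  fixes a :: "'a::euclidean_space"
  assumes "r > 0"
  obtains \<eta> where "C2_on D \<eta>" "\<And>z. 0 \<le> \<eta> z" "\<And>z. \<eta> z \<le> 1"
    "\<And>z. norm (z - a) \<le> r \<Longrightarrow> \<eta> z = 1" "\<And>z. norm (z - a) \<ge> 2 * r \<Longrightarrow> \<eta> z = 0"
proof
  define \<eta> where "\<eta> z = 1 + - pos3 (1 + - pos3 (2 + - ((norm (z - a))\<^sup>2 * (1 / r\<^sup>2))))" for z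
  have c: "\<exists>g G. C2_jet D (\<lambda>z. pos3 (f z)) g G" if "\<exists>g G. C2_jet D f g G" for f :: "'a \<Rightarrow> real"
  proof -
    have "continuous_on UNIV (\<lambda>s::real. 6 * max 0 s)" by (intro continuous_intros)
    with that C2_jet_compose[OF _ pos3_derivs] show ?thesis by blast
  qed
  have m: "\<exists>g G. C2_jet D (\<lambda>z. k + - f z) g G" if "\<exists>g G. C2_jet D f g G" for f :: "'a \<Rightarrow> real" and k
    using that C2_jet_minus C2_jet_add C2_jet_const by blast
  have "\<exists>g G. C2_jet D (\<lambda>z. (norm (z - a))\<^sup>2 * (1 / r\<^sup>2)) g G"
    using C2_jet_mult C2_jet_norm_power2 C2_jet_const by blast
  then show "C2_on D \<eta>" unfolding C2_on_iff_jet \<eta>_def by (intro c m)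
  have le1: "pos3 s \<le> 1" if "s \<le> 1" for s unfolding pos3_def by (rule power_le_one) (use that in auto)
  have ge0: "pos3 s \<ge> 0" for s unfolding pos3_def by simp
  show "0 \<le> \<eta> z" "\<eta> z \<le> 1" for z
    unfolding \<eta>_def using ge0 le1 by (smt (verit, best))+
  show "\<eta> z = 1" if "norm (z - a) \<le> r" for z
  proof -
    have "(norm (z - a))\<^sup>2 \<le> r\<^sup>2" using that by (simp add: power_mono)
    then have "1 \<le> 2 + - ((norm (z - a))\<^sup>2 * (1 / r\<^sup>2))" using assms by (simp add: field_simps)
    then have "pos3 (2 + - ((norm (z - a))\<^sup>2 * (1 / r\<^sup>2))) \<ge> 1"
      unfolding pos3_def by (intro one_le_power) auto
    then show ?thesis unfolding \<eta>_def by (simp add: pos3_def[of "1 - _"])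
  qed
  show "\<eta> z = 0" if "norm (z - a) \<ge> 2 * r" for z
  proof -
    have "(norm (z - a))\<^sup>2 \<ge> (2 * r)\<^sup>2" using that assms by (intro power_mono) auto
    then have "4 * r\<^sup>2 \<le> (norm (z - a))\<^sup>2" by (simp add: power_mult_distrib)
    then have "2 * r\<^sup>2 \<le> (norm (z - a))\<^sup>2" using zero_le_power2[of r] by linarith
    then have "2 + - ((norm (z - a))\<^sup>2 * (1 / r\<^sup>2)) \<le> 0"
      using assms by (simp add: field_simps)
    then have "pos3 (2 + - ((norm (z - a))\<^sup>2 * (1 / r\<^sup>2))) = 0"
      unfolding pos3_def by simp
    then show ?thesis unfolding \<eta>_def by (simp add: pos3_def)
  qed
qed

section \<open>Second-order Taylor expansion\<close>

text \<open>The remainder along the ray \<open>z + s k\<close> has derivative \<open>(g (z + s k) - g z - s G z k) \<bullet> k\<close>, and this is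
\<open>o(|k|\<^sup>2)\<close> uniformly in \<open>0 \<le> s \<le> 1\<close> because \<open>g\<close> is differentiable at \<open>z\<close>.\<close>

lemma C2_jet_taylor:
  fixes z :: "'a::euclidean_space"
  assumes "C2_jet N \<phi> g G" "open N" "z \<in> N" "\<delta> > 0"
  obtains d where "d > 0"
    "\<And>k. norm k < d \<Longrightarrow> \<bar>\<phi> (z + k) - \<phi> z - g z \<bullet> k - (G z k \<bullet> k) / 2\<bar> \<le> \<delta> * (norm k)\<^sup>2"
proof -
  obtain d1 where d1: "d1 > 0" "\<And>y. norm (y - z) < d1 \<Longrightarrow> norm (g y - g z - G z (y - z)) \<le> \<delta> * norm (y - z)"
    using C2_jetD(2)[OF assms(1,3)] assms(4) unfolding has_derivative_at_alt by blast
  obtain d2 where d2: "d2 > 0" "ball z d2 \<subseteq> N" using assms(2,3) openE by blast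
  have lin: "linear (G z)" using C2_jetD(4)[OF assms(1,3)] .
  show ?thesis
  proof (rule that[of "min d1 d2"])
    show "0 < min d1 d2" using d1 d2 by simp
    fix k :: 'a assume k: "norm k < min d1 d2"
    define e where "e s = \<phi> (z + s *\<^sub>R k) - s * (g z \<bullet> k) - s\<^sup>2 * (G z k \<bullet> k) / 2" for s :: real
    have inN: "z + s *\<^sub>R k \<in> N" "norm (s *\<^sub>R k) < d1" "norm (s *\<^sub>R k) \<le> norm k" if "0 \<le> s" "s \<le> 1" for s
    proof -
      have "norm (s *\<^sub>R k) \<le> norm k" using that by (simp add: mult_left_le_one_le)
      then show "z + s *\<^sub>R k \<in> N" "norm (s *\<^sub>R k) < d1" "norm (s *\<^sub>R k) \<le> norm k"
        using k d2(2) by (auto simp: subset_iff dist_norm)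
    qed
    have e': "(e has_real_derivative (g (z + s *\<^sub>R k) - g z - s *\<^sub>R G z k) \<bullet> k) (at s)" if "0 \<le> s" "s \<le> 1" for s
    proof -
      have "((\<lambda>s. z + s *\<^sub>R k) has_derivative (\<lambda>h. h *\<^sub>R k)) (at s)"
        by (auto intro!: derivative_eq_intros)
      from has_derivative_compose[OF this C2_jetD(1)[OF assms(1) inN(1)[OF that]]]
      have "((\<lambda>s. \<phi> (z + s *\<^sub>R k)) has_real_derivative g (z + s *\<^sub>R k) \<bullet> k) (at s)"
        unfolding has_field_derivative_def by (rule has_derivative_eq_rhs) (auto simp: mult.commute)
      then show ?thesis unfolding e_def
        by (auto intro!: derivative_eq_intros simp: algebra_simps)
    qed
    obtain \<xi> where \<xi>: "0 < \<xi>" "\<xi> < 1" "e 1 - e 0 = (1 - 0) * ((g (z + \<xi> *\<^sub>R k) - g z - \<xi> *\<^sub>R G z k) \<bullet> k)"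
      using MVT2[of 0 1 e "\<lambda>s. (g (z + s *\<^sub>R k) - g z - s *\<^sub>R G z k) \<bullet> k"] e' by auto
    have "norm (g (z + \<xi> *\<^sub>R k) - g z - \<xi> *\<^sub>R G z k) \<le> \<delta> * norm k"
      using d1(2)[of "z + \<xi> *\<^sub>R k"] inN[of \<xi>] \<xi> linear_scale[OF lin, of \<xi> k] assms(4)
      by (smt (verit) add_diff_cancel_left' mult_left_mono)
    then have "\<bar>(g (z + \<xi> *\<^sub>R k) - g z - \<xi> *\<^sub>R G z k) \<bullet> k\<bar> \<le> \<delta> * norm k * norm k"
      using Cauchy_Schwarz_ineq2 by (meson mult_right_mono norm_ge_zero order_trans)
    moreover have "e 1 - e 0 = \<phi> (z + k) - \<phi> z - g z \<bullet> k - (G z k \<bullet> k) / 2"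
      unfolding e_def by simp
    ultimately show "\<bar>\<phi> (z + k) - \<phi> z - g z \<bullet> k - (G z k \<bullet> k) / 2\<bar> \<le> \<delta> * (norm k)\<^sup>2"
      using \<xi>(3) by (simp add: power2_eq_square mult.assoc)
  qed
qed

text \<open>The second difference of \<open>\<phi>\<close> over the parallelogram spanned by \<open>t h\<close> and \<open>t k\<close> is symmetric in \<open>h\<close> and
\<open>k\<close>. By the mean value theorem in the direction \<open>h\<close> it equals \<open>t\<^sup>2 (G z k \<bullet> h) + o(t\<^sup>2)\<close>.\<close>

lemma C2_jet_symmetric:
  fixes z :: "'a::euclidean_space"
  assumes "C2_jet N \<phi> g G" "open N" "z \<in> N"
  shows "G z h \<bullet> k = G z k \<bullet> h"
proof -
  have lin: "linear (G z)" using C2_jetD(4)[OF assms(1,3)] .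
  define B where "B = 1 + norm h + norm k"
  have B: "B \<ge> 1" "norm h \<le> B" "norm k \<le> B" unfolding B_def by auto
  have main: "\<bar>G z h \<bullet> k - G z k \<bullet> h\<bar> \<le> 4 * \<delta> * B\<^sup>2" if \<delta>: "\<delta> > 0" for \<delta>
  proof -
    obtain d1 where d1: "d1 > 0" "\<And>y. norm (y - z) < d1 \<Longrightarrow> norm (g y - g z - G z (y - z)) \<le> \<delta> * norm (y - z)"
      using C2_jetD(2)[OF assms(1,3)] \<delta> unfolding has_derivative_at_alt by blast
    obtain d2 where d2: "d2 > 0" "ball z d2 \<subseteq> N" using assms(2,3) openE by blast
    \<comment> \<open>keeps the parallelogram inside both balls; the factor \<open>2\<close> makes the bounds strict\<close>
    define t where "t = min d1 d2 / (2 * B)"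
    have t: "t > 0" "t * B < d1" "t * B < d2"
    proof -
      have "t * B = min d1 d2 / 2" using B(1) unfolding t_def by (simp add: field_simps)
      moreover have "0 < min d1 d2" "min d1 d2 \<le> d1" "min d1 d2 \<le> d2" using d1(1) d2(1) by simp_all
      ultimately show "t > 0" "t * B < d1" "t * B < d2" using B(1) d1(1) d2(1) unfolding t_def by (simp, linarith+)
    qed
    have claim: "\<bar>(\<phi> (z + t *\<^sub>R h + t *\<^sub>R k) - \<phi> (z + t *\<^sub>R h) - \<phi> (z + t *\<^sub>R k) + \<phi> z) - t\<^sup>2 * (G z k \<bullet> h)\<bar>
        \<le> 2 * \<delta> * t\<^sup>2 * B\<^sup>2"
      if hk: "B = 1 + norm h + norm k" for h k
    proof -
      have nrm: "norm (s *\<^sub>R h + r *\<^sub>R k) \<le> t * B" if "0 \<le> s" "s \<le> t" "0 \<le> r" "r \<le> t" for s r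
      proof -
        have "norm (s *\<^sub>R h + r *\<^sub>R k) \<le> s * norm h + r * norm k"
          using norm_triangle_ineq[of "s *\<^sub>R h" "r *\<^sub>R k"] that by simp
        also have "\<dots> \<le> t * norm h + t * norm k"
          using that by (intro add_mono mult_right_mono) auto
        also have "\<dots> \<le> t * B" using t(1) unfolding hk by (simp add: algebra_simps)
        finally show ?thesis .
      qed
      have inN: "z + s *\<^sub>R h + r *\<^sub>R k \<in> N" if "0 \<le> s" "s \<le> t" "0 \<le> r" "r \<le> t" for s r
      proof -
        have "dist z (z + s *\<^sub>R h + r *\<^sub>R k) = norm (s *\<^sub>R h + r *\<^sub>R k)"
          by (simp add: dist_norm norm_minus_commute add.assoc, simp add: add.commute)
        then show ?thesis using nrm[OF that] t(3) d2(2) by (auto simp: subset_iff)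
      qed
      have est: "norm (g (z + s *\<^sub>R h + r *\<^sub>R k) - g z - G z (s *\<^sub>R h + r *\<^sub>R k)) \<le> \<delta> * (t * B)"
        if "0 \<le> s" "s \<le> t" "0 \<le> r" "r \<le> t" for s r
      proof -
        have "norm (g (z + s *\<^sub>R h + r *\<^sub>R k) - g z - G z (s *\<^sub>R h + r *\<^sub>R k)) \<le> \<delta> * norm (s *\<^sub>R h + r *\<^sub>R k)"
          using d1(2)[of "z + s *\<^sub>R h + r *\<^sub>R k"] nrm[OF that] t(2) by (simp add: add.assoc)
        also have "\<dots> \<le> \<delta> * (t * B)" using nrm[OF that] \<open>\<delta> > 0\<close> by (intro mult_left_mono) auto
        finally show ?thesis .
      qed
      have der: "((\<lambda>s. \<phi> (z + s *\<^sub>R h + r *\<^sub>R k)) has_real_derivative g (z + s *\<^sub>R h + r *\<^sub>R k) \<bullet> h) (at s)"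
        if "0 \<le> s" "s \<le> t" "0 \<le> r" "r \<le> t" for s r
      proof -
        have "((\<lambda>s. z + s *\<^sub>R h + r *\<^sub>R k) has_derivative (\<lambda>x. x *\<^sub>R h)) (at s)"
          by (auto intro!: derivative_eq_intros)
        from has_derivative_compose[OF this C2_jetD(1)[OF assms(1) inN[OF that]]]
        show ?thesis
          unfolding has_field_derivative_def by (rule has_derivative_eq_rhs) (auto simp: mult.commute)
      qed
      define e where "e s = \<phi> (z + s *\<^sub>R h + t *\<^sub>R k) - \<phi> (z + s *\<^sub>R h)" for s
      have "\<exists>\<xi>>0. \<xi> < t \<and> e t - e 0 = (t - 0) * (g (z + \<xi> *\<^sub>R h + t *\<^sub>R k) \<bullet> h - g (z + \<xi> *\<^sub>R h) \<bullet> h)"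
        unfolding e_def
        by (rule MVT2) (use t(1) der[of _ t] der[of _ 0] in \<open>auto intro!: derivative_intros\<close>)
      then obtain \<xi> where \<xi>: "0 < \<xi>" "\<xi> < t"
        and A: "e t - e 0 = t * ((g (z + \<xi> *\<^sub>R h + t *\<^sub>R k) - g (z + \<xi> *\<^sub>R h)) \<bullet> h)"
        by (auto simp: inner_diff_left)
      have e2: "norm (g (z + \<xi> *\<^sub>R h + t *\<^sub>R k) - g z - G z (\<xi> *\<^sub>R h + t *\<^sub>R k)) \<le> \<delta> * (t * B)"
        "norm (g (z + \<xi> *\<^sub>R h) - g z - G z (\<xi> *\<^sub>R h)) \<le> \<delta> * (t * B)"
        using est[of \<xi> t] est[of \<xi> 0] \<xi> t(1) by auto
      have eq: "(g (z + \<xi> *\<^sub>R h + t *\<^sub>R k) - g (z + \<xi> *\<^sub>R h)) - t *\<^sub>R G z k =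
          (g (z + \<xi> *\<^sub>R h + t *\<^sub>R k) - g z - G z (\<xi> *\<^sub>R h + t *\<^sub>R k)) - (g (z + \<xi> *\<^sub>R h) - g z - G z (\<xi> *\<^sub>R h))"
        by (simp add: linear_add[OF lin] linear_scale[OF lin])
      have n: "norm ((g (z + \<xi> *\<^sub>R h + t *\<^sub>R k) - g (z + \<xi> *\<^sub>R h)) - t *\<^sub>R G z k) \<le> 2 * \<delta> * (t * B)"
        unfolding eq by (rule order_trans[OF norm_triangle_ineq4]) (use e2 in linarith)
      have "\<bar>(e t - e 0) - t\<^sup>2 * (G z k \<bullet> h)\<bar> = t * \<bar>((g (z + \<xi> *\<^sub>R h + t *\<^sub>R k) - g (z + \<xi> *\<^sub>R h)) - t *\<^sub>R G z k) \<bullet> h\<bar>"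
      proof -
        have "(e t - e 0) - t\<^sup>2 * (G z k \<bullet> h) = t * (((g (z + \<xi> *\<^sub>R h + t *\<^sub>R k) - g (z + \<xi> *\<^sub>R h)) - t *\<^sub>R G z k) \<bullet> h)"
          unfolding A by (simp add: inner_diff_left right_diff_distrib power2_eq_square)
        then show ?thesis using t(1) by (simp add: abs_mult)
      qed
      also have "\<dots> \<le> t * (2 * \<delta> * (t * B) * B)"
      proof (intro mult_left_mono)
        have "norm h \<le> B" unfolding hk by simp
        with n have "norm ((g (z + \<xi> *\<^sub>R h + t *\<^sub>R k) - g (z + \<xi> *\<^sub>R h)) - t *\<^sub>R G z k) * norm h \<le> 2 * \<delta> * (t * B) * B"
          by (rule mult_mono) (use \<open>\<delta> > 0\<close> t(1) B(1) in auto)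
        then show "\<bar>((g (z + \<xi> *\<^sub>R h + t *\<^sub>R k) - g (z + \<xi> *\<^sub>R h)) - t *\<^sub>R G z k) \<bullet> h\<bar> \<le> 2 * \<delta> * (t * B) * B"
          by (rule order_trans[OF Cauchy_Schwarz_ineq2])
      qed (use t in auto)
      also have "\<dots> = 2 * \<delta> * t\<^sup>2 * B\<^sup>2" by (simp add: power2_eq_square)
      finally show ?thesis unfolding e_def by (simp add: algebra_simps)
    qed
    from claim[of h k] claim[of k h]
    have "\<bar>t\<^sup>2 * (G z h \<bullet> k) - t\<^sup>2 * (G z k \<bullet> h)\<bar> \<le> 4 * \<delta> * t\<^sup>2 * B\<^sup>2"
      unfolding B_def by (simp add: algebra_simps)
    then have "t\<^sup>2 * \<bar>G z h \<bullet> k - G z k \<bullet> h\<bar> \<le> t\<^sup>2 * (4 * \<delta> * B\<^sup>2)"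
      unfolding right_diff_distrib[symmetric] abs_mult by (simp add: mult_ac)
    then show ?thesis using t(1) by simp
  qed
  have "\<bar>G z h \<bullet> k - G z k \<bullet> h\<bar> \<le> 0"
  proof (rule field_le_epsilon)
    fix e :: real assume "e > 0"
    then show "\<bar>G z h \<bullet> k - G z k \<bullet> h\<bar> \<le> 0 + e"
      using main[of "e / (4 * B\<^sup>2)"] B by (simp add: divide_simps split: if_splits)
  qed
  then show ?thesis by simp
qed

lemma gradient_eqI:
  fixes f :: "real^'m \<Rightarrow> real"
  assumes "(f has_derivative (\<lambda>h. v \<bullet> h)) (at x)"
  shows "gradient f x = v"
proof -
  have "frechet_derivative f (at x) = (\<lambda>h. v \<bullet> h)" using frechet_derivative_at[OF assms] by simp
  then show ?thesis unfolding gradient_def by (simp add: vec_eq_iff inner_axis)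
qed

text \<open>The operators in the viscosity inequalities are defined from partial derivatives of slices of \<open>\<phi>\<close>;
this reads them off from the full gradient and Hessian.\<close>

lemma C2_jet_partials:
  fixes \<phi> :: "'m::finite point \<Rightarrow> real"
  assumes j: "C2_jet N \<phi> g G" "open N" "z \<in> N"
  shows "grad_X \<phi> z = fst (g z)" "grad_Y \<phi> z = fst (snd (g z))" "d_t \<phi> z = snd (snd (g z))"
    "hess_X \<phi> z *v h = fst (G z (h, 0))"
proof -
  obtain X Y t where z: "z = (X, Y, t)" using prod_cases3 by blast
  have gX: "gradient (\<lambda>x. \<phi> (x, Y, t)) x = fst (g (x, Y, t))" if "(x, Y, t) \<in> N" for x
  proof (rule gradient_eqI)
    have "((\<lambda>x. (x, Y, t)) has_derivative (\<lambda>h. (h, 0, 0))) (at x)"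
      by (auto intro!: derivative_eq_intros simp: zero_prod_def)
    from has_derivative_compose[OF this C2_jetD(1)[OF j(1) that]]
    show "((\<lambda>x. \<phi> (x, Y, t)) has_derivative (\<bullet>) (fst (g (x, Y, t)))) (at x)"
      by (rule has_derivative_eq_rhs) (auto simp: inner_prod_def)
  qed
  show "grad_X \<phi> z = fst (g z)" using gX j(3) unfolding grad_X_def z by simp
  have "((\<lambda>x. (X, x, t)) has_derivative (\<lambda>h. (0, h, 0))) (at Y)"
    by (auto intro!: derivative_eq_intros simp: zero_prod_def)
  from has_derivative_compose[OF this C2_jetD(1)[OF j(1) j(3)[unfolded z]]]
  have "((\<lambda>x. \<phi> (X, x, t)) has_derivative (\<bullet>) (fst (snd (g z)))) (at Y)"
    by (rule has_derivative_eq_rhs) (auto simp: inner_prod_def z)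
  then show "grad_Y \<phi> z = fst (snd (g z))" unfolding grad_Y_def z by (simp add: gradient_eqI)
  have "((\<lambda>x. (X, Y, x)) has_derivative (\<lambda>h. (0, 0, h))) (at t)"
    by (auto intro!: derivative_eq_intros simp: zero_prod_def)
  from has_derivative_compose[OF this C2_jetD(1)[OF j(1) j(3)[unfolded z]]]
  have "((\<lambda>x. \<phi> (X, Y, x)) has_real_derivative (snd (snd (g z)))) (at t)"
    unfolding has_field_derivative_def
    by (rule has_derivative_eq_rhs) (auto simp: inner_prod_def z)
  then show "d_t \<phi> z = snd (snd (g z))" unfolding d_t_def z by (simp add: DERIV_imp_deriv)
  have "open ((\<lambda>x. (x, Y, t)) -` N)" using j(2) by (intro open_vimage continuous_intros)
  moreover have "X \<in> (\<lambda>x. (x, Y, t)) -` N" using j(3) z by simp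
  moreover have "((\<lambda>x. fst (g (x, Y, t))) has_derivative (\<lambda>h. fst (G z (h, 0)))) (at X)"
  proof -
    have "((\<lambda>x. (x, Y, t)) has_derivative (\<lambda>h. (h, 0))) (at X)"
      by (auto intro!: derivative_eq_intros simp: zero_prod_def)
    from has_derivative_fst[OF has_derivative_compose[OF this C2_jetD(2)[OF j(1) j(3)[unfolded z]]]]
    show ?thesis unfolding z .
  qed
  ultimately have d: "(gradient (\<lambda>x. \<phi> (x, Y, t)) has_derivative (\<lambda>h. fst (G z (h, 0)))) (at X)"
  proof -
    assume a: "open ((\<lambda>x. (x, Y, t)) -` N)" "X \<in> (\<lambda>x. (x, Y, t)) -` N"
      and b: "((\<lambda>x. fst (g (x, Y, t))) has_derivative (\<lambda>h. fst (G z (h, 0)))) (at X)"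
    show ?thesis by (rule has_derivative_transform_within_open[OF b a]) (simp add: gX)
  qed
  then have "gradient (\<lambda>x. \<phi> (x, Y, t)) differentiable (at X)" by (rule differentiableI)
  from jacobian_works[THEN iffD1, OF this] d
  have "(\<lambda>h. jacobian (gradient (\<lambda>x. \<phi> (x, Y, t))) (at X) *v h) = (\<lambda>h. fst (G z (h, 0)))"
    by (rule has_derivative_unique)
  then show "hess_X \<phi> z *v h = fst (G z (h, 0))"
    unfolding hess_X_def hessian_def z by (auto dest: fun_cong)
qed

lemma C2_jet_hess_X_inner:
  fixes \<phi> :: "'m::finite point \<Rightarrow> real"
  assumes j: "C2_jet N \<phi> g G" "open N" "z \<in> N"
  shows "(hess_X \<phi> z *v h) \<bullet> k = G z (h, 0) \<bullet> (k, 0)"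
    and "(hess_X \<phi> z *v h) \<bullet> k = (hess_X \<phi> z *v k) \<bullet> h"
proof -
  show 1: "(hess_X \<phi> z *v h) \<bullet> k = G z (h, 0) \<bullet> (k, 0)" for h k
    unfolding C2_jet_partials(4)[OF j] by (simp add: inner_prod_def)
  show "(hess_X \<phi> z *v h) \<bullet> k = (hess_X \<phi> z *v k) \<bullet> h"
    unfolding 1 by (rule C2_jet_symmetric[OF j])
qed

section \<open>Supremum and infimum of a nearly quadratic function over a small ball\<close>

text \<open>The linear term dominates, so the maximum is almost attained at \<open>\<epsilon> e\<close> with \<open>e = g / |g|\<close>. A point of the
ball at distance \<open>d\<close> from \<open>\<epsilon> e\<close> loses at least \<open>|g| d\<^sup>2 / (2 \<epsilon>)\<close> in the linear term and gains at most
\<open>K \<epsilon> d\<close> in the quadratic one; completing the square bounds the net gain by \<open>K\<^sup>2 \<epsilon>\<^sup>3 / (2 |g|)\<close>. For the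
opposite bound the point \<open>(\<epsilon> - \<epsilon>\<^sup>3) e\<close> lies in the open ball and falls short by \<open>O(\<epsilon>\<^sup>3)\<close> only.\<close>

lemma quadratic_on_ball_bounds:
  fixes g :: "'a::real_inner"
  assumes g: "g \<noteq> 0" and lin: "linear H" and K: "\<And>v. norm (H v) \<le> K * norm v" "K \<ge> 0"
    and \<epsilon>: "0 < \<epsilon>" "\<epsilon> < 1"
  defines "L \<equiv> H g \<bullet> g / (norm g)\<^sup>2"
  shows "norm h \<le> \<epsilon> \<Longrightarrow> g \<bullet> h + (H h \<bullet> h) / 2 \<le> \<epsilon> * norm g + \<epsilon>\<^sup>2 * L / 2 + K\<^sup>2 / (2 * norm g) * \<epsilon>^3"
    and "\<exists>h. norm h < \<epsilon> \<and> g \<bullet> h + (H h \<bullet> h) / 2 \<ge> \<epsilon> * norm g + \<epsilon>\<^sup>2 * L / 2 - (norm g + K) * \<epsilon>^3"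
proof -
  define e where "e = g /\<^sub>R norm g"
  have e1: "norm e = 1" "g = norm g *\<^sub>R e" using g by (auto simp: e_def)
  then have e: "norm e = 1" "g = norm g *\<^sub>R e" "e \<bullet> e = 1" by (simp_all add: norm_eq_1[symmetric])
  have ng: "norm g > 0" using g by simp
  have L: "L = H e \<bullet> e"
    unfolding L_def e_def using g by (simp add: linear_scale[OF lin] power2_eq_square divide_inverse mult_ac)
  show "g \<bullet> h + (H h \<bullet> h) / 2 \<le> \<epsilon> * norm g + \<epsilon>\<^sup>2 * L / 2 + K\<^sup>2 / (2 * norm g) * \<epsilon>^3"
    if h: "norm h \<le> \<epsilon>"
  proof -
    define d where "d = norm (h - \<epsilon> *\<^sub>R e)"
    have d0: "d \<ge> 0" unfolding d_def by simp
    have "d\<^sup>2 = (norm h)\<^sup>2 + \<epsilon>\<^sup>2 - 2 * \<epsilon> * (e \<bullet> h)"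
      unfolding d_def power2_norm_eq_inner using e(3)
      by (simp add: inner_diff_left inner_diff_right inner_commute power2_eq_square algebra_simps)
    also have "\<dots> \<le> 2 * \<epsilon>\<^sup>2 - 2 * \<epsilon> * (e \<bullet> h)" using h \<epsilon> by (simp add: power_mono)
    finally have "2 * \<epsilon> * (e \<bullet> h) \<le> 2 * \<epsilon>\<^sup>2 - d\<^sup>2" by simp
    then have eh: "e \<bullet> h \<le> \<epsilon> - d\<^sup>2 / (2 * \<epsilon>)" using \<epsilon> by (simp add: field_simps power2_eq_square)
    have "g \<bullet> h = norm g * (e \<bullet> h)" using e(2) by (metis inner_scaleR_left)
    also have "\<dots> \<le> norm g * (\<epsilon> - d\<^sup>2 / (2 * \<epsilon>))" using eh by (simp add: mult_left_mono)
    finally have 1: "g \<bullet> h \<le> \<epsilon> * norm g - norm g * d\<^sup>2 / (2 * \<epsilon>)" by (simp add: algebra_simps)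
    have "H h \<bullet> h - \<epsilon>\<^sup>2 * L = H (h - \<epsilon> *\<^sub>R e) \<bullet> h + H (\<epsilon> *\<^sub>R e) \<bullet> (h - \<epsilon> *\<^sub>R e)"
      unfolding L by (simp add: linear_diff[OF lin] linear_scale[OF lin] inner_diff_left inner_diff_right power2_eq_square)
    also have "\<dots> \<le> K * d * \<epsilon> + K * \<epsilon> * d"
    proof (rule add_mono)
      have "H (h - \<epsilon> *\<^sub>R e) \<bullet> h \<le> norm (H (h - \<epsilon> *\<^sub>R e)) * norm h" by (rule norm_cauchy_schwarz)
      also have "\<dots> \<le> K * d * \<epsilon>" using K h d0 unfolding d_def by (intro mult_mono) auto
      finally show "H (h - \<epsilon> *\<^sub>R e) \<bullet> h \<le> K * d * \<epsilon>" .
      have "H (\<epsilon> *\<^sub>R e) \<bullet> (h - \<epsilon> *\<^sub>R e) \<le> norm (H (\<epsilon> *\<^sub>R e)) * norm (h - \<epsilon> *\<^sub>R e)" by (rule norm_cauchy_schwarz)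
      also have "\<dots> \<le> K * \<epsilon> * d" using K(1)[of "\<epsilon> *\<^sub>R e"] e(1) \<epsilon> unfolding d_def by (intro mult_right_mono) auto
      finally show "H (\<epsilon> *\<^sub>R e) \<bullet> (h - \<epsilon> *\<^sub>R e) \<le> K * \<epsilon> * d" .
    qed
    finally have 2: "(H h \<bullet> h) / 2 \<le> \<epsilon>\<^sup>2 * L / 2 + K * \<epsilon> * d" by (simp add: algebra_simps)
    \<comment> \<open>loss in the linear term against gain in the quadratic term, by completing the square\<close>
    have "0 \<le> (norm g * d - K * \<epsilon>\<^sup>2)\<^sup>2 / (2 * norm g * \<epsilon>)" using \<epsilon> ng by simp
    also have "\<dots> = norm g * d\<^sup>2 / (2 * \<epsilon>) - K * \<epsilon> * d + K\<^sup>2 / (2 * norm g) * \<epsilon>^3"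
      using \<epsilon> ng by (simp add: field_simps power2_eq_square power3_eq_cube)
    finally show ?thesis using 1 2 by linarith
  qed
  show "\<exists>h. norm h < \<epsilon> \<and> g \<bullet> h + (H h \<bullet> h) / 2 \<ge> \<epsilon> * norm g + \<epsilon>\<^sup>2 * L / 2 - (norm g + K) * \<epsilon>^3"
  proof (intro exI conjI)
    define r where "r = \<epsilon> - \<epsilon>^3"
    have "\<epsilon>^3 < \<epsilon>" using power_strict_decreasing[of 1 3 \<epsilon>] \<epsilon> by simp
    then have r: "0 < r" "r < \<epsilon>" unfolding r_def using \<epsilon> by auto
    show "norm (r *\<^sub>R e) < \<epsilon>" using r e(1) by simp
    have LK: "\<bar>L\<bar> \<le> K"
      unfolding L using Cauchy_Schwarz_ineq2[of "H e" e] K(1)[of e] e(1) by simp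
    have r2: "0 \<le> \<epsilon>\<^sup>2 - r\<^sup>2" "\<epsilon>\<^sup>2 - r\<^sup>2 \<le> 2 * \<epsilon>^3"
    proof -
      show "0 \<le> \<epsilon>\<^sup>2 - r\<^sup>2" using r by (simp add: power_mono)
      have "\<epsilon>\<^sup>2 - r\<^sup>2 = 2 * \<epsilon>^4 - \<epsilon>^6"
        unfolding r_def by (simp add: power2_eq_square algebra_simps eval_nat_numeral)
      moreover have "\<epsilon>^4 \<le> \<epsilon>^3" "0 \<le> \<epsilon>^6" using \<epsilon> power_decreasing[of 3 4 \<epsilon>] by auto
      ultimately show "\<epsilon>\<^sup>2 - r\<^sup>2 \<le> 2 * \<epsilon>^3" by linarith
    qed
    have "(\<epsilon>\<^sup>2 - r\<^sup>2) * L \<le> 2 * \<epsilon>^3 * K"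
      using r2 LK \<epsilon> K(2) by (smt (verit, ccfv_SIG) mult_left_mono mult_right_mono)
    moreover have "g \<bullet> (r *\<^sub>R e) = r * norm g"
      using e(2,3) by (metis inner_scaleR_left inner_scaleR_right mult.right_neutral)
    moreover have "H (r *\<^sub>R e) \<bullet> (r *\<^sub>R e) = r\<^sup>2 * L"
      unfolding L by (simp add: linear_scale[OF lin] power2_eq_square)
    ultimately show "g \<bullet> (r *\<^sub>R e) + (H (r *\<^sub>R e) \<bullet> (r *\<^sub>R e)) / 2
        \<ge> \<epsilon> * norm g + \<epsilon>\<^sup>2 * L / 2 - (norm g + K) * \<epsilon>^3"
      unfolding r_def by (simp add: algebra_simps)
  qed
qed

lemma INF_eq_uminus_SUP: "(INF x\<in>A. f x) = - (SUP x\<in>A. - f x :: real)"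
  unfolding Inf_real_def by (simp add: image_image)

text \<open>The quantification over all \<open>F\<close> and \<open>c\<close> inside the eventuality makes the estimate uniform: later it is
applied to the slices of a test function in the \<open>X\<close> variable, with one \<open>\<epsilon>\<close> for all slices.\<close>

lemma SUP_quadratic_expansion:
  fixes g :: "'a::euclidean_space"
  assumes g: "g \<noteq> 0" and lin: "linear H" and \<delta>: "\<delta> > 0"
  shows "\<forall>\<^sub>F \<epsilon> in at_right 0. \<forall>F c. (\<forall>x\<in>ball X \<epsilon>. \<bar>F x - c - g \<bullet> (x - X) - (H (x - X) \<bullet> (x - X)) / 2\<bar> \<le> \<delta> * \<epsilon>\<^sup>2) \<longrightarrow>
     \<bar>(SUP x\<in>ball X \<epsilon>. F x) - c - \<epsilon> * norm g - \<epsilon>\<^sup>2 * (H g \<bullet> g / (norm g)\<^sup>2) / 2\<bar> \<le> 2 * \<delta> * \<epsilon>\<^sup>2"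
proof -
  obtain K where K: "\<And>v. norm (H v) \<le> norm v * K" "K \<ge> 0"
    using bounded_linear.nonneg_bounded[of H] lin by (auto simp: linear_conv_bounded_linear)
  define C where "C = K\<^sup>2 / (2 * norm g) + norm g + K"
  have C: "C > 0" "C \<ge> K\<^sup>2 / (2 * norm g)" "C \<ge> norm g + K" 
  proof -
    have "K\<^sup>2 / (2 * norm g) \<ge> 0" "norm g > 0" using g by auto
    then show "C > 0" "C \<ge> K\<^sup>2 / (2 * norm g)" "C \<ge> norm g + K" using K(2) unfolding C_def by linarith+
  qed
  define L where "L = H g \<bullet> g / (norm g)\<^sup>2"
  have "\<forall>\<^sub>F \<epsilon>::real in at_right 0. \<epsilon> \<in> {0<..<min 1 (\<delta> / C)}"
    by (rule eventually_at_right_real) (use C \<delta> in auto)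
  then show ?thesis
  proof (eventually_elim, intro allI impI)
    fix \<epsilon> F c
    assume \<epsilon>: "\<epsilon> \<in> {0<..<min 1 (\<delta> / C)}"
      and F: "\<forall>x\<in>ball X \<epsilon>. \<bar>F x - c - g \<bullet> (x - X) - (H (x - X) \<bullet> (x - X)) / 2\<bar> \<le> \<delta> * \<epsilon>\<^sup>2"
    have Ce: "C * \<epsilon>^3 \<le> \<delta> * \<epsilon>\<^sup>2"
    proof -
      have "C * \<epsilon> \<le> \<delta>" using \<epsilon> C(1) by (simp add: field_simps)
      then have "(C * \<epsilon>) * \<epsilon>\<^sup>2 \<le> \<delta> * \<epsilon>\<^sup>2" by (rule mult_right_mono) simp
      then show ?thesis by (simp add: power2_eq_square power3_eq_cube mult_ac)
    qed
    have K': "norm (H v) \<le> K * norm v" for v using K(1)[of v] by (simp add: mult.commute)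
    note Q = quadratic_on_ball_bounds[OF g lin K' K(2), of \<epsilon>, folded L_def]
    have "K\<^sup>2 / (2 * norm g) * \<epsilon>^3 \<le> C * \<epsilon>^3" "(norm g + K) * \<epsilon>^3 \<le> C * \<epsilon>^3"
      using mult_right_mono[OF C(2), of "\<epsilon>^3"] mult_right_mono[OF C(3), of "\<epsilon>^3"] \<epsilon> by simp_all
    with Ce have CC: "K\<^sup>2 / (2 * norm g) * \<epsilon>^3 \<le> \<delta> * \<epsilon>\<^sup>2" "(norm g + K) * \<epsilon>^3 \<le> \<delta> * \<epsilon>\<^sup>2" by linarith+
    have up: "F x \<le> c + \<epsilon> * norm g + \<epsilon>\<^sup>2 * L / 2 + 2 * \<delta> * \<epsilon>\<^sup>2" if "x \<in> ball X \<epsilon>" for x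
    proof -
      have "norm (x - X) \<le> \<epsilon>" using that by (simp add: dist_norm norm_minus_commute)
      then show ?thesis using Q(1)[of "x - X"] \<epsilon> F[rule_format, OF that] CC by (simp add: abs_le_iff)
    qed
    have ne: "ball X \<epsilon> \<noteq> {}" using \<epsilon> by simp
    have "(SUP x\<in>ball X \<epsilon>. F x) \<le> c + \<epsilon> * norm g + \<epsilon>\<^sup>2 * L / 2 + 2 * \<delta> * \<epsilon>\<^sup>2"
      by (rule cSUP_least[OF ne up])
    moreover have "(SUP x\<in>ball X \<epsilon>. F x) \<ge> c + \<epsilon> * norm g + \<epsilon>\<^sup>2 * L / 2 - 2 * \<delta> * \<epsilon>\<^sup>2"
    proof -
      obtain h where h: "norm h < \<epsilon>" "g \<bullet> h + (H h \<bullet> h) / 2 \<ge> \<epsilon> * norm g + \<epsilon>\<^sup>2 * L / 2 - (norm g + K) * \<epsilon>^3"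
        using Q(2) \<epsilon> by auto
      have X: "X + h \<in> ball X \<epsilon>" using h(1) by (simp add: dist_norm)
      have "F (X + h) \<ge> c + \<epsilon> * norm g + \<epsilon>\<^sup>2 * L / 2 - 2 * \<delta> * \<epsilon>\<^sup>2"
        using F[rule_format, OF X] h(2) CC by (simp add: abs_le_iff)
      moreover have "F (X + h) \<le> (SUP x\<in>ball X \<epsilon>. F x)"
        by (rule cSUP_upper[OF X]) (use up in \<open>auto intro!: bdd_aboveI2\<close>)
      ultimately show ?thesis by linarith
    qed
    ultimately show "\<bar>(SUP x\<in>ball X \<epsilon>. F x) - c - \<epsilon> * norm g - \<epsilon>\<^sup>2 * (H g \<bullet> g / (norm g)\<^sup>2) / 2\<bar> \<le> 2 * \<delta> * \<epsilon>\<^sup>2"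
      unfolding L_def[symmetric] by (simp add: abs_le_iff)
  qed
qed

text \<open>The infimum is minus the supremum of \<open>- F\<close>, whose linear part has the same length and whose
quadratic part has the opposite sign. Hence the contributions \<open>\<epsilon> |g|\<close> cancel in the sum and the
second-order contributions add up to the normalized infinity Laplacian. For \<open>g = 0\<close> that quotient is
\<open>0\<close> by convention, which is the correct value if also \<open>H = 0\<close>.\<close>

lemma SUP_plus_INF_quadratic_expansion:
  fixes g :: "'a::euclidean_space"
  assumes gH: "g \<noteq> 0 \<or> H = (\<lambda>_. 0)" and lin: "linear H" and \<delta>: "\<delta> > 0"
  shows "\<forall>\<^sub>F \<epsilon> in at_right 0. \<forall>F c. (\<forall>x\<in>ball X \<epsilon>. \<bar>F x - c - g \<bullet> (x - X) - (H (x - X) \<bullet> (x - X)) / 2\<bar> \<le> \<delta> * \<epsilon>\<^sup>2) \<longrightarrow>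
     \<bar>(SUP x\<in>ball X \<epsilon>. F x) + (INF x\<in>ball X \<epsilon>. F x) - 2 * c - \<epsilon>\<^sup>2 * (H g \<bullet> g / (norm g)\<^sup>2)\<bar> \<le> 4 * \<delta> * \<epsilon>\<^sup>2"
proof (cases "g = 0")
  case False
  have lin': "linear (\<lambda>v. - H v)" using lin by (rule linear_compose_neg)
  have "- g \<noteq> 0" using False by simp
  from SUP_quadratic_expansion[OF False lin \<delta>, of X] SUP_quadratic_expansion[OF this lin' \<delta>, of X]
  show ?thesis
  proof (eventually_elim, intro allI impI)
    fix \<epsilon> F c
    assume 1: "\<forall>F c. (\<forall>x\<in>ball X \<epsilon>. \<bar>F x - c - g \<bullet> (x - X) - (H (x - X) \<bullet> (x - X)) / 2\<bar> \<le> \<delta> * \<epsilon>\<^sup>2) \<longrightarrow>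
        \<bar>(SUP x\<in>ball X \<epsilon>. F x) - c - \<epsilon> * norm g - \<epsilon>\<^sup>2 * (H g \<bullet> g / (norm g)\<^sup>2) / 2\<bar> \<le> 2 * \<delta> * \<epsilon>\<^sup>2"
      and 2: "\<forall>F c. (\<forall>x\<in>ball X \<epsilon>. \<bar>F x - c - (-g) \<bullet> (x - X) - (- H (x - X) \<bullet> (x - X)) / 2\<bar> \<le> \<delta> * \<epsilon>\<^sup>2) \<longrightarrow>
        \<bar>(SUP x\<in>ball X \<epsilon>. F x) - c - \<epsilon> * norm (-g) - \<epsilon>\<^sup>2 * (- H (-g) \<bullet> (-g) / (norm (-g))\<^sup>2) / 2\<bar> \<le> 2 * \<delta> * \<epsilon>\<^sup>2"
      and F: "\<forall>x\<in>ball X \<epsilon>. \<bar>F x - c - g \<bullet> (x - X) - (H (x - X) \<bullet> (x - X)) / 2\<bar> \<le> \<delta> * \<epsilon>\<^sup>2"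
    have "\<forall>x\<in>ball X \<epsilon>. \<bar>- F x - (-c) - (-g) \<bullet> (x - X) - (- H (x - X) \<bullet> (x - X)) / 2\<bar> \<le> \<delta> * \<epsilon>\<^sup>2"
      using F by (auto simp: abs_le_iff)
    from 2[rule_format, OF this[rule_format]]
    have "\<bar>(SUP x\<in>ball X \<epsilon>. - F x) + c - \<epsilon> * norm g + \<epsilon>\<^sup>2 * (H g \<bullet> g / (norm g)\<^sup>2) / 2\<bar> \<le> 2 * \<delta> * \<epsilon>\<^sup>2"
      by (simp add: linear_neg[OF lin])
    moreover have "\<bar>(SUP x\<in>ball X \<epsilon>. F x) - c - \<epsilon> * norm g - \<epsilon>\<^sup>2 * (H g \<bullet> g / (norm g)\<^sup>2) / 2\<bar> \<le> 2 * \<delta> * \<epsilon>\<^sup>2"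
      using 1 F by blast
    ultimately show "\<bar>(SUP x\<in>ball X \<epsilon>. F x) + (INF x\<in>ball X \<epsilon>. F x) - 2 * c - \<epsilon>\<^sup>2 * (H g \<bullet> g / (norm g)\<^sup>2)\<bar> \<le> 4 * \<delta> * \<epsilon>\<^sup>2"
      unfolding INF_eq_uminus_SUP[of F] abs_le_iff by linarith
  qed
next
  case True
  then have H: "H = (\<lambda>_. 0)" using gH by auto
  have "\<forall>\<^sub>F \<epsilon>::real in at_right 0. \<epsilon> > 0" by (simp add: eventually_at_right_less)
  then show ?thesis
  proof (eventually_elim, intro allI impI)
    fix \<epsilon> :: real and F c
    assume \<epsilon>: "\<epsilon> > 0" and F: "\<forall>x\<in>ball X \<epsilon>. \<bar>F x - c - g \<bullet> (x - X) - (H (x - X) \<bullet> (x - X)) / 2\<bar> \<le> \<delta> * \<epsilon>\<^sup>2"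
    have S: "\<bar>(SUP x\<in>ball X \<epsilon>. f x) - k\<bar> \<le> \<delta> * \<epsilon>\<^sup>2" if f: "\<And>x. x \<in> ball X \<epsilon> \<Longrightarrow> \<bar>f x - k\<bar> \<le> \<delta> * \<epsilon>\<^sup>2" for f k
    proof -
      have up: "f x \<le> k + \<delta> * \<epsilon>\<^sup>2" if "x \<in> ball X \<epsilon>" for x using f[OF that] by (simp add: abs_le_iff)
      have X: "X \<in> ball X \<epsilon>" using \<epsilon> by simp
      have "(SUP x\<in>ball X \<epsilon>. f x) \<le> k + \<delta> * \<epsilon>\<^sup>2" by (rule cSUP_least[OF _ up]) (use X in blast)
      moreover have "f X \<le> (SUP x\<in>ball X \<epsilon>. f x)"
        by (rule cSUP_upper[OF X]) (use up in \<open>auto intro!: bdd_aboveI2\<close>)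
      ultimately show ?thesis using f[OF X] by (simp add: abs_le_iff)
    qed
    have 1: "\<bar>(SUP x\<in>ball X \<epsilon>. F x) - c\<bar> \<le> \<delta> * \<epsilon>\<^sup>2" by (rule S) (use F True H in auto)
    have 2: "\<bar>(SUP x\<in>ball X \<epsilon>. - F x) - (-c)\<bar> \<le> \<delta> * \<epsilon>\<^sup>2" by (rule S) (use F True H in \<open>auto simp: abs_le_iff\<close>)
    have "0 \<le> \<delta> * \<epsilon>\<^sup>2" using \<delta> by simp
    with 1 2 show "\<bar>(SUP x\<in>ball X \<epsilon>. F x) + (INF x\<in>ball X \<epsilon>. F x) - 2 * c - \<epsilon>\<^sup>2 * (H g \<bullet> g / (norm g)\<^sup>2)\<bar> \<le> 4 * \<delta> * \<epsilon>\<^sup>2"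
      unfolding INF_eq_uminus_SUP[of F] abs_le_iff by (simp add: True)
  qed
qed

section \<open>Nested integrals of functions close to affine ones\<close>

text \<open>Needed for the measurability of the integrands \<open>sup + inf\<close>. By uniform continuity on \<open>C \<times> W\<close>, nearby
parameters give functions on \<open>B\<close> that are uniformly close, and taking suprema preserves this.\<close>

lemma continuous_on_SUP_compact:
  fixes F :: "'a::metric_space \<Rightarrow> 'b::metric_space \<Rightarrow> real"
  assumes "compact C" "B \<subseteq> C" "B \<noteq> {}" "compact W" and cont: "continuous_on (C \<times> W) (\<lambda>(x, w). F x w)"
  shows "continuous_on W (\<lambda>w. SUP x\<in>B. F x w)"
proof -
  have uc: "uniformly_continuous_on (C \<times> W) (\<lambda>(x, w). F x w)"
    by (intro compact_uniformly_continuous cont compact_Times assms)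
  have bdd: "bdd_above ((\<lambda>x. F x w) ` B)" if "w \<in> W" for w
  proof -
    have "compact ((\<lambda>(x, w). F x w) ` (C \<times> W))" by (intro compact_continuous_image cont compact_Times assms)
    then have "bdd_above ((\<lambda>(x, w). F x w) ` (C \<times> W))" by (intro bounded_imp_bdd_above compact_imp_bounded)
    then show ?thesis by (rule bdd_above_mono) (use that assms(2) in auto)
  qed
  have half: "(SUP x\<in>B. F x w) \<le> (SUP x\<in>B. F x w') + e"
    if "w' \<in> W" "\<And>x. x \<in> B \<Longrightarrow> F x w \<le> F x w' + e" for w w' e
  proof (rule cSUP_least[OF assms(3)])
    fix x assume "x \<in> B"
    then show "F x w \<le> (SUP x\<in>B. F x w') + e"
      using that(2)[of x] cSUP_upper[OF _ bdd[OF that(1)], of x] by linarith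
  qed
  show ?thesis unfolding continuous_on_iff
  proof (intro ballI allI impI)
    fix w e :: real and w0 assume w: "w0 \<in> W" and e: "e > 0"
    obtain d where d: "d > 0" "\<And>p q. p \<in> C \<times> W \<Longrightarrow> q \<in> C \<times> W \<Longrightarrow> dist q p < d \<Longrightarrow>
        dist ((\<lambda>(x, w). F x w) q) ((\<lambda>(x, w). F x w) p) < e / 2"
      using uc[unfolded uniformly_continuous_on_def, rule_format, of "e / 2"] e by auto
    show "\<exists>d>0. \<forall>x'\<in>W. dist x' w0 < d \<longrightarrow> dist (SUP x\<in>B. F x x') (SUP x\<in>B. F x w0) < e"
    proof (intro exI conjI ballI impI)
      fix w' assume w': "w' \<in> W" "dist w' w0 < d"
      have dF: "dist (F x w') (F x w0) < e / 2" if "x \<in> B" for x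
        using d(2)[of "(x, w0)" "(x, w')"] that w w' assms(2) by (auto simp: dist_Pair_Pair)
      then have c: "F x w' \<le> F x w0 + e / 2" "F x w0 \<le> F x w' + e / 2" if "x \<in> B" for x
        using dF[OF that] unfolding dist_real_def by linarith+
      show "dist (SUP x\<in>B. F x w') (SUP x\<in>B. F x w0) < e"
        using half[OF w c(1)] half[OF w'(1) c(2)] e by (simp add: dist_real_def)
    qed (rule d(1))
  qed
qed

text \<open>Iterated integrals are estimated one variable at a time. Since the integral of a non-integrable
function is \<open>0\<close> by convention, integrability of \<open>F\<close> has to come first: it follows from measurability
and the bound on \<open>F - G\<close>.\<close>

lemma set_integral_close:
  fixes F G :: "'a::euclidean_space \<Rightarrow> real"
  assumes S: "S \<in> sets borel" "emeasure lborel S < \<infinity>"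
    and F: "set_borel_measurable borel S F" and G: "set_integrable lborel S G"
    and d: "\<And>x. x \<in> S \<Longrightarrow> \<bar>F x - G x\<bar> \<le> d"
  shows "\<bar>(LINT x:S|lborel. F x) - (LINT x:S|lborel. G x)\<bar> \<le> d * measure lborel S"
proof -
  have c: "set_integrable lborel S (\<lambda>_. d)" using S by (simp add: set_integrable_def)
  have F': "set_borel_measurable lborel S F" using F unfolding set_borel_measurable_def by simp
  have mG: "set_borel_measurable lborel S G"
    using G unfolding set_integrable_def set_borel_measurable_def by (rule borel_measurable_integrable)
  have diff: "set_integrable lborel S (\<lambda>x. F x - G x)"
  proof (rule set_integrable_bound[OF c])
    have "(\<lambda>x. indicator S x *\<^sub>R F x - indicator S x *\<^sub>R G x) \<in> borel_measurable lborel"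
      using F' mG unfolding set_borel_measurable_def by (rule borel_measurable_diff)
    then show "set_borel_measurable lborel S (\<lambda>x. F x - G x)"
      unfolding set_borel_measurable_def by (simp add: algebra_simps)
  qed (use d in \<open>auto intro!: AE_I2 dest!: d\<close>)
  have "set_integrable lborel S (\<lambda>x. (F x - G x) + G x)"
    by (rule set_integral_add(1)[OF diff G])
  then have Fi: "set_integrable lborel S F" by simp
  have "\<bar>(LINT x:S|lborel. F x) - (LINT x:S|lborel. G x)\<bar> = norm (LINT x:S|lborel. F x - G x)"
    using set_integral_diff(2)[OF Fi G] by simp
  also have "\<dots> \<le> (LINT x:S|lborel. norm (F x - G x))" by (rule set_integral_norm_bound[OF diff])
  also have "\<dots> \<le> (LINT x:S|lborel. d)"
    by (rule set_integral_mono) (use c d set_integrable_norm[OF diff] in auto)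
  also have "\<dots> = d * measure lborel S" using S by (subst set_integral_const) auto
  finally show ?thesis .
qed

lemma set_borel_measurable_integral_fst:
  fixes f :: "'a::euclidean_space \<Rightarrow> 'b::euclidean_space \<Rightarrow> real"
  assumes "set_borel_measurable borel (S \<times> T) (\<lambda>(x, y). f x y)"
  shows "set_borel_measurable borel S (\<lambda>x. LINT y:T|lborel. f x y)"
proof -
  have "(\<lambda>(x, y). indicator (S \<times> T) (x, y) *\<^sub>R f x y) \<in> borel_measurable (borel \<Otimes>\<^sub>M lborel)"
    using assms unfolding set_borel_measurable_def
    by (simp add: borel_prod[symmetric] split_beta' cong: measurable_cong_sets sets_pair_measure_cong)
  then have "(\<lambda>x. LINT y|lborel. indicator (S \<times> T) (x, y) *\<^sub>R f x y) \<in> borel_measurable borel"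
    by (rule lborel.borel_measurable_lebesgue_integral)
  moreover have "(LINT y|lborel. indicator (S \<times> T) (x, y) *\<^sub>R f x y) = indicator S x *\<^sub>R (LINT y:T|lborel. f x y)" for x
    unfolding set_lebesgue_integral_def by (cases "x \<in> S") (auto simp: indicator_def)
  ultimately show ?thesis unfolding set_borel_measurable_def by simp
qed

text \<open>The average of \<open>s - t\<close> over \<open>[t - e, t]\<close> is \<open>- e / 2\<close>; with \<open>e = \<epsilon>\<^sup>2\<close> this is the contribution of the
first-order part of the equation to the mean value.\<close>

lemma set_integral_affine_before:
  fixes t e c k :: real
  assumes "e \<ge> 0"
  shows "(LINT s:{t - e..t}|lborel. c + k * (s - t)) = e * (c - k * e / 2)"
    and "set_integrable lborel {t - e..t} (\<lambda>s. c + k * (s - t))"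
proof -
  have "(\<integral>s. indicator {t - e..t} s *\<^sub>R (c + k * (s - t)) \<partial>lborel) =
    (c * t + k * (t - t)\<^sup>2 / 2) - (c * (t - e) + k * (t - e - t)\<^sup>2 / 2)"
    by (rule integral_FTC_Icc)
      (use assms in \<open>auto intro!: derivative_eq_intros continuous_intros simp: has_real_derivative_iff_has_vector_derivative[symmetric]\<close>)
  then show "(LINT s:{t - e..t}|lborel. c + k * (s - t)) = e * (c - k * e / 2)"
    unfolding set_lebesgue_integral_def by (simp add: algebra_simps power2_eq_square)
  show "set_integrable lborel {t - e..t} (\<lambda>s. c + k * (s - t))"
    by (intro borel_integrable_atLeastAtMost') (auto intro!: continuous_intros)
qed

lemma double_integral_close_affine:
  fixes f :: "'a::euclidean_space \<Rightarrow> real \<Rightarrow> real"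
  assumes S: "S \<in> sets borel" "emeasure lborel S < \<infinity>" and e: "e \<ge> 0"
    and f: "continuous_on (S \<times> {t - e..t}) (\<lambda>(y, s). f y s)"
    and d: "\<And>y s. y \<in> S \<Longrightarrow> s \<in> {t - e..t} \<Longrightarrow> \<bar>f y s - (c + k * (s - t))\<bar> \<le> d"
  shows "\<bar>(LINT y:S|lborel. LINT s:{t - e..t}|lborel. f y s) - measure lborel S * (e * (c - k * e / 2))\<bar>
     \<le> d * e * measure lborel S"
proof -
  have m: "set_borel_measurable borel (S \<times> {t - e..t}) (\<lambda>(y, s). f y s)"
    unfolding set_borel_measurable_def
    by (rule borel_measurable_continuous_on_indicator[OF _ f]) (use S in \<open>auto intro: borel_Times\<close>)
  have inner: "\<bar>(LINT s:{t - e..t}|lborel. f y s) - e * (c - k * e / 2)\<bar> \<le> d * e" if y: "y \<in> S" for y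
  proof -
    have "continuous_on {t - e..t} (\<lambda>s. case (y, s) of (y, s) \<Rightarrow> f y s)"
      by (rule continuous_on_compose2[OF f]) (use y in \<open>auto intro!: continuous_on_Pair continuous_on_const continuous_on_id\<close>)
    then have "set_borel_measurable borel {t - e..t} (f y)"
      unfolding set_borel_measurable_def split by (intro borel_measurable_continuous_on_indicator) auto
    from set_integral_close[OF _ _ this set_integral_affine_before(2)[OF e, of t c k], of d] d[OF y] e
    show ?thesis by (simp add: set_integral_affine_before)
  qed
  have "set_integrable lborel S (\<lambda>_. e * (c - k * e / 2))"
    using S by (simp add: set_integrable_def)
  from set_integral_close[OF S set_borel_measurable_integral_fst[OF m] this inner]
  have "\<bar>(LINT y:S|lborel. LINT s:{t - e..t}|lborel. f y s) - (LINT y:S|lborel. e * (c - k * e / 2))\<bar>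
      \<le> d * e * measure lborel S" by simp
  moreover have "(LINT y:S|lborel. e * (c - k * e / 2)) = measure lborel S * (e * (c - k * e / 2))"
    using S by (subst set_integral_const) auto
  ultimately show ?thesis by (simp only:)
qed

lemma triple_integral_close_affine:
  fixes f :: "'a::euclidean_space \<Rightarrow> 'b::euclidean_space \<Rightarrow> real \<Rightarrow> real"
  assumes B: "B \<in> sets borel" "emeasure lborel B < \<infinity>"
    and S: "S \<in> sets borel" "emeasure lborel S < \<infinity>" and e: "e \<ge> 0"
    and f: "continuous_on (B \<times> S \<times> {t - e..t}) (\<lambda>(x, y, s). f x y s)"
    and q: "set_integrable lborel B q"
    and d: "\<And>x y s. x \<in> B \<Longrightarrow> y \<in> S \<Longrightarrow> s \<in> {t - e..t} \<Longrightarrow> \<bar>f x y s - (q x + k * (s - t))\<bar> \<le> d"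
  shows "\<bar>(LINT x:B|lborel. LINT y:S|lborel. LINT s:{t - e..t}|lborel. f x y s)
       - measure lborel S * (e * ((LINT x:B|lborel. q x) - measure lborel B * (k * e / 2)))\<bar>
     \<le> d * e * measure lborel S * measure lborel B"
proof -
  have "continuous_on ((B \<times> S) \<times> {t - e..t}) (\<lambda>p. case (fst (fst p), snd (fst p), snd p) of (x, y, s) \<Rightarrow> f x y s)"
    by (rule continuous_on_compose2[OF f])
      (auto intro!: continuous_on_Pair continuous_on_fst continuous_on_snd continuous_on_id)
  then have "continuous_on ((B \<times> S) \<times> {t - e..t}) (\<lambda>(xy, s). f (fst xy) (snd xy) s)"
    by (simp add: split_beta')
  then have "set_borel_measurable borel ((B \<times> S) \<times> {t - e..t}) (\<lambda>(xy, s). f (fst xy) (snd xy) s)"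
    unfolding set_borel_measurable_def
    by (intro borel_measurable_continuous_on_indicator) (use S B in \<open>auto intro: borel_Times\<close>)
  from set_borel_measurable_integral_fst[OF this]
  have "set_borel_measurable borel (B \<times> S) (\<lambda>(x, y). LINT s:{t - e..t}|lborel. f x y s)"
    by (simp add: split_beta')
  from set_borel_measurable_integral_fst[OF this]
  have m: "set_borel_measurable borel B (\<lambda>x. LINT y:S|lborel. LINT s:{t - e..t}|lborel. f x y s)" .
  have c: "set_integrable lborel B (\<lambda>_. k * e / 2)" using B by (simp add: set_integrable_def)
  define G where "G x = (measure lborel S * e) * (q x - k * e / 2)" for x
  have Gi: "set_integrable lborel B G" unfolding G_def
    by (intro set_integrable_mult_right set_integral_diff(1) q c)
  have GI: "(LINT x:B|lborel. G x) = measure lborel S * (e * ((LINT x:B|lborel. q x) - measure lborel B * (k * e / 2)))"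
    unfolding G_def set_integral_mult_right using B by (subst set_integral_diff(2)[OF q c], subst set_integral_const) auto
  have "\<bar>(LINT y:S|lborel. LINT s:{t - e..t}|lborel. f x y s) - G x\<bar> \<le> d * e * measure lborel S" if x: "x \<in> B" for x
  proof -
    have "continuous_on (S \<times> {t - e..t}) (\<lambda>p. case (x, p) of (x, y, s) \<Rightarrow> f x y s)"
      by (rule continuous_on_compose2[OF f]) (use x in \<open>auto intro!: continuous_on_Pair continuous_on_const continuous_on_id\<close>)
    then have "continuous_on (S \<times> {t - e..t}) (\<lambda>(y, s). f x y s)" by simp
    from double_integral_close_affine[OF S e this d[OF x]] show ?thesis unfolding G_def by (simp add: mult_ac)
  qed
  from set_integral_close[OF B m Gi this] show ?thesis unfolding GI .
qed

section \<open>Second moments of a ball\<close>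

text \<open>A coordinate reflection permutes the coordinate boxes without changing their volumes, and boxes
determine Lebesgue measure. The same argument covers the exchange of two coordinates below.\<close>

lemma lborel_reflection:
  fixes b :: "'a::euclidean_space"
  assumes b: "b \<in> Basis"
  shows "distr lborel borel (\<lambda>x. x - (2 * (x \<bullet> b)) *\<^sub>R b) = lborel"
proof (rule lborel_eqI[symmetric])
  let ?T = "\<lambda>x. x - (2 * (x \<bullet> b)) *\<^sub>R b"
  have [measurable]: "?T \<in> borel_measurable borel"
    by (intro borel_measurable_continuous_onI continuous_intros)
  fix l u :: 'a assume le: "\<And>b. b \<in> Basis \<Longrightarrow> l \<bullet> b \<le> u \<bullet> b"
  define l' u' where "l' = l - ((l + u) \<bullet> b) *\<^sub>R b" and "u' = u - ((l + u) \<bullet> b) *\<^sub>R b"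
  have "?T -` box l u = box l' u'"
  proof (rule set_eqI)
    fix x
    have "(l \<bullet> i < ?T x \<bullet> i \<and> ?T x \<bullet> i < u \<bullet> i) \<longleftrightarrow> (l' \<bullet> i < x \<bullet> i \<and> x \<bullet> i < u' \<bullet> i)" if "i \<in> Basis" for i
      using b that unfolding l'_def u'_def
      by (cases "i = b") (auto simp: inner_diff_left inner_add_left inner_Basis)
    then show "x \<in> ?T -` box l u \<longleftrightarrow> x \<in> box l' u'" by (auto simp: mem_box)
  qed
  then have "emeasure (distr lborel borel ?T) (box l u) = emeasure lborel (box l' u')"
    by (subst emeasure_distr) auto
  also have "\<dots> = (\<Prod>b\<in>Basis. (u' - l') \<bullet> b)"
    by (rule emeasure_lborel_box) (use le in \<open>auto simp: l'_def u'_def inner_diff_left\<close>)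
  also have "u' - l' = u - l" unfolding l'_def u'_def by simp
  finally show "emeasure (distr lborel borel ?T) (box l u) = (\<Prod>b\<in>Basis. (u - l) \<bullet> b)" .
qed simp

lemma lborel_swap:
  fixes a b :: "'a::euclidean_space"
  assumes a: "a \<in> Basis" and b: "b \<in> Basis"
  shows "distr lborel borel (\<lambda>x. x + (x \<bullet> b - x \<bullet> a) *\<^sub>R (a - b)) = lborel"
proof -
  \<comment> \<open>the orthogonal reflection that exchanges the coordinates along \<open>a\<close> and \<open>b\<close>\<close>
  define T where "T x = x + (x \<bullet> b - x \<bullet> a) *\<^sub>R (a - b)" for x
  define \<pi> where "\<pi> i = (if i = a then b else if i = b then a else i)" for i
  have T: "T x \<bullet> i = x \<bullet> \<pi> i" if "i \<in> Basis" for x i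
    using a b that by (auto simp: T_def \<pi>_def inner_diff_left inner_add_left inner_Basis)
  have \<pi>: "\<And>i. \<pi> (\<pi> i) = i" "\<And>i. i \<in> Basis \<Longrightarrow> \<pi> i \<in> Basis"
    using a b by (auto simp: \<pi>_def)
  then have bij: "bij_betw \<pi> Basis Basis" by (intro bij_betw_byWitness[of _ \<pi>]) auto
  have [measurable]: "T \<in> borel_measurable borel"
    unfolding T_def by (intro borel_measurable_continuous_onI continuous_intros)
  have "lborel = distr lborel borel T"
  proof (rule lborel_eqI)
    fix l u :: 'a assume le: "\<And>b. b \<in> Basis \<Longrightarrow> l \<bullet> b \<le> u \<bullet> b"
    have "T -` box l u = box (T l) (T u)"
    proof (rule set_eqI)
      fix x
      have "(\<forall>i\<in>Basis. l \<bullet> i < x \<bullet> \<pi> i \<and> x \<bullet> \<pi> i < u \<bullet> i) \<longleftrightarrow> (\<forall>i\<in>Basis. l \<bullet> \<pi> i < x \<bullet> i \<and> x \<bullet> i < u \<bullet> \<pi> i)"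
        using \<pi> by metis
      then show "x \<in> T -` box l u \<longleftrightarrow> x \<in> box (T l) (T u)" by (simp add: mem_box T)
    qed
    then have "emeasure (distr lborel borel T) (box l u) = emeasure lborel (box (T l) (T u))"
      by (subst emeasure_distr) auto
    also have "\<dots> = (\<Prod>i\<in>Basis. (T u - T l) \<bullet> i)"
      by (rule emeasure_lborel_box) (simp add: T le \<pi>(2))
    also have "(\<Prod>i\<in>Basis. (T u - T l) \<bullet> i) = (\<Prod>i\<in>Basis. (u - l) \<bullet> \<pi> i)"
      by (rule prod.cong[OF refl]) (simp add: T inner_diff_left)
    also have "\<dots> = (\<Prod>i\<in>Basis. (u - l) \<bullet> i)" by (rule prod.reindex_bij_betw[OF bij])
    finally show "emeasure (distr lborel borel T) (box l u) = (\<Prod>b\<in>Basis. (u - l) \<bullet> b)" .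
  qed simp
  then show ?thesis unfolding T_def[abs_def] by simp
qed

lemma set_integral_lborel_invariant:
  fixes f :: "'a::euclidean_space \<Rightarrow> real"
  assumes T: "distr lborel borel T = lborel" "T \<in> borel_measurable borel" "\<And>x. T x \<in> S \<longleftrightarrow> x \<in> S'"
    and f: "f \<in> borel_measurable borel" "S \<in> sets borel"
  shows "(LINT x:S|lborel. f x) = (LINT x:S'|lborel. f (T x))"
proof -
  have "(LINT x:S|lborel. f x) = (LINT x|distr lborel borel T. indicator S x *\<^sub>R f x)"
    unfolding set_lebesgue_integral_def T(1) ..
  also have "\<dots> = (LINT x|lborel. indicator S (T x) *\<^sub>R f (T x))"
    by (rule integral_distr) (use T(2) f in measurable)
  also have "\<dots> = (LINT x:S'|lborel. f (T x))"
    unfolding set_lebesgue_integral_def using T(3) by (simp add: indicator_def)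
  finally show ?thesis .
qed

lemma set_integral_sum:
  fixes f :: "'i \<Rightarrow> 'a \<Rightarrow> real"
  assumes "\<And>i. i \<in> I \<Longrightarrow> set_integrable M A (f i)"
  shows "(LINT x:A|M. \<Sum>i\<in>I. f i x) = (\<Sum>i\<in>I. LINT x:A|M. f i x)"
  using assms unfolding set_lebesgue_integral_def set_integrable_def scaleR_sum_right
  by (rule Bochner_Integration.integral_sum)

lemma set_integrable_continuous_ball:
  fixes f :: "'a::euclidean_space \<Rightarrow> real"
  assumes "continuous_on UNIV f"
  shows "set_integrable lborel (ball x r) f"
proof -
  have "set_integrable lborel (cball x r) f"
    unfolding set_integrable_def
    by (rule borel_integrable_compact) (use assms in \<open>auto intro: continuous_on_subset\<close>)
  then show ?thesis by (rule set_integrable_subset) auto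
qed

text \<open>Write \<open>|x|\<^sup>2\<close> as the integral of \<open>2 r\<close> over \<open>0 \<le> r \<le> |x|\<close> and exchange the integrals. The inner
integral is then the volume \<open>V (\<epsilon>\<^sup>n - r\<^sup>n)\<close> of a spherical shell, and the outer one is elementary.\<close>

lemma integral_norm_power2_ball:
  fixes \<epsilon> :: real
  assumes "\<epsilon> > 0"
  shows "(LINT x:ball (0::'a::euclidean_space) \<epsilon>|lborel. (norm x)\<^sup>2)
     = measure lborel (ball (0::'a) \<epsilon>) * (\<epsilon>\<^sup>2 * DIM('a) / (DIM('a) + 2))"
proof -
  define n where "n = DIM('a)"
  define V where "V = unit_ball_vol n"
  have V: "V \<ge> 0" unfolding V_def by simp
  define F :: "'a \<Rightarrow> real \<Rightarrow> ennreal" where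
    "F x r = ennreal (2 * r) * indicator {0..\<epsilon>} r * indicator {(x, r). r < norm x \<and> norm x < \<epsilon>} (x, r)" for x r
  have [measurable]: "{(x::'a, r::real). r < norm x \<and> norm x < \<epsilon>} \<in> sets (lborel \<Otimes>\<^sub>M lborel)"
    unfolding lborel_prod sets_lborel by (intro borel_open) (auto simp: split_beta' intro!: open_Collect_conj open_Collect_less continuous_intros)
  have [measurable]: "(\<lambda>(x, r). F x r) \<in> borel_measurable (lborel \<Otimes>\<^sub>M lborel)"
    unfolding F_def by measurable
  have inner1: "(\<integral>\<^sup>+r. F x r \<partial>lborel) = ennreal ((norm x)\<^sup>2) * indicator (ball 0 \<epsilon>) x" for x
  proof (cases "norm x < \<epsilon>")
    case True
    have "(\<integral>\<^sup>+r. F x r \<partial>lborel) = (\<integral>\<^sup>+r. ennreal (2 * r) * indicator {0..norm x} r \<partial>lborel)"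
    proof (rule nn_integral_cong_AE)
      have "AE r in lborel. r \<noteq> norm x" by (rule AE_lborel_singleton)
      then show "AE r in lborel. F x r = ennreal (2 * r) * indicator {0..norm x} r"
        by eventually_elim (use True in \<open>auto simp: F_def indicator_def\<close>)
    qed
    also have "\<dots> = (norm x)\<^sup>2 - 0\<^sup>2"
      by (rule nn_integral_FTC_Icc[where F = "\<lambda>r. r\<^sup>2"]) (auto intro!: derivative_eq_intros)
    finally show ?thesis using True by simp
  next
    case False
    then show ?thesis by (simp add: F_def)
  qed
  have inner2: "(\<integral>\<^sup>+x. F x r \<partial>lborel) = ennreal (2 * r * (V * (\<epsilon> ^ n - r ^ n))) * indicator {0..\<epsilon>} r" for r
  proof (cases "r \<in> {0..\<epsilon>}")
    case True
    have "(\<integral>\<^sup>+x. F x r \<partial>lborel) = (\<integral>\<^sup>+x. ennreal (2 * r) * indicator (ball (0::'a) \<epsilon> - cball 0 r) x \<partial>lborel)"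
      using True by (intro nn_integral_cong) (auto simp: F_def indicator_def)
    also have "\<dots> = ennreal (2 * r) * emeasure lborel (ball (0::'a) \<epsilon> - cball 0 r)"
      by (rule nn_integral_cmult_indicator) auto
    also have "emeasure lborel (ball (0::'a) \<epsilon> - cball 0 r) = ennreal (V * (\<epsilon> ^ n - r ^ n))"
    proof -
      have "emeasure lborel (ball (0::'a) \<epsilon> - cball 0 r) = emeasure lborel (cball (0::'a) \<epsilon> - cball 0 r)"
      proof (rule emeasure_eq_AE)
        have "sphere (0::'a) \<epsilon> \<in> null_sets lborel"
          using negligible_sphere[of "0::'a" \<epsilon>]
          by (auto simp: null_sets_completion_iff negligible_iff_null_sets)
        then have "AE x in lborel. x \<notin> sphere (0::'a) \<epsilon>" by (rule AE_not_in)
        then show "AE x in lborel. (x \<in> ball (0::'a) \<epsilon> - cball 0 r) = (x \<in> cball (0::'a) \<epsilon> - cball 0 r)"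
          by eventually_elim auto
      qed auto
      also have "\<dots> = emeasure lborel (cball (0::'a) \<epsilon>) - emeasure lborel (cball (0::'a) r)"
        using True by (intro emeasure_Diff) (auto simp: emeasure_cball)
      also have "\<dots> = ennreal (V * \<epsilon> ^ n - V * r ^ n)"
        using True V assms by (simp add: emeasure_cball V_def n_def ennreal_minus)
      finally show ?thesis by (simp add: algebra_simps)
    qed
    finally show ?thesis using True V assms by (simp add: ennreal_mult' power_mono)
  next
    case False
    then show ?thesis by (simp add: F_def)
  qed
  have "(\<integral>\<^sup>+x. ennreal ((norm x)\<^sup>2) * indicator (ball (0::'a) \<epsilon>) x \<partial>lborel)
      = (\<integral>\<^sup>+x. \<integral>\<^sup>+r. F x r \<partial>lborel \<partial>lborel)" by (simp add: inner1)
  also have "\<dots> = (\<integral>\<^sup>+r. \<integral>\<^sup>+x. F x r \<partial>lborel \<partial>lborel)"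
    by (rule lborel_pair.Fubini') measurable
  also have "\<dots> = (\<integral>\<^sup>+r. ennreal (2 * r * (V * (\<epsilon> ^ n - r ^ n))) * indicator {0..\<epsilon>} r \<partial>lborel)"
    by (simp add: inner2)
  also have "\<dots> = (V * \<epsilon> ^ n * \<epsilon>\<^sup>2 - 2 * V * \<epsilon> ^ (n + 2) / (n + 2)) - (V * \<epsilon> ^ n * 0\<^sup>2 - 2 * V * 0 ^ (n + 2) / (n + 2))"
  proof (rule nn_integral_FTC_Icc[where F = "\<lambda>r. V * \<epsilon> ^ n * r\<^sup>2 - 2 * V * r ^ (n + 2) / (n + 2)"])
    fix r :: real assume "r \<in> {0..\<epsilon>}"
    show "((\<lambda>r. V * \<epsilon> ^ n * r\<^sup>2 - 2 * V * r ^ (n + 2) / (n + 2)) has_real_derivative 2 * r * (V * (\<epsilon> ^ n - r ^ n))) (at r)"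
      by (rule derivative_eq_intros refl | simp)+ (simp add: field_simps)
    show "0 \<le> 2 * r * (V * (\<epsilon> ^ n - r ^ n))" using \<open>r \<in> {0..\<epsilon>}\<close> V by (simp add: power_mono)
  qed (use assms in auto)
  also have "\<dots> = ennreal (V * \<epsilon> ^ n * (\<epsilon>\<^sup>2 * n / (n + 2)))"
    by (rule arg_cong[where f = ennreal]) (simp add: field_simps power2_eq_square)
  finally have nn: "(\<integral>\<^sup>+x. ennreal ((norm x)\<^sup>2 * indicator (ball (0::'a) \<epsilon>) x) \<partial>lborel) = ennreal (V * \<epsilon> ^ n * (\<epsilon>\<^sup>2 * n / (n + 2)))"
    by (simp add: ennreal_mult' ennreal_indicator)
  have "(LINT x:ball (0::'a) \<epsilon>|lborel. (norm x)\<^sup>2) = (\<integral>x. (norm x)\<^sup>2 * indicator (ball (0::'a) \<epsilon>) x \<partial>lborel)"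
    unfolding set_lebesgue_integral_def by (simp add: mult.commute)
  also have "\<dots> = enn2real (\<integral>\<^sup>+x. ennreal ((norm x)\<^sup>2 * indicator (ball (0::'a) \<epsilon>) x) \<partial>lborel)"
    by (rule integral_eq_nn_integral) (auto intro!: borel_measurable_times borel_measurable_power borel_measurable_norm borel_measurable_indicator)
  also have "\<dots> = V * \<epsilon> ^ n * (\<epsilon>\<^sup>2 * n / (n + 2))"
    unfolding nn using V assms by simp
  finally show ?thesis using assms by (simp add: content_ball V_def n_def)
qed

text \<open>Reflecting the coordinate \<open>b\<close> changes the sign of the integrand if \<open>a \<noteq> b\<close>. Exchanging coordinates
shows that the squares of all coordinates have the same integral, and these integrals add up to the
integral of \<open>|x|\<^sup>2\<close>.\<close>

lemma second_moment_ball: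
  fixes a b :: "'a::euclidean_space"
  assumes "\<epsilon> > 0" "a \<in> Basis" "b \<in> Basis"
  shows "(LINT x:ball (0::'a) \<epsilon>|lborel. (x \<bullet> a) * (x \<bullet> b))
     = (if a = b then measure lborel (ball (0::'a) \<epsilon>) * (\<epsilon>\<^sup>2 / (DIM('a) + 2)) else 0)"
proof -
  let ?B = "ball (0::'a) \<epsilon>"
  show ?thesis
  proof (cases "a = b")
    case False
    let ?T = "\<lambda>x. x - (2 * (x \<bullet> b)) *\<^sub>R b"
    have "(norm (?T x))\<^sup>2 = (norm x)\<^sup>2" for x
      unfolding power2_norm_eq_inner using assms(3)
      by (simp add: inner_diff_left inner_diff_right inner_commute power2_eq_square)
    then have n: "norm (?T x) = norm x" for x by simp
    have "(LINT x:?B|lborel. (x \<bullet> a) * (x \<bullet> b)) = (LINT x:?B|lborel. (?T x \<bullet> a) * (?T x \<bullet> b))"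
      by (rule set_integral_lborel_invariant[OF lborel_reflection[OF assms(3)]])
        (auto simp: n intro!: borel_measurable_continuous_onI continuous_intros)
    also have "\<dots> = - (LINT x:?B|lborel. (x \<bullet> a) * (x \<bullet> b))"
      using False assms by (simp add: inner_diff_left inner_Basis set_lebesgue_integral_def)
    finally show ?thesis using False by simp
  next
    case True
    have eq: "(LINT x:?B|lborel. (x \<bullet> c)\<^sup>2) = (LINT x:?B|lborel. (x \<bullet> b)\<^sup>2)" if c: "c \<in> Basis" for c
    proof (cases "c = b")
      case False
      let ?T = "\<lambda>x. x + (x \<bullet> b - x \<bullet> c) *\<^sub>R (c - b)"
      have "(norm (?T x))\<^sup>2 = (norm x)\<^sup>2" for x
        unfolding power2_norm_eq_inner using assms(3) c False
        by (simp add: inner_diff_left inner_diff_right inner_add_left inner_add_right inner_commute inner_Basis algebra_simps)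
      then have n: "norm (?T x) = norm x" for x by simp
      have "(LINT x:?B|lborel. (x \<bullet> c)\<^sup>2) = (LINT x:?B|lborel. (?T x \<bullet> c)\<^sup>2)"
        by (rule set_integral_lborel_invariant[OF lborel_swap[OF c assms(3)]])
          (auto simp: n intro!: borel_measurable_continuous_onI continuous_intros)
      also have "\<dots> = (LINT x:?B|lborel. (x \<bullet> b)\<^sup>2)"
        using False assms c by (simp add: inner_diff_left inner_add_left inner_Basis)
      finally show ?thesis .
    qed simp
    have "DIM('a) * (LINT x:?B|lborel. (x \<bullet> b)\<^sup>2) = (\<Sum>c\<in>Basis. LINT x:?B|lborel. (x \<bullet> c)\<^sup>2)"
      by (simp add: eq)
    also have "\<dots> = (LINT x:?B|lborel. (\<Sum>c\<in>Basis. (x \<bullet> c)\<^sup>2))"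
      by (rule set_integral_sum[symmetric])
        (intro set_integrable_continuous_ball continuous_intros)
    also have "(\<lambda>x::'a. \<Sum>c\<in>Basis. (x \<bullet> c)\<^sup>2) = (\<lambda>x. (norm x)\<^sup>2)"
      unfolding power2_norm_eq_inner by (subst euclidean_inner) (simp add: power2_eq_square)
    also have "(LINT x:?B|lborel. (norm x)\<^sup>2) = measure lborel ?B * (\<epsilon>\<^sup>2 * DIM('a) / (DIM('a) + 2))"
      by (rule integral_norm_power2_ball[OF assms(1)])
    finally have e: "DIM('a) * (LINT x:?B|lborel. (x \<bullet> b)\<^sup>2) = DIM('a) * (measure lborel ?B * (\<epsilon>\<^sup>2 / (DIM('a) + 2)))"
      by (simp add: mult_ac)
    have "(LINT x:?B|lborel. (x \<bullet> b)\<^sup>2) = measure lborel ?B * (\<epsilon>\<^sup>2 / (DIM('a) + 2))"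
      by (rule mult_left_cancel[THEN iffD1, OF _ e]) simp
    then show ?thesis using True by (simp add: power2_eq_square)
  qed
qed

text \<open>By symmetry of the ball only the trace of \<open>H\<close> survives; this is where the Laplacian in the equation
comes from.\<close>

lemma integral_quadratic_ball:
  fixes g X :: "'a::euclidean_space"
  assumes "\<epsilon> > 0" and lin: "linear H"
  shows "(LINT x:ball X \<epsilon>|lborel. c + g \<bullet> (x - X) + (H (x - X) \<bullet> (x - X)) / 2)
     = measure lborel (ball X \<epsilon>) * (c + \<epsilon>\<^sup>2 * (\<Sum>b\<in>Basis. H b \<bullet> b) / (2 * (DIM('a) + 2)))"
    and "set_integrable lborel (ball X \<epsilon>) (\<lambda>x. c + g \<bullet> (x - X) + (H (x - X) \<bullet> (x - X)) / 2)"
proof -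
  let ?B = "ball (0::'a) \<epsilon>"
  let ?q = "\<lambda>h. c + g \<bullet> h + (H h \<bullet> h) / 2"
  have Hc: "continuous_on UNIV (\<lambda>x. H (f x))" if "continuous_on UNIV f" for f :: "'a \<Rightarrow> 'a"
    using linear_continuous_on_compose[OF that lin] by simp
  have Hq: "continuous_on UNIV (\<lambda>x. (H (f x) \<bullet> f x) / 2)" if "continuous_on UNIV f" for f :: "'a \<Rightarrow> 'a"
    by (intro continuous_on_divide continuous_on_inner continuous_on_const Hc that) simp
  have qc: "continuous_on UNIV (\<lambda>x. c + g \<bullet> f x + (H (f x) \<bullet> f x) / 2)" if "continuous_on UNIV f" for f :: "'a \<Rightarrow> 'a"
    by (intro continuous_on_add continuous_on_inner continuous_on_const Hq that)
  show "set_integrable lborel (ball X \<epsilon>) (\<lambda>x. c + g \<bullet> (x - X) + (H (x - X) \<bullet> (x - X)) / 2)"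
    by (intro set_integrable_continuous_ball qc continuous_intros)
  have i: "set_integrable lborel ?B (\<lambda>x. c)" "set_integrable lborel ?B (\<lambda>x. g \<bullet> x)" "set_integrable lborel ?B (\<lambda>x. (H x \<bullet> x) / 2)"
    by (intro set_integrable_continuous_ball continuous_on_inner continuous_on_const continuous_on_id Hq)+
  have "(LINT x:ball X \<epsilon>|lborel. ?q (x - X)) = (LINT x:?B|lborel. ?q (X + x - X))"
    by (rule set_integral_lborel_invariant[OF lborel_distr_plus])
      (auto simp: dist_norm intro!: borel_measurable_continuous_onI qc continuous_intros)
  also have "\<dots> = (LINT x:?B|lborel. c) + (LINT x:?B|lborel. g \<bullet> x) + (LINT x:?B|lborel. (H x \<bullet> x) / 2)"
    using i by (simp add: set_integral_add)
  also have "(LINT x:?B|lborel. c) = measure lborel ?B * c"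
    by (subst set_integral_const) (auto simp: emeasure_ball assms less_imp_le)
  also have "(LINT x:?B|lborel. g \<bullet> x) = 0"
  proof -
    have "distr lborel borel uminus = (lborel :: 'a measure)" by (subst lborel_affine[of "-1" 0]) (auto simp: density_1 fun_eq_iff intro!: arg_cong[where f = "distr lborel borel"])
    from set_integral_lborel_invariant[OF this, of ?B ?B "\<lambda>x. g \<bullet> x"]
    have "(LINT x:?B|lborel. g \<bullet> x) = (LINT x:?B|lborel. g \<bullet> (- x))"
      by (auto intro!: borel_measurable_continuous_onI continuous_intros)
    also have "\<dots> = - (LINT x:?B|lborel. g \<bullet> x)" by (simp add: set_lebesgue_integral_def)
    finally show ?thesis by simp
  qed
  also have "(LINT x:?B|lborel. (H x \<bullet> x) / 2) = (LINT x:?B|lborel. (\<Sum>a\<in>Basis. \<Sum>b\<in>Basis. (H a \<bullet> b / 2) * ((x \<bullet> a) * (x \<bullet> b))))"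
  proof (rule set_lebesgue_integral_cong, simp, intro allI impI)
    fix x :: 'a
    have "H x = (\<Sum>a\<in>Basis. (x \<bullet> a) *\<^sub>R H a)"
      using linear_sum[OF lin, of "\<lambda>a. (x \<bullet> a) *\<^sub>R a" Basis] by (simp add: euclidean_representation linear_scale[OF lin])
    then have "H x \<bullet> x = (\<Sum>a\<in>Basis. (x \<bullet> a) * (H a \<bullet> x))" by (simp add: inner_sum_left)
    also have "\<dots> = (\<Sum>a\<in>Basis. \<Sum>b\<in>Basis. (H a \<bullet> b) * ((x \<bullet> a) * (x \<bullet> b)))"
      by (subst euclidean_inner[of "H _" x]) (simp add: sum_distrib_left mult_ac)
    finally show "(H x \<bullet> x) / 2 = (\<Sum>a\<in>Basis. \<Sum>b\<in>Basis. (H a \<bullet> b / 2) * ((x \<bullet> a) * (x \<bullet> b)))"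
      by (simp add: sum_divide_distrib)
  qed
  also have "\<dots> = (\<Sum>a\<in>Basis. \<Sum>b\<in>Basis. (H a \<bullet> b / 2) * (LINT x:?B|lborel. (x \<bullet> a) * (x \<bullet> b)))"
  proof -
    have ii: "set_integrable lborel ?B (\<lambda>x. k * ((x \<bullet> a) * (x \<bullet> b)))" for k and a b :: 'a
      by (intro set_integrable_continuous_ball continuous_intros)
    have "set_integrable lborel ?B (\<lambda>x. \<Sum>b\<in>Basis. (H a \<bullet> b / 2) * ((x \<bullet> a) * (x \<bullet> b)))" for a
      by (intro set_integrable_continuous_ball continuous_intros)
    then have "(LINT x:?B|lborel. (\<Sum>a\<in>Basis. \<Sum>b\<in>Basis. (H a \<bullet> b / 2) * ((x \<bullet> a) * (x \<bullet> b)))) =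
        (\<Sum>a\<in>Basis. LINT x:?B|lborel. (\<Sum>b\<in>Basis. (H a \<bullet> b / 2) * ((x \<bullet> a) * (x \<bullet> b))))"
      by (rule set_integral_sum)
    also have "\<dots> = (\<Sum>a\<in>Basis. \<Sum>b\<in>Basis. LINT x:?B|lborel. (H a \<bullet> b / 2) * ((x \<bullet> a) * (x \<bullet> b)))"
      by (rule sum.cong[OF refl], rule set_integral_sum, rule ii)
    finally show ?thesis by (simp only: set_integral_mult_right)
  qed
  also have "\<dots> = (\<Sum>a\<in>Basis. \<Sum>b\<in>Basis. if a = b then (H a \<bullet> b / 2) * (measure lborel ?B * (\<epsilon>\<^sup>2 / (DIM('a) + 2))) else 0)"
    by (intro sum.cong refl) (simp only: second_moment_ball[OF assms(1)] if_distrib[of "(*) _"] mult_zero_right)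
  also have "\<dots> = (\<Sum>a\<in>Basis. (H a \<bullet> a / 2) * (measure lborel ?B * (\<epsilon>\<^sup>2 / (DIM('a) + 2))))"
    by simp
  also have "\<dots> = measure lborel ?B * (\<epsilon>\<^sup>2 * (\<Sum>b\<in>Basis. H b \<bullet> b) / (2 * (DIM('a) + 2)))"
    unfolding sum_distrib_right[symmetric] sum_divide_distrib[symmetric] by (simp add: divide_simps mult_ac)
  also have "measure lborel ?B = measure lborel (ball X \<epsilon>)"
    using assms(1) by (simp add: content_ball)
  finally show "(LINT x:ball X \<epsilon>|lborel. ?q (x - X))
     = measure lborel (ball X \<epsilon>) * (c + \<epsilon>\<^sup>2 * (\<Sum>b\<in>Basis. H b \<bullet> b) / (2 * (DIM('a) + 2)))"
    by (simp add: algebra_simps)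
qed

section \<open>Asymptotic expansion of the mean value\<close>

text \<open>The mean value samples a sheared cylinder around \<open>(X, Y, t)\<close> whose displacement is \<open>O(\<epsilon>)\<close> in the \<open>X\<close>
variable and only \<open>O(\<epsilon>\<^sup>2)\<close> in the remaining ones.\<close>

lemma sheared_cylinder_norm_le:
  fixes X Y :: "real^'m"
  assumes "0 < \<epsilon>" "\<epsilon> \<le> 1" "norm (X' - X) \<le> \<epsilon>" "norm (Y' - Y) \<le> \<epsilon>^3" "t' \<in> {t - \<epsilon>\<^sup>2..t}"
  shows "norm (Y' - (t' - t) *\<^sub>R X - Y, t' - t) \<le> (2 + norm X) * \<epsilon>\<^sup>2"
    and "norm (X' - X, Y' - (t' - t) *\<^sub>R X - Y, t' - t) \<le> (3 + norm X) * \<epsilon>"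
proof -
  have s: "\<bar>t' - t\<bar> \<le> \<epsilon>\<^sup>2" using assms(5) by auto
  have e: "\<epsilon>^3 \<le> \<epsilon>\<^sup>2" "\<epsilon>\<^sup>2 \<le> \<epsilon>" using assms(1,2) power_decreasing[of 2 3 \<epsilon>] power_decreasing[of 1 2 \<epsilon>] by auto
  have "norm (Y' - (t' - t) *\<^sub>R X - Y) \<le> norm (Y' - Y) + norm ((t' - t) *\<^sub>R X)"
    using norm_triangle_ineq4[of "Y' - Y" "(t' - t) *\<^sub>R X"] by (simp add: algebra_simps)
  also have "\<dots> \<le> \<epsilon>\<^sup>2 + \<epsilon>\<^sup>2 * norm X"
    using assms(4) e(1) mult_right_mono[OF s, of "norm X"] by simp
  finally have 1: "norm (Y' - (t' - t) *\<^sub>R X - Y) \<le> \<epsilon>\<^sup>2 + \<epsilon>\<^sup>2 * norm X" .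
  have "norm (Y' - (t' - t) *\<^sub>R X - Y, t' - t) \<le> norm (Y' - (t' - t) *\<^sub>R X - Y) + norm (t' - t)"
    by (rule norm_Pair_le)
  with 1 s show 2: "norm (Y' - (t' - t) *\<^sub>R X - Y, t' - t) \<le> (2 + norm X) * \<epsilon>\<^sup>2"
    by (simp add: algebra_simps)
  have "norm (X' - X, Y' - (t' - t) *\<^sub>R X - Y, t' - t) \<le> norm (X' - X) + norm (Y' - (t' - t) *\<^sub>R X - Y, t' - t)"
    by (rule norm_Pair_le)
  also have "\<dots> \<le> \<epsilon> + (2 + norm X) * \<epsilon>" 
    using assms(3) order_trans[OF 2 mult_left_mono[OF e(2), of "2 + norm X"]] by simp
  finally show "norm (X' - X, Y' - (t' - t) *\<^sub>R X - Y, t' - t) \<le> (3 + norm X) * \<epsilon>" by (simp add: algebra_simps)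
qed

lemma sheared_cylinder_subset:
  fixes X Y :: "real^'m"
  assumes "open D" "(X, Y, t) \<in> D"
  shows "\<forall>\<^sub>F \<epsilon> in at_right 0. \<forall>X'\<in>cball X \<epsilon>. \<forall>Y'\<in>cball Y (\<epsilon>^3). \<forall>t'\<in>{t - \<epsilon>\<^sup>2..t}.
     (X', Y' - (t' - t) *\<^sub>R X, t') \<in> D"
proof -
  obtain d where d: "d > 0" "ball (X, Y, t) d \<subseteq> D" using assms openE by blast
  have C: "3 + norm X > 0" by (simp add: add_pos_nonneg)
  have "\<forall>\<^sub>F \<epsilon>::real in at_right 0. \<epsilon> \<in> {0<..<min 1 (d / (3 + norm X))}"
    by (rule eventually_at_right_real) (use C d in auto)
  then show ?thesis
  proof (eventually_elim, intro ballI)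
    fix \<epsilon> t' :: real and X' Y' :: "real^'m"
    assume \<epsilon>: "\<epsilon> \<in> {0<..<min 1 (d / (3 + norm X))}" and X': "X' \<in> cball X \<epsilon>" "Y' \<in> cball Y (\<epsilon>^3)"
      and t': "t' \<in> {t - \<epsilon>\<^sup>2..t}"
    have "norm (X' - X, Y' - (t' - t) *\<^sub>R X - Y, t' - t) \<le> (3 + norm X) * \<epsilon>"
      by (rule sheared_cylinder_norm_le) (use \<epsilon> X' t' in \<open>auto simp: dist_norm norm_minus_commute\<close>)
    also have "\<dots> < d" using \<epsilon> C by (simp add: field_simps)
    finally have "dist (X', Y' - (t' - t) *\<^sub>R X, t') (X, Y, t) < d" by (simp add: dist_norm)
    then show "(X', Y' - (t' - t) *\<^sub>R X, t') \<in> D" using d(2) by (auto simp: dist_commute)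
  qed
qed

text \<open>In the Taylor expansion at \<open>(X, Y, t)\<close> all second-order terms involving \<open>Y\<close> or \<open>t\<close> are \<open>O(\<epsilon>\<^sup>3)\<close>, and so is
the first-order term in \<open>Y' - Y\<close>, because the ball in \<open>Y\<close> has radius \<open>\<epsilon>\<^sup>3\<close>. The shear by \<open>(t' - t) X\<close>
combines the derivatives in \<open>Y\<close> and \<open>t\<close> into \<open>\<tau>\<close>, the transport part of the equation.\<close>

lemma C2_jet_taylor_sheared_cylinder:
  fixes \<phi> :: "'m::finite point \<Rightarrow> real"
  assumes j: "C2_jet D \<phi> g G" "open D" and z: "(X, Y, t) \<in> D" and \<delta>: "\<delta> > 0"
  defines "\<tau> \<equiv> d_t \<phi> (X, Y, t) - X \<bullet> grad_Y \<phi> (X, Y, t)"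
  shows "\<forall>\<^sub>F \<epsilon> in at_right 0. \<forall>X'\<in>ball X \<epsilon>. \<forall>Y'\<in>ball Y (\<epsilon>^3). \<forall>t'\<in>{t - \<epsilon>\<^sup>2..t}.
     \<bar>\<phi> (X', Y' - (t' - t) *\<^sub>R X, t') - (\<phi> (X, Y, t) + \<tau> * (t' - t)) - grad_X \<phi> (X, Y, t) \<bullet> (X' - X)
       - ((hess_X \<phi> (X, Y, t) *v (X' - X)) \<bullet> (X' - X)) / 2\<bar> \<le> \<delta> * \<epsilon>\<^sup>2"
proof -
  let ?z = "(X, Y, t)"
  note P = C2_jet_partials[OF j z]
  have lin: "linear (G ?z)" using C2_jetD(4)[OF j(1) z] .
  obtain K where K: "\<And>v. norm (G ?z v) \<le> norm v * K" "K \<ge> 0"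
    using bounded_linear.nonneg_bounded[of "G ?z"] lin by (auto simp: linear_conv_bounded_linear)
  define C where "C = 2 + norm X"
  have C: "C > 0" "3 + norm X = 1 + C" unfolding C_def by (auto simp: add_pos_nonneg)
  \<comment> \<open>\<open>M\<close> collects the constants in front of \<open>\<epsilon>\<^sup>3\<close> in the remainder\<close>
  define M where "M = norm (grad_Y \<phi> ?z) + K * C * (2 + C) / 2 + 1"
  have M: "M > 0" unfolding M_def using K(2) C(1) by (auto intro!: add_nonneg_pos)
  define \<delta>' where "\<delta>' = \<delta> / (2 * (1 + C)\<^sup>2)"
  have \<delta>': "\<delta>' > 0" "\<delta>' * (1 + C)\<^sup>2 = \<delta> / 2" unfolding \<delta>'_def using \<delta> C(1) by auto
  obtain d where d: "d > 0"
    "\<And>k. norm k < d \<Longrightarrow> \<bar>\<phi> (?z + k) - \<phi> ?z - g ?z \<bullet> k - (G ?z k \<bullet> k) / 2\<bar> \<le> \<delta>' * (norm k)\<^sup>2"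
    using C2_jet_taylor[OF j z \<delta>'(1)] by blast
  have "\<forall>\<^sub>F \<epsilon>::real in at_right 0. \<epsilon> \<in> {0<..<min 1 (min (d / (1 + C)) (\<delta> / (2 * M)))}"
    by (rule eventually_at_right_real) (use C d M \<delta> in auto)
  then show ?thesis
  proof (eventually_elim, intro ballI)
    fix \<epsilon> t' :: real and X' Y' :: "real^'m"
    assume \<epsilon>: "\<epsilon> \<in> {0<..<min 1 (min (d / (1 + C)) (\<delta> / (2 * M)))}" and X': "X' \<in> ball X \<epsilon>" "Y' \<in> ball Y (\<epsilon>^3)"
      and t': "t' \<in> {t - \<epsilon>\<^sup>2..t}"
    have n: "norm (X' - X) \<le> \<epsilon>" "norm (Y' - Y) \<le> \<epsilon>^3" using X' by (auto simp: dist_norm norm_minus_commute)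
    \<comment> \<open>\<open>k1\<close> is the displacement in \<open>X\<close>, of size \<open>\<epsilon>\<close>, and \<open>k2\<close> the rest, of size \<open>\<epsilon>\<^sup>2\<close>\<close>
    define h s k k1 k2 where "h = X' - X" and "s = t' - t" and "k = (h, Y' - s *\<^sub>R X - Y, s)"
      and "k1 = (h, 0 :: (real^'m) \<times> real)" and "k2 = (0 :: real^'m, Y' - s *\<^sub>R X - Y, s)"
    have k: "k = k1 + k2" unfolding k_def k1_def k2_def by (simp add: zero_prod_def)
    have zk: "?z + k = (X', Y' - (t' - t) *\<^sub>R X, t')" unfolding k_def h_def s_def by simp
    have nk1: "norm k1 \<le> \<epsilon>" using n(1) unfolding k1_def h_def by (simp add: norm_Pair)
    have e01: "0 < \<epsilon>" "\<epsilon> \<le> 1" using \<epsilon> by auto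
    note sh = sheared_cylinder_norm_le[OF e01 n t']
    have "norm k2 = norm (Y' - s *\<^sub>R X - Y, s)" unfolding k2_def by (simp add: norm_Pair[of 0])
    then have nk2: "norm k2 \<le> C * \<epsilon>\<^sup>2" using sh(1) unfolding s_def C_def by (simp only:)
    have nk: "norm k \<le> (1 + C) * \<epsilon>" using sh(2) unfolding C(2) k_def h_def s_def .
    have "(1 + C) * \<epsilon> < d" using \<epsilon> C(1) by (simp add: field_simps)
    with nk have "norm k < d" by simp
    note d(2)[OF this]
    also have "\<delta>' * (norm k)\<^sup>2 \<le> \<delta>' * ((1 + C) * \<epsilon>)\<^sup>2" using nk \<delta>'(1) by (intro mult_left_mono power_mono) auto
    also have "\<dots> = \<delta> / 2 * \<epsilon>\<^sup>2" using \<delta>'(2) by (simp add: power_mult_distrib mult.assoc[symmetric])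
    finally have T: "\<bar>\<phi> (?z + k) - \<phi> ?z - g ?z \<bullet> k - (G ?z k \<bullet> k) / 2\<bar> \<le> \<delta> / 2 * \<epsilon>\<^sup>2" .
    have gk: "g ?z \<bullet> k = grad_X \<phi> ?z \<bullet> h + \<tau> * s + grad_Y \<phi> ?z \<bullet> (Y' - Y)"
      unfolding P \<tau>_def k_def by (simp add: inner_prod_def inner_diff_right inner_diff_left algebra_simps inner_commute)
    have gY: "\<bar>grad_Y \<phi> ?z \<bullet> (Y' - Y)\<bar> \<le> norm (grad_Y \<phi> ?z) * \<epsilon>^3"
      using Cauchy_Schwarz_ineq2[of "grad_Y \<phi> ?z" "Y' - Y"] mult_left_mono[OF n(2), of "norm (grad_Y \<phi> ?z)"] by simp
    have "G ?z k \<bullet> k - G ?z k1 \<bullet> k1 = G ?z k1 \<bullet> k2 + G ?z k2 \<bullet> k"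
      unfolding k linear_add[OF lin] by (simp add: inner_add_left inner_add_right)
    moreover have "\<bar>G ?z k1 \<bullet> k2\<bar> \<le> (\<epsilon> * K) * (C * \<epsilon>\<^sup>2)"
    proof (rule order_trans[OF Cauchy_Schwarz_ineq2 mult_mono])
      show "norm (G ?z k1) \<le> \<epsilon> * K" using K(1)[of k1] mult_right_mono[OF nk1 K(2)] by linarith
    qed (use nk2 K(2) \<epsilon> in auto)
    moreover have "\<bar>G ?z k2 \<bullet> k\<bar> \<le> (C * \<epsilon>\<^sup>2 * K) * ((1 + C) * \<epsilon>)"
    proof (rule order_trans[OF Cauchy_Schwarz_ineq2 mult_mono])
      show "norm (G ?z k2) \<le> C * \<epsilon>\<^sup>2 * K" using K(1)[of k2] mult_right_mono[OF nk2 K(2)] by linarith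
    qed (use nk K(2) C(1) in auto)
    moreover have "G ?z k1 \<bullet> k1 = (hess_X \<phi> ?z *v h) \<bullet> h"
      unfolding k1_def C2_jet_hess_X_inner(1)[OF j z] by simp
    ultimately have Gk: "\<bar>G ?z k \<bullet> k - (hess_X \<phi> ?z *v h) \<bullet> h\<bar> \<le> K * C * (2 + C) * \<epsilon>^3"
      by (simp add: algebra_simps power2_eq_square power3_eq_cube abs_le_iff)
    have "M * \<epsilon>^3 \<le> \<delta> / 2 * \<epsilon>\<^sup>2"
    proof -
      have "M * \<epsilon> \<le> \<delta> / 2" using \<epsilon> M by (simp add: field_simps)
      then have "(M * \<epsilon>) * \<epsilon>\<^sup>2 \<le> \<delta> / 2 * \<epsilon>\<^sup>2" by (rule mult_right_mono) simp
      then show ?thesis by (simp add: power2_eq_square power3_eq_cube mult_ac)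
    qed
    then have "norm (grad_Y \<phi> ?z) * \<epsilon>^3 + K * C * (2 + C) * \<epsilon>^3 / 2 + \<epsilon>^3 \<le> \<delta> / 2 * \<epsilon>\<^sup>2"
      unfolding M_def by (simp add: algebra_simps)
    moreover have "\<epsilon>^3 \<ge> 0" using \<epsilon> by simp
    ultimately have "\<bar>\<phi> (?z + k) - (\<phi> ?z + \<tau> * s) - grad_X \<phi> ?z \<bullet> h - ((hess_X \<phi> ?z *v h) \<bullet> h) / 2\<bar> \<le> \<delta> / 2 * \<epsilon>\<^sup>2 + \<delta> / 2 * \<epsilon>\<^sup>2"
      using T gk gY Gk by linarith
    then show "\<bar>\<phi> (X', Y' - (t' - t) *\<^sub>R X, t') - (\<phi> ?z + \<tau> * (t' - t)) - grad_X \<phi> ?z \<bullet> (X' - X)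
       - ((hess_X \<phi> ?z *v (X' - X)) \<bullet> (X' - X)) / 2\<bar> \<le> \<delta> * \<epsilon>\<^sup>2"
      unfolding zk h_def s_def by simp
  qed
qed

lemma trace_eq_sum_Basis:
  fixes A :: "real^'m^'m"
  shows "(\<Sum>b\<in>Basis. (A *v b) \<bullet> b) = trace A"
proof -
  have "(\<Sum>b\<in>Basis. (A *v b) \<bullet> b) = (\<Sum>i\<in>UNIV. (A *v axis i 1) \<bullet> axis i 1)"
    unfolding Basis_vec_def by (subst sum.UNION_disjoint) (auto simp: axis_eq_axis)
  also have "\<dots> = trace A" unfolding trace_def by (simp add: inner_axis matrix_vector_mul_component inner_axis')
  finally show ?thesis .
qed

text \<open>The three contributions are collected here: the time average gives \<open>- \<epsilon>\<^sup>2 \<tau> / 2\<close>, the sum of supremum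
and infimum gives the normalized infinity Laplacian, and the average over the ball in \<open>X\<close> gives the
Laplacian. The weight \<open>\<alpha>\<close> is negative for \<open>p < 2\<close>, hence the absolute values in the error.\<close>

lemma mean_value_affine_estimate:
  fixes \<phi> :: "'m::finite point \<Rightarrow> real" and p :: ereal
  assumes j: "C2_jet D \<phi> g G" "open D" and z: "(X, Y, t) \<in> D"
    and gH: "grad_X \<phi> (X, Y, t) \<noteq> 0 \<or> hess_X \<phi> (X, Y, t) = 0" and \<delta>: "\<delta> > 0"
  defines "\<tau> \<equiv> d_t \<phi> (X, Y, t) - X \<bullet> grad_Y \<phi> (X, Y, t)"
    and "\<alpha> \<equiv> mv_alpha p CARD('m)" and "\<beta> \<equiv> mv_beta p CARD('m)"
  shows "\<forall>\<^sub>F \<epsilon> in at_right 0. \<bar>mean_value p \<epsilon> \<phi> (X, Y, t)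
     - ((\<alpha> + \<beta>) * (\<phi> (X, Y, t) - \<epsilon>\<^sup>2 * \<tau> / 2)
        + \<epsilon>\<^sup>2 * (\<alpha> * inf_laplace_X \<phi> (X, Y, t) / 2 + \<beta> * laplace_X \<phi> (X, Y, t) / (2 * (real CARD('m) + 2))))\<bar>
     \<le> (2 * \<bar>\<alpha>\<bar> + \<bar>\<beta>\<bar>) * \<delta> * \<epsilon>\<^sup>2"
proof -
  let ?z = "(X, Y, t)"
  define A where "A = hess_X \<phi> ?z"
  define H where "H v = A *v v" for v
  define gX where "gX = grad_X \<phi> ?z"
  define L where "L = H gX \<bullet> gX / (norm gX)\<^sup>2"
  define tr where "tr = (\<Sum>b\<in>Basis. H b \<bullet> b)"
  have L: "inf_laplace_X \<phi> ?z = L" unfolding inf_laplace_X_def L_def H_def A_def gX_def ..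
  have tr: "laplace_X \<phi> ?z = tr" unfolding laplace_X_def tr_def H_def trace_eq_sum_Basis A_def ..
  have linH: "linear H" unfolding H_def by (rule matrix_vector_mul_linear)
  have gH': "gX \<noteq> 0 \<or> H = (\<lambda>_. 0)" using gH unfolding gX_def H_def A_def by auto
  have pos: "\<forall>\<^sub>F \<epsilon>::real in at_right 0. \<epsilon> > 0" by (simp add: eventually_at_right_less)
  from pos sheared_cylinder_subset[OF j(2) z] C2_jet_taylor_sheared_cylinder[OF j z \<delta>, folded \<tau>_def]
    SUP_plus_INF_quadratic_expansion[OF gH' linH \<delta>, of X]
  show ?thesis
  proof eventually_elim
    fix \<epsilon> :: real
    assume \<epsilon>: "\<epsilon> > 0"
      and sub: "\<forall>X'\<in>cball X \<epsilon>. \<forall>Y'\<in>cball Y (\<epsilon>^3). \<forall>t'\<in>{t - \<epsilon>\<^sup>2..t}. (X', Y' - (t' - t) *\<^sub>R X, t') \<in> D"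
      and tay: "\<forall>X'\<in>ball X \<epsilon>. \<forall>Y'\<in>ball Y (\<epsilon>^3). \<forall>t'\<in>{t - \<epsilon>\<^sup>2..t}.
         \<bar>\<phi> (X', Y' - (t' - t) *\<^sub>R X, t') - (\<phi> ?z + \<tau> * (t' - t)) - grad_X \<phi> ?z \<bullet> (X' - X)
           - ((hess_X \<phi> ?z *v (X' - X)) \<bullet> (X' - X)) / 2\<bar> \<le> \<delta> * \<epsilon>\<^sup>2"
      and SI: "\<forall>F c. (\<forall>x\<in>ball X \<epsilon>. \<bar>F x - c - gX \<bullet> (x - X) - (H (x - X) \<bullet> (x - X)) / 2\<bar> \<le> \<delta> * \<epsilon>\<^sup>2) \<longrightarrow>
         \<bar>(SUP x\<in>ball X \<epsilon>. F x) + (INF x\<in>ball X \<epsilon>. F x) - 2 * c - \<epsilon>\<^sup>2 * (H gX \<bullet> gX / (norm gX)\<^sup>2)\<bar> \<le> 4 * \<delta> * \<epsilon>\<^sup>2"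
    let ?B = "ball X \<epsilon>" and ?S = "ball Y (\<epsilon>^3)" and ?T = "{t - \<epsilon>\<^sup>2..t}"
    define f where "f x y s = \<phi> (x, y - (s - t) *\<^sub>R X, s)" for x y s
    define mB mS where "mB = measure lborel ?B" and "mS = measure lborel ?S"
    have mpos: "mB > 0" "mS > 0" using \<epsilon> unfolding mB_def mS_def by (auto intro!: content_ball_pos)
    have fin: "emeasure lborel ?B < \<infinity>" "emeasure lborel ?S < \<infinity>" using \<epsilon> by (auto simp: emeasure_ball)
    have cf: "continuous_on (cball X \<epsilon> \<times> (cball Y (\<epsilon>^3) \<times> ?T)) (\<lambda>(x, y, s). f x y s)"
    proof -
      have "continuous_on (cball X \<epsilon> \<times> (cball Y (\<epsilon>^3) \<times> ?T))
          (\<lambda>p. \<phi> (fst p, fst (snd p) - (snd (snd p) - t) *\<^sub>R X, snd (snd p)))"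
        by (rule continuous_on_compose2[OF C2_jetD(5)[OF j(1)]])
          (use sub in \<open>auto intro!: continuous_intros\<close>)
      then show ?thesis unfolding f_def by (simp add: split_beta')
    qed
    have tay': "\<bar>f x y s - (\<phi> ?z + \<tau> * (s - t)) - gX \<bullet> (x - X) - (H (x - X) \<bullet> (x - X)) / 2\<bar> \<le> \<delta> * \<epsilon>\<^sup>2"
      if "x \<in> ?B" "y \<in> ?S" "s \<in> ?T" for x y s
      using tay that unfolding f_def gX_def H_def A_def by blast
    have cS: "continuous_on (cball Y (\<epsilon>^3) \<times> ?T) (\<lambda>w. SUP x\<in>?B. (\<lambda>(y, s). F x y s) w)"
      if "continuous_on (cball X \<epsilon> \<times> (cball Y (\<epsilon>^3) \<times> ?T)) (\<lambda>(x, y, s). F x y s)" for F :: "real^'m \<Rightarrow> real^'m \<Rightarrow> real \<Rightarrow> real"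
      by (rule continuous_on_SUP_compact[of "cball X \<epsilon>"]) (use \<epsilon> that in \<open>auto intro!: compact_Times\<close>)
    have "continuous_on (cball X \<epsilon> \<times> (cball Y (\<epsilon>^3) \<times> ?T)) (\<lambda>(x, y, s). - f x y s)"
      using continuous_on_minus[OF cf] by (simp add: split_beta')
    from cS[OF this] cS[OF cf]
    have "continuous_on (cball Y (\<epsilon>^3) \<times> ?T) (\<lambda>(y, s). (SUP x\<in>?B. f x y s) + (INF x\<in>?B. f x y s))"
      unfolding INF_eq_uminus_SUP split_beta' by (intro continuous_intros)
    then have c1: "continuous_on (?S \<times> ?T) (\<lambda>(y, s). (SUP x\<in>?B. f x y s) + (INF x\<in>?B. f x y s))"
      by (rule continuous_on_subset) auto
    have "\<bar>((SUP x\<in>?B. f x y s) + (INF x\<in>?B. f x y s)) - ((2 * \<phi> ?z + \<epsilon>\<^sup>2 * L) + (2 * \<tau>) * (s - t))\<bar> \<le> 4 * \<delta> * \<epsilon>\<^sup>2"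
      if "y \<in> ?S" "s \<in> ?T" for y s
      using SI[rule_format, of "\<lambda>x. f x y s" "\<phi> ?z + \<tau> * (s - t)"] tay'[OF _ that]
      unfolding L_def[symmetric] by (simp add: algebra_simps)
    from double_integral_close_affine[OF _ fin(2) _ c1 this]
    have I1: "\<bar>(LINT y:?S|lborel. LINT s:?T|lborel. (SUP x\<in>?B. f x y s) + (INF x\<in>?B. f x y s))
        - mS * (\<epsilon>\<^sup>2 * (2 * \<phi> ?z + \<epsilon>\<^sup>2 * L - 2 * \<tau> * \<epsilon>\<^sup>2 / 2))\<bar> \<le> 4 * \<delta> * \<epsilon>\<^sup>2 * \<epsilon>\<^sup>2 * mS"
      unfolding mS_def by simp
    define q where "q x = \<phi> ?z + gX \<bullet> (x - X) + (H (x - X) \<bullet> (x - X)) / 2" for x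
    note Q = integral_quadratic_ball[OF \<epsilon> linH, of X "\<phi> ?z" gX, folded q_def tr_def mB_def]
    have c2: "continuous_on (?B \<times> ?S \<times> ?T) (\<lambda>(x, y, s). f x y s)"
      by (rule continuous_on_subset[OF cf]) auto
    have "\<bar>f x y s - (q x + \<tau> * (s - t))\<bar> \<le> \<delta> * \<epsilon>\<^sup>2" if "x \<in> ?B" "y \<in> ?S" "s \<in> ?T" for x y s
      using tay'[OF that] unfolding q_def by (simp add: algebra_simps)
    from triple_integral_close_affine[OF _ fin(1) _ fin(2) _ c2 Q(2) this]
    have I2: "\<bar>(LINT x:?B|lborel. LINT y:?S|lborel. LINT s:?T|lborel. f x y s)
        - mS * (\<epsilon>\<^sup>2 * (mB * (\<phi> ?z + \<epsilon>\<^sup>2 * tr / (2 * (real CARD('m) + 2))) - mB * (\<tau> * \<epsilon>\<^sup>2 / 2)))\<bar>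
        \<le> \<delta> * \<epsilon>\<^sup>2 * \<epsilon>\<^sup>2 * mS * mB"
      unfolding mS_def mB_def[symmetric] Q(1) by (simp add: add.commute)
    \<comment> \<open>division by the volume \<open>w\<close> of the averaging domain\<close>
    have scale: "\<bar>a * (1 / w) * I - a * v\<bar> \<le> \<bar>a\<bar> * r" if "\<bar>I - w * v\<bar> \<le> w * r" "w > 0" for a w I v r :: real
    proof -
      have 1: "a * (1 / w) * I - a * v = a * ((I - w * v) / w)" using that(2) by (simp add: field_simps)
      have "\<bar>(I - w * v) / w\<bar> \<le> r" using that by (simp add: field_simps)
      then show ?thesis unfolding 1 abs_mult by (rule mult_left_mono) simp
    qed
    have J1: "\<bar>\<alpha> / 2 * (1 / (\<epsilon>\<^sup>2 * mS)) * (LINT y:?S|lborel. LINT s:?T|lborel. (SUP x\<in>?B. f x y s) + (INF x\<in>?B. f x y s))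
        - \<alpha> / 2 * (2 * \<phi> ?z + \<epsilon>\<^sup>2 * L - 2 * \<tau> * \<epsilon>\<^sup>2 / 2)\<bar> \<le> \<bar>\<alpha> / 2\<bar> * (4 * \<delta> * \<epsilon>\<^sup>2)"
      by (rule scale) (use I1 mpos \<epsilon> in \<open>simp_all add: mult_ac\<close>)
    have J2: "\<bar>\<beta> * (1 / (\<epsilon>\<^sup>2 * mB * mS)) * (LINT x:?B|lborel. LINT y:?S|lborel. LINT s:?T|lborel. f x y s)
        - \<beta> * ((\<phi> ?z + \<epsilon>\<^sup>2 * tr / (2 * (real CARD('m) + 2))) - \<tau> * \<epsilon>\<^sup>2 / 2)\<bar> \<le> \<bar>\<beta>\<bar> * (\<delta> * \<epsilon>\<^sup>2)"
    proof (rule scale)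
      have "mS * (\<epsilon>\<^sup>2 * (mB * (\<phi> ?z + \<epsilon>\<^sup>2 * tr / (2 * (real CARD('m) + 2))) - mB * (\<tau> * \<epsilon>\<^sup>2 / 2)))
        = \<epsilon>\<^sup>2 * mB * mS * ((\<phi> ?z + \<epsilon>\<^sup>2 * tr / (2 * (real CARD('m) + 2))) - \<tau> * \<epsilon>\<^sup>2 / 2)"
        by (simp only: right_diff_distrib mult_ac)
      moreover have "\<delta> * \<epsilon>\<^sup>2 * \<epsilon>\<^sup>2 * mS * mB = \<epsilon>\<^sup>2 * mB * mS * (\<delta> * \<epsilon>\<^sup>2)" by (simp only: mult_ac)
      ultimately show "\<bar>(LINT x:?B|lborel. LINT y:?S|lborel. LINT s:?T|lborel. f x y s)
        - \<epsilon>\<^sup>2 * mB * mS * ((\<phi> ?z + \<epsilon>\<^sup>2 * tr / (2 * (real CARD('m) + 2))) - \<tau> * \<epsilon>\<^sup>2 / 2)\<bar> \<le> \<epsilon>\<^sup>2 * mB * mS * (\<delta> * \<epsilon>\<^sup>2)"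
        using I2 by (simp only:)
    qed (use mpos \<epsilon> in simp)
    have mv: "mean_value p \<epsilon> \<phi> ?z =
       \<alpha> / 2 * (1 / (\<epsilon>\<^sup>2 * mS)) * (LINT y:?S|lborel. LINT s:?T|lborel. (SUP x\<in>?B. f x y s) + (INF x\<in>?B. f x y s))
       + \<beta> * (1 / (\<epsilon>\<^sup>2 * mB * mS)) * (LINT x:?B|lborel. LINT y:?S|lborel. LINT s:?T|lborel. f x y s)"
      unfolding mean_value_def \<alpha>_def \<beta>_def mS_def mB_def f_def by simp
    have eq1: "(\<alpha> + \<beta>) * (\<phi> ?z - \<epsilon>\<^sup>2 * \<tau> / 2) + \<epsilon>\<^sup>2 * (\<alpha> * L / 2 + \<beta> * tr / (2 * (real CARD('m) + 2)))
       = \<alpha> / 2 * (2 * \<phi> ?z + \<epsilon>\<^sup>2 * L - 2 * \<tau> * \<epsilon>\<^sup>2 / 2) + \<beta> * ((\<phi> ?z + \<epsilon>\<^sup>2 * tr / (2 * (real CARD('m) + 2))) - \<tau> * \<epsilon>\<^sup>2 / 2)"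
      by (simp add: field_simps)
    have eq2: "(2 * \<bar>\<alpha>\<bar> + \<bar>\<beta>\<bar>) * \<delta> * \<epsilon>\<^sup>2 = \<bar>\<alpha> / 2\<bar> * (4 * \<delta> * \<epsilon>\<^sup>2) + \<bar>\<beta>\<bar> * (\<delta> * \<epsilon>\<^sup>2)"
      by (simp add: algebra_simps)
    have tri: "\<bar>a + b - (a' + b')\<bar> \<le> x + y" if "\<bar>a - a'\<bar> \<le> x" "\<bar>b - b'\<bar> \<le> y" for a b a' b' x y :: real
      using that by linarith
    show "\<bar>mean_value p \<epsilon> \<phi> ?z - ((\<alpha> + \<beta>) * (\<phi> ?z - \<epsilon>\<^sup>2 * \<tau> / 2)
        + \<epsilon>\<^sup>2 * (\<alpha> * inf_laplace_X \<phi> ?z / 2 + \<beta> * laplace_X \<phi> ?z / (2 * (real CARD('m) + 2))))\<bar>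
       \<le> (2 * \<bar>\<alpha>\<bar> + \<bar>\<beta>\<bar>) * \<delta> * \<epsilon>\<^sup>2"
      unfolding mv L tr eq1 eq2 by (rule tri[OF J1 J2])
  qed
qed

text \<open>The weights are chosen such that \<open>\<alpha> + \<beta> = 1\<close> and, for finite \<open>p\<close>, \<open>\<alpha> : \<beta> / (m + 2) = (p - 2) : 1\<close>. The first identity
keeps the value of \<open>\<phi>\<close>, the second one reproduces the ratio of the two second-order operators.\<close>

lemma mean_value_expansion:
  fixes \<phi> :: "'m::finite point \<Rightarrow> real"
  assumes D: "open D" and \<phi>: "C2_on D \<phi>" and z: "z \<in> D" and p: "1 < p"
    and gH: "grad_X \<phi> z \<noteq> 0 \<or> hess_X \<phi> z = 0"
  defines "c \<equiv> (if p = \<infinity> then 1 else real CARD('m) + real_of_ereal p)"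
  shows "((\<lambda>\<epsilon>. (mean_value p \<epsilon> \<phi> z - \<phi> z) / \<epsilon>\<^sup>2) \<longlongrightarrow> (diffusion p \<phi> z - transport p \<phi> z) / (2 * c)) (at_right 0)"
    and "c > 0"
proof -
  show c: "c > 0" unfolding c_def using p by (cases p) auto
  obtain X Y t where zz: "z = (X, Y, t)" using prod_cases3 by blast
  obtain g G where j: "C2_jet D \<phi> g G" using \<phi> unfolding C2_on_iff_jet by blast
  define \<tau> where "\<tau> = d_t \<phi> z - X \<bullet> grad_Y \<phi> z"
  define \<alpha> \<beta> where "\<alpha> = mv_alpha p CARD('m)" and "\<beta> = mv_beta p CARD('m)"
  have ab: "\<alpha> + \<beta> = 1" unfolding \<alpha>_def \<beta>_def mv_alpha_def mv_beta_def using c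
    by (auto simp: c_def add_divide_distrib[symmetric] split: if_splits)
  define \<kappa> where "\<kappa> = (diffusion p \<phi> z - transport p \<phi> z) / (2 * c)"
  have \<kappa>: "\<alpha> * inf_laplace_X \<phi> z / 2 + \<beta> * laplace_X \<phi> z / (2 * (real CARD('m) + 2)) - \<tau> / 2 = \<kappa>"
  proof (cases "p = \<infinity>")
    case True
    then show ?thesis unfolding \<kappa>_def \<alpha>_def \<beta>_def mv_alpha_def mv_beta_def c_def diffusion_def transport_def \<tau>_def zz
      by (simp add: field_simps)
  next
    case False
    have t: "transport p \<phi> z = c * \<tau>" unfolding transport_def \<tau>_def c_def zz using False by simp
    have d: "diffusion p \<phi> z = (real_of_ereal p - 2) * inf_laplace_X \<phi> z + laplace_X \<phi> z"
      unfolding diffusion_def using False by simp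
    have a: "\<alpha> = (real_of_ereal p - 2) / c" unfolding \<alpha>_def mv_alpha_def c_def using False by simp
    have b: "\<beta> / (2 * (real CARD('m) + 2)) = 1 / (2 * c)"
    proof -
      have "M / q / (2 * M) = 1 / (2 * q)" if "M > 0" for M q :: real
        using that by (cases "q = 0") (simp_all add: field_simps)
      from this[of "real CARD('m) + 2" c] show ?thesis
        unfolding \<beta>_def mv_beta_def c_def using False by (simp only: if_False)
    qed
    have e: "\<beta> * laplace_X \<phi> z / (2 * (real CARD('m) + 2)) = laplace_X \<phi> z / (2 * c)"
      using arg_cong[OF b, of "\<lambda>v. v * laplace_X \<phi> z"] by simp
    show ?thesis unfolding e \<kappa>_def t d a using c by (simp add: field_simps)
  qed
  show "((\<lambda>\<epsilon>. (mean_value p \<epsilon> \<phi> z - \<phi> z) / \<epsilon>\<^sup>2) \<longlongrightarrow> (diffusion p \<phi> z - transport p \<phi> z) / (2 * c)) (at_right 0)"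
    unfolding \<kappa>_def[symmetric]
  proof (rule tendstoI)
    fix e :: real assume e: "e > 0"
    define C where "C = 2 * \<bar>\<alpha>\<bar> + \<bar>\<beta>\<bar> + 1"
    have C: "C > 0" unfolding C_def by simp
    define \<delta> where "\<delta> = e / (2 * C)"
    have \<delta>: "\<delta> > 0" "C * \<delta> < e" unfolding \<delta>_def using e C by auto
    have pos: "\<forall>\<^sub>F \<epsilon>::real in at_right 0. \<epsilon> > 0" by (simp add: eventually_at_right_less)
    from pos mean_value_affine_estimate[OF j D z[unfolded zz] gH[unfolded zz] \<delta>(1), of p,
        folded zz, folded \<tau>_def \<alpha>_def \<beta>_def]
    show "\<forall>\<^sub>F \<epsilon> in at_right 0. dist ((mean_value p \<epsilon> \<phi> z - \<phi> z) / \<epsilon>\<^sup>2) \<kappa> < e"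
    proof eventually_elim
      fix \<epsilon> :: real
      assume \<epsilon>: "\<epsilon> > 0" and est: "\<bar>mean_value p \<epsilon> \<phi> z - ((\<alpha> + \<beta>) * (\<phi> z - \<epsilon>\<^sup>2 * \<tau> / 2)
        + \<epsilon>\<^sup>2 * (\<alpha> * inf_laplace_X \<phi> z / 2 + \<beta> * laplace_X \<phi> z / (2 * (real CARD('m) + 2))))\<bar>
        \<le> (2 * \<bar>\<alpha>\<bar> + \<bar>\<beta>\<bar>) * \<delta> * \<epsilon>\<^sup>2"
      have "(\<alpha> + \<beta>) * (\<phi> z - \<epsilon>\<^sup>2 * \<tau> / 2)
        + \<epsilon>\<^sup>2 * (\<alpha> * inf_laplace_X \<phi> z / 2 + \<beta> * laplace_X \<phi> z / (2 * (real CARD('m) + 2))) = \<phi> z + \<epsilon>\<^sup>2 * \<kappa>"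
        unfolding ab \<kappa>[symmetric] by (simp add: algebra_simps)
      with est have "\<bar>mean_value p \<epsilon> \<phi> z - (\<phi> z + \<epsilon>\<^sup>2 * \<kappa>)\<bar> \<le> (2 * \<bar>\<alpha>\<bar> + \<bar>\<beta>\<bar>) * \<delta> * \<epsilon>\<^sup>2" by simp
      also have "\<dots> \<le> C * \<delta> * \<epsilon>\<^sup>2" unfolding C_def using \<delta>(1) by (intro mult_right_mono) auto
      finally have "\<bar>mean_value p \<epsilon> \<phi> z - (\<phi> z + \<epsilon>\<^sup>2 * \<kappa>)\<bar> / \<epsilon>\<^sup>2 \<le> C * \<delta>" using \<epsilon> by (simp add: divide_le_eq)
      moreover have "(mean_value p \<epsilon> \<phi> z - \<phi> z) / \<epsilon>\<^sup>2 - \<kappa> = (mean_value p \<epsilon> \<phi> z - (\<phi> z + \<epsilon>\<^sup>2 * \<kappa>)) / \<epsilon>\<^sup>2"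
        using \<epsilon> by (simp add: field_simps)
      ultimately show "dist ((mean_value p \<epsilon> \<phi> z - \<phi> z) / \<epsilon>\<^sup>2) \<kappa> < e"
        using \<delta>(2) by (simp add: dist_real_def)
    qed
  qed
qed

text \<open>Divided by \<open>\<epsilon>\<^sup>2\<close>, the error term disappears in the limit and the inequality becomes a sign condition
on the limit of the expansion; conversely, the remainder of the expansion is an admissible error
term.\<close>

lemma mean_value_inequality_iff:
  fixes \<phi> :: "'m::finite point \<Rightarrow> real"
  assumes D: "open D" and \<phi>: "C2_on D \<phi>" and z: "z \<in> D" and p: "1 < p"
    and gH: "grad_X \<phi> z \<noteq> 0 \<or> hess_X \<phi> z = 0"
  shows "(\<exists>r \<in> o[at_right 0](\<lambda>\<epsilon>. \<epsilon>\<^sup>2). \<forall>\<^sub>F \<epsilon> in at_right 0. \<phi> z \<ge> mean_value p \<epsilon> \<phi> z + r \<epsilon>)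
     \<longleftrightarrow> transport p \<phi> z \<ge> diffusion p \<phi> z"
proof -
  define c where "c = (if p = \<infinity> then 1 else real CARD('m) + real_of_ereal p)"
  define \<kappa> where "\<kappa> = (diffusion p \<phi> z - transport p \<phi> z) / (2 * c)"
  note M = mean_value_expansion[OF D \<phi> z p gH, folded c_def, folded \<kappa>_def]
  have sgn: "\<kappa> \<le> 0 \<longleftrightarrow> transport p \<phi> z \<ge> diffusion p \<phi> z" unfolding \<kappa>_def using M(2) by (simp add: divide_le_0_iff)
  have pos: "\<forall>\<^sub>F \<epsilon>::real in at_right 0. \<epsilon> > 0" by (simp add: eventually_at_right_less)
  show ?thesis unfolding sgn[symmetric]
  proof
    assume "\<exists>r \<in> o[at_right 0](\<lambda>\<epsilon>. \<epsilon>\<^sup>2). \<forall>\<^sub>F \<epsilon> in at_right 0. \<phi> z \<ge> mean_value p \<epsilon> \<phi> z + r \<epsilon>"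
    then obtain r where r: "r \<in> o[at_right 0](\<lambda>\<epsilon>. \<epsilon>\<^sup>2)" "\<forall>\<^sub>F \<epsilon> in at_right 0. \<phi> z \<ge> mean_value p \<epsilon> \<phi> z + r \<epsilon>" by blast
    have "((\<lambda>\<epsilon>. (mean_value p \<epsilon> \<phi> z - \<phi> z) / \<epsilon>\<^sup>2 + r \<epsilon> / \<epsilon>\<^sup>2) \<longlongrightarrow> \<kappa> + 0) (at_right 0)"
      by (intro tendsto_add M(1) smalloD_tendsto r)
    moreover have "\<forall>\<^sub>F \<epsilon> in at_right 0. (mean_value p \<epsilon> \<phi> z - \<phi> z) / \<epsilon>\<^sup>2 + r \<epsilon> / \<epsilon>\<^sup>2 \<le> 0"
      using pos r(2)
      by eventually_elim (simp add: add_divide_distrib[symmetric] divide_le_0_iff)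
    ultimately have "\<kappa> + 0 \<le> 0" by (rule tendsto_upperbound) simp
    then show "\<kappa> \<le> 0" by simp
  next
    assume \<kappa>: "\<kappa> \<le> 0"
    define r where "r \<epsilon> = \<phi> z + \<epsilon>\<^sup>2 * \<kappa> - mean_value p \<epsilon> \<phi> z" for \<epsilon>
    have "((\<lambda>\<epsilon>. \<kappa> - (mean_value p \<epsilon> \<phi> z - \<phi> z) / \<epsilon>\<^sup>2) \<longlongrightarrow> \<kappa> - \<kappa>) (at_right 0)"
      by (intro tendsto_intros M(1))
    moreover have "\<forall>\<^sub>F \<epsilon> in at_right 0. \<kappa> - (mean_value p \<epsilon> \<phi> z - \<phi> z) / \<epsilon>\<^sup>2 = r \<epsilon> / \<epsilon>\<^sup>2"
      using pos by eventually_elim (simp add: r_def field_simps)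
    ultimately have "((\<lambda>\<epsilon>. r \<epsilon> / \<epsilon>\<^sup>2) \<longlongrightarrow> 0) (at_right 0)" by (auto dest: Lim_transform_eventually)
    moreover have "\<forall>\<^sub>F \<epsilon>::real in at_right 0. \<epsilon>\<^sup>2 \<noteq> 0" using pos by eventually_elim simp
    ultimately have "r \<in> o[at_right 0](\<lambda>\<epsilon>. \<epsilon>\<^sup>2)" by (intro smalloI_tendsto)
    moreover have "\<forall>\<^sub>F \<epsilon> in at_right 0. \<phi> z \<ge> mean_value p \<epsilon> \<phi> z + r \<epsilon>"
      using pos by eventually_elim (simp add: r_def \<kappa> mult_nonneg_nonpos)
    ultimately show "\<exists>r \<in> o[at_right 0](\<lambda>\<epsilon>. \<epsilon>\<^sup>2). \<forall>\<^sub>F \<epsilon> in at_right 0. \<phi> z \<ge> mean_value p \<epsilon> \<phi> z + r \<epsilon>" by blast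
  qed
qed

section \<open>Smallest eigenvalues of symmetric matrices\<close>

text \<open>A minimizer \<open>v\<close> of the quadratic form on the unit sphere is an eigenvector: if \<open>w = A v - \<mu> v\<close> were not
zero, moving from \<open>v\<close> in the direction \<open>- w\<close> would push the form below \<open>\<mu> |x|\<^sup>2\<close>. Testing with other
eigenvectors shows that \<open>\<mu>\<close> is the smallest eigenvalue.\<close>

lemma min_eigenvalue_symmetric:
  fixes A :: "real^'m^'m"
  assumes sym: "\<And>x y. (A *v x) \<bullet> y = (A *v y) \<bullet> x"
  shows "is_eigenvalue A (min_eigenvalue A)"
    and "is_eigenvalue A \<nu> \<Longrightarrow> min_eigenvalue A \<le> \<nu>"
    and "min_eigenvalue A * (norm x)\<^sup>2 \<le> (A *v x) \<bullet> x"
proof -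
  define Q where "Q x = (A *v x) \<bullet> x" for x
  have "continuous_on (sphere 0 1) Q" unfolding Q_def by (intro continuous_intros)
  moreover have "sphere (0::real^'m) 1 \<noteq> {}" by simp
  ultimately obtain v where v: "v \<in> sphere 0 1" "\<And>x. x \<in> sphere 0 1 \<Longrightarrow> Q v \<le> Q x"
    using continuous_attains_inf[of "sphere 0 1" Q] by auto
  define \<mu> where "\<mu> = Q v"
  have v1: "norm v = 1" "v \<noteq> 0" using v(1) by auto
  have scale: "Q (s *\<^sub>R x) = s\<^sup>2 * Q x" for s x
    unfolding Q_def by (simp add: matrix_vector_mult_scaleR power2_eq_square)
  have low: "\<mu> * (norm x)\<^sup>2 \<le> Q x" for x
  proof (cases "x = 0")
    case False
    then have "\<mu> \<le> Q ((1 / norm x) *\<^sub>R x)" unfolding \<mu>_def by (intro v(2)) simp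
    also have "\<dots> = Q x / (norm x)\<^sup>2" unfolding scale by (simp add: power_divide)
    finally show ?thesis using False by (simp add: field_simps)
  qed (simp add: Q_def)
  define w where "w = A *v v - \<mu> *\<^sub>R v"
  \<comment> \<open>\<open>q\<close> is the coefficient of \<open>s\<^sup>2\<close> in the form minus \<open>\<mu> |x|\<^sup>2\<close> at \<open>v - s w\<close>\<close>
  define q where "q = Q w - \<mu> * (norm w)\<^sup>2"
  have var: "2 * (w \<bullet> w) \<le> s * q" if "s > 0" for s
  proof -
    have e1: "Q (v - s *\<^sub>R w) = \<mu> - 2 * s * ((A *v v) \<bullet> w) + s\<^sup>2 * Q w"
      unfolding \<mu>_def Q_def using sym[of w v]
      by (simp add: matrix_vector_mult_diff_distrib matrix_vector_mult_scaleR inner_diff_left inner_diff_right power2_eq_square algebra_simps)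
    have "(norm (v - s *\<^sub>R w))\<^sup>2 = v \<bullet> v - 2 * s * (v \<bullet> w) + s\<^sup>2 * (norm w)\<^sup>2"
      unfolding power2_norm_eq_inner
      by (simp add: inner_diff_left inner_diff_right inner_commute power2_eq_square algebra_simps)
    also have "v \<bullet> v = 1" using v1(1) by (simp add: norm_eq_1)
    finally have e0: "(norm (v - s *\<^sub>R w))\<^sup>2 = 1 - 2 * s * (v \<bullet> w) + s\<^sup>2 * (norm w)\<^sup>2" .
    have e2: "\<mu> * (norm (v - s *\<^sub>R w))\<^sup>2 = \<mu> - 2 * s * (\<mu> * (v \<bullet> w)) + s\<^sup>2 * (\<mu> * (norm w)\<^sup>2)"
      unfolding e0 by (simp add: algebra_simps)
    have ww: "w \<bullet> w = (A *v v) \<bullet> w - \<mu> * (v \<bullet> w)"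
      by (subst (1) w_def) (simp add: inner_diff_left)
    have "0 \<le> s * (s * q - 2 * (w \<bullet> w))"
      using low[of "v - s *\<^sub>R w"] unfolding e1 e2 ww q_def by (simp add: power2_eq_square algebra_simps)
    then show ?thesis using that by (simp add: zero_le_mult_iff)
  qed
  have "w \<bullet> w \<le> 0"
  proof (rule ccontr)
    assume "\<not> w \<bullet> w \<le> 0"
    then have p: "w \<bullet> w > 0" by linarith
    have "2 * (w \<bullet> w) \<le> (w \<bullet> w) / (\<bar>q\<bar> + 1) * q" by (rule var) (use p in simp)
    also have "\<dots> \<le> w \<bullet> w"
    proof -
      have "(w \<bullet> w) * q \<le> (w \<bullet> w) * (\<bar>q\<bar> + 1)" using p by (intro mult_left_mono) auto
      then show ?thesis by (simp add: field_simps)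
    qed
    finally show False using p by simp
  qed
  then have "w = 0" using inner_ge_zero[of w] by (metis antisym inner_eq_zero_iff)
  then have ev: "is_eigenvalue A \<mu>" unfolding is_eigenvalue_def w_def using v1 by auto
  have le: "\<mu> \<le> \<nu>" if "is_eigenvalue A \<nu>" for \<nu>
  proof -
    obtain x where x: "x \<noteq> 0" "A *v x = \<nu> *\<^sub>R x" using \<open>is_eigenvalue A \<nu>\<close> unfolding is_eigenvalue_def by blast
    have "\<mu> * (norm x)\<^sup>2 \<le> \<nu> * (norm x)\<^sup>2" using low[of x] unfolding Q_def x(2) by (simp add: power2_norm_eq_inner)
    then show ?thesis using x(1) by simp
  qed
  have m: "min_eigenvalue A = \<mu>" unfolding min_eigenvalue_def using ev le by (rule Least_equality)
  show "is_eigenvalue A (min_eigenvalue A)" "is_eigenvalue A \<nu> \<Longrightarrow> min_eigenvalue A \<le> \<nu>"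
    "min_eigenvalue A * (norm x)\<^sup>2 \<le> (A *v x) \<bullet> x"
    unfolding m using ev le low[of x] unfolding Q_def by auto
qed

lemma min_eigenvalue_zero: "min_eigenvalue (0 :: real^'m^'m) = 0"
proof -
  have "is_eigenvalue (0 :: real^'m^'m) (min_eigenvalue (0 :: real^'m^'m))"
    by (rule min_eigenvalue_symmetric) simp
  then show ?thesis unfolding is_eigenvalue_def by auto
qed

lemma max_eigenvalue_eq_min:
  fixes A :: "real^'m^'m"
  assumes sym: "\<And>x y. (A *v x) \<bullet> y = (A *v y) \<bullet> x"
  shows "max_eigenvalue A = - min_eigenvalue (- A)"
proof -
  have neg: "(- A) *v x = - (A *v x)" for x :: "real^'m"
    using matrix_vector_mult_diff_rdistrib[of 0 A x] by simp
  have e: "is_eigenvalue (- A) \<nu> \<longleftrightarrow> is_eigenvalue A (- \<nu>)" for \<nu>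
    unfolding is_eigenvalue_def neg by (metis minus_equation_iff scaleR_minus_left)
  have s: "((- A) *v x) \<bullet> y = ((- A) *v y) \<bullet> x" for x y unfolding neg using sym[of x y] by simp
  show ?thesis unfolding max_eigenvalue_def
  proof (rule Greatest_equality)
    show "is_eigenvalue A (- min_eigenvalue (- A))" using min_eigenvalue_symmetric(1)[OF s] e by blast
    fix y assume "is_eigenvalue A y"
    then have "is_eigenvalue (- A) (- y)" by (simp add: e)
    then show "y \<le> - min_eigenvalue (- A)" using min_eigenvalue_symmetric(2)[OF s] by fastforce
  qed
qed

text \<open>If gradient and Hessian vanish, the relaxed and the unrelaxed second-order parts agree, so the test
functions admitted by the mean value formula satisfy one common inequality.\<close>

lemma diffusion_degenerate:
  assumes "grad_X \<phi> z = 0" "hess_X \<phi> z = 0"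
  shows "diffusion p \<phi> z = 0" "diffusion_lower p \<phi> z = 0"
  using assms unfolding diffusion_def diffusion_lower_def inf_laplace_X_def laplace_X_def trace_def
  by (auto simp: min_eigenvalue_zero)

section \<open>Localizing test functions\<close>

text \<open>A function \<open>\<psi>\<close> that touches \<open>u\<close> only near \<open>z\<close> becomes a test function on all of \<open>D\<close> once some \<open>\<phi> \<le> u\<close> is
available: the combination \<open>(1 - \<eta>) \<phi> + \<eta> \<psi>\<close> with a cutoff \<open>\<eta>\<close> stays below \<open>u\<close> by convexity, and
subtracting \<open>|w - z|\<^sup>4\<close> makes the contact strict. The fourth power leaves the derivatives up to second
order at \<open>z\<close> unchanged.\<close>

lemma touches_below_localize:
  fixes D :: "'a::euclidean_space set"
  assumes D: "open D" and \<phi>: "C2_on D \<phi>" "\<And>w. w \<in> D \<Longrightarrow> \<phi> w \<le> u w"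
    and V: "open V" "V \<subseteq> D" "z \<in> V"
    and \<psi>: "C2_jet V \<psi> g G" "\<And>w. w \<in> V \<Longrightarrow> \<psi> w \<le> u w" "\<psi> z = u z"
  obtains \<psi>' N g' G' where "touches_below D \<psi>' u z" "open N" "z \<in> N" "C2_jet N \<psi>' g' G'"
    "g' z = g z" "G' z = G z"
proof -
  obtain r0 where r0: "r0 > 0" "ball z r0 \<subseteq> V" using V openE by blast
  define r where "r = r0 / 3"
  have r: "r > 0" "ball z (3 * r) \<subseteq> V" using r0 unfolding r_def by auto
  obtain \<eta> :: "'a \<Rightarrow> real" where \<eta>: "C2_on UNIV \<eta>" "\<And>w. 0 \<le> \<eta> w" "\<And>w. \<eta> w \<le> 1"
    "\<And>w. norm (w - z) \<le> r \<Longrightarrow> \<eta> w = 1" "\<And>w. norm (w - z) \<ge> 2 * r \<Longrightarrow> \<eta> w = 0"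
    using C2_on_cutoff[OF r(1), of UNIV z] by blast
  obtain gf Gf where jf: "C2_jet D \<phi> gf Gf" using \<phi>(1) unfolding C2_on_iff_jet by blast
  obtain ge Ge where je: "C2_jet UNIV \<eta> ge Ge" using \<eta>(1) unfolding C2_on_iff_jet by blast
  define \<psi>' where "\<psi>' w = \<phi> w + \<eta> w * (\<psi> w + - \<phi> w) + - ((norm (w - z))^4)" for w
  have "C2_on D \<psi>'"
  proof (rule C2_on_local)
    fix w assume w: "w \<in> D"
    show "\<exists>N. open N \<and> w \<in> N \<and> C2_on N \<psi>'"
    proof (cases "norm (w - z) < 3 * r")
      case True
      let ?N = "ball z (3 * r)"
      have sub: "?N \<subseteq> V" "?N \<subseteq> D" using r V by auto
      have "\<exists>g G. C2_jet ?N \<psi>' g G" unfolding \<psi>'_def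
        using C2_jet_add[OF C2_jet_add[OF C2_jet_subset[OF jf sub(2)]
          C2_jet_mult[OF C2_jet_subset[OF je subset_UNIV]
            C2_jet_add[OF C2_jet_subset[OF \<psi>(1) sub(1)] C2_jet_minus[OF C2_jet_subset[OF jf sub(2)]]]]]
          C2_jet_minus[OF C2_jet_norm_power4[of _ z]]] by blast
      moreover have "w \<in> ?N" using True by (simp add: dist_norm norm_minus_commute)
      ultimately show ?thesis unfolding C2_on_iff_jet by blast
    next
      case False
      let ?N = "D - cball z (2 * r)"
      have "C2_jet ?N (\<lambda>w. \<phi> w + - ((norm (w - z))^4)) (\<lambda>w. gf w + - ((4 * (norm (w - z))\<^sup>2) *\<^sub>R (w - z)))
        (\<lambda>w h. Gf w h + - ((4 * (norm (w - z))\<^sup>2) *\<^sub>R h + (8 * ((w - z) \<bullet> h)) *\<^sub>R (w - z)))"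
        by (intro C2_jet_add C2_jet_minus C2_jet_norm_power4 C2_jet_subset[OF jf]) auto
      then have "C2_jet ?N \<psi>' (\<lambda>w. gf w + - ((4 * (norm (w - z))\<^sup>2) *\<^sub>R (w - z)))
        (\<lambda>w h. Gf w h + - ((4 * (norm (w - z))\<^sup>2) *\<^sub>R h + (8 * ((w - z) \<bullet> h)) *\<^sub>R (w - z)))"
        by (rule C2_jet_cong) (use D \<eta>(5) in \<open>auto simp: \<psi>'_def dist_norm norm_minus_commute\<close>)
      then have "C2_on ?N \<psi>'" unfolding C2_on_iff_jet by blast
      moreover have "w \<in> ?N" using w False r(1) by (auto simp: dist_norm norm_minus_commute)
      ultimately show ?thesis using D by (intro exI[of _ ?N]) auto
    qed
  qed
  moreover have "\<psi>' w < u w" if "w \<in> D - {z}" for w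
  proof -
    have "\<phi> w + \<eta> w * (\<psi> w + - \<phi> w) \<le> u w"
    proof (cases "norm (w - z) < 2 * r")
      case True
      then have "w \<in> V" using r by (auto simp: subset_iff dist_norm norm_minus_commute)
      have "\<phi> w + \<eta> w * (\<psi> w + - \<phi> w) = (1 - \<eta> w) * \<phi> w + \<eta> w * \<psi> w" by (simp add: algebra_simps)
      also have "\<dots> \<le> (1 - \<eta> w) * u w + \<eta> w * u w"
        using \<eta>(2,3)[of w] \<phi>(2)[of w] \<psi>(2)[OF \<open>w \<in> V\<close>] that by (intro add_mono mult_left_mono) auto
      finally show ?thesis by (simp add: algebra_simps)
    next
      case False
      then show ?thesis using \<eta>(5)[of w] \<phi>(2)[of w] that by simp
    qed
    moreover have "(norm (w - z))^4 > 0" using that by simp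
    ultimately show ?thesis unfolding \<psi>'_def by linarith
  qed
  moreover have "\<psi>' z = u z" unfolding \<psi>'_def using \<eta>(4)[of z] r(1) \<psi>(3) by simp
  ultimately have t: "touches_below D \<psi>' u z" unfolding touches_below_def using V by auto
  let ?N = "ball z r"
  have "C2_jet ?N (\<lambda>w. \<psi> w + - ((norm (w - z))^4)) (\<lambda>w. g w + - ((4 * (norm (w - z))\<^sup>2) *\<^sub>R (w - z)))
        (\<lambda>w h. G w h + - ((4 * (norm (w - z))\<^sup>2) *\<^sub>R h + (8 * ((w - z) \<bullet> h)) *\<^sub>R (w - z)))"
    by (intro C2_jet_add C2_jet_minus C2_jet_norm_power4 C2_jet_subset[OF \<psi>(1)]) (use r in \<open>auto simp: subset_iff\<close>)
  then have j: "C2_jet ?N \<psi>' (\<lambda>w. g w + - ((4 * (norm (w - z))\<^sup>2) *\<^sub>R (w - z)))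
        (\<lambda>w h. G w h + - ((4 * (norm (w - z))\<^sup>2) *\<^sub>R h + (8 * ((w - z) \<bullet> h)) *\<^sub>R (w - z)))"
    by (rule C2_jet_cong) (use \<eta>(4) in \<open>auto simp: \<psi>'_def dist_norm norm_minus_commute\<close>)
  show thesis by (rule that[OF t _ _ j]) (use r(1) in auto)
qed

lemma same_jet_same_operators:
  fixes \<phi> :: "'m::finite point \<Rightarrow> real"
  assumes "C2_jet N \<phi> g G" "open N" "z \<in> N" "C2_jet N' \<psi> g' G'" "open N'" "z' \<in> N'"
    and "g' z' = g z" "G' z' = G z"
  shows "grad_X \<psi> z' = grad_X \<phi> z" "hess_X \<psi> z' = hess_X \<phi> z" "diffusion p \<psi> z' = diffusion p \<phi> z"
    "d_t \<psi> z' = d_t \<phi> z" "grad_Y \<psi> z' = grad_Y \<phi> z"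
proof -
  note P = C2_jet_partials[OF assms(1-3)] C2_jet_partials[OF assms(4-6)]
  show 1: "grad_X \<psi> z' = grad_X \<phi> z" "d_t \<psi> z' = d_t \<phi> z" "grad_Y \<psi> z' = grad_Y \<phi> z"
    using assms(7) unfolding P by simp_all
  show 2: "hess_X \<psi> z' = hess_X \<phi> z" unfolding matrix_eq P using assms(8) by simp
  show "diffusion p \<psi> z' = diffusion p \<phi> z"
    unfolding diffusion_def inf_laplace_X_def laplace_X_def 1 2 ..
qed

lemma local_test_inequality:
  fixes D :: "'m::finite point set"
  assumes D: "open D" and \<phi>: "C2_on D \<phi>" "\<And>w. w \<in> D \<Longrightarrow> \<phi> w \<le> u w"
    and V: "open V" "V \<subseteq> D" "z \<in> V"
    and \<psi>: "C2_jet V \<psi> g G" "\<And>w. w \<in> V \<Longrightarrow> \<psi> w \<le> u w" "\<psi> z = u z"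
    and nd: "grad_X \<psi> z \<noteq> 0 \<or> hess_X \<psi> z = 0"
    and test: "\<And>\<psi> z. touches_below D \<psi> u z \<Longrightarrow> grad_X \<psi> z \<noteq> 0 \<or> hess_X \<psi> z = 0 \<Longrightarrow> diffusion p \<psi> z \<le> transport p \<psi> z"
  shows "diffusion p \<psi> z \<le> transport p \<psi> z"
proof -
  obtain \<psi>' N g' G' where t: "touches_below D \<psi>' u z" "open N" "z \<in> N" "C2_jet N \<psi>' g' G'"
    "g' z = g z" "G' z = G z"
    using touches_below_localize[where D = D and \<phi> = \<phi> and u = u and V = V and \<psi> = \<psi> and g = g and G = G and z = z] D \<phi> V \<psi> by blast
  note S = same_jet_same_operators[OF \<psi>(1) V(1,3) t(4,2,3,5,6)]
  have "diffusion p \<psi>' z \<le> transport p \<psi>' z" by (rule test[OF t(1)]) (use nd in \<open>simp add: S\<close>)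
  then show ?thesis unfolding transport_def S .
qed

section \<open>Test functions with vanishing gradient\<close>

lemma linear_norm_le_sum_Basis:
  fixes L :: "'a::euclidean_space \<Rightarrow> 'b::real_normed_vector"
  assumes "linear L"
  shows "norm (L v) \<le> (\<Sum>b\<in>Basis. norm (L b)) * norm v"
proof -
  have "L v = (\<Sum>b\<in>Basis. (v \<bullet> b) *\<^sub>R L b)"
    using linear_sum[OF assms, of "\<lambda>b. (v \<bullet> b) *\<^sub>R b" Basis]
    by (simp add: euclidean_representation linear_scale[OF assms])
  also have "norm \<dots> \<le> (\<Sum>b\<in>Basis. norm v * norm (L b))"
    by (rule order_trans[OF norm_sum sum_mono]) (simp add: Basis_le_norm mult_right_mono)
  finally show ?thesis by (simp add: sum_distrib_left[symmetric] mult.commute)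
qed

text \<open>At points \<open>w\<close> near \<open>z\<close> with nonzero gradient, the normalized infinity Laplacian is a Rayleigh quotient
of the Hessian at \<open>w\<close>. Replacing that Hessian by the one at \<open>z\<close> costs a multiple of \<open>E w\<close>, and Rayleigh
quotients at \<open>z\<close> are bounded below by the smallest eigenvalue. The bound is uniform in the direction of
the gradient, which need not converge as \<open>w\<close> tends to \<open>z\<close>.\<close>

lemma diffusion_ge_diffusion_lower:
  fixes \<phi> :: "'m::finite point \<Rightarrow> real"
  assumes j: "C2_jet D \<phi> g G" "open D" and z: "z \<in> D"
  defines "E \<equiv> \<lambda>w. \<Sum>b\<in>Basis. norm (G w b - G z b)"
  shows "\<exists>C. \<forall>w\<in>D. grad_X \<phi> w \<noteq> 0 \<longrightarrow> diffusion_lower p \<phi> z - C * E w \<le> diffusion p \<phi> w"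
proof -
  define Q where "Q w v = (hess_X \<phi> w *v v) \<bullet> v" for w v
  have E0: "E w \<ge> 0" for w unfolding E_def by (simp add: sum_nonneg)
  have QE: "\<bar>Q w v - Q z v\<bar> \<le> E w * (norm v)\<^sup>2" if w: "w \<in> D" for w v
  proof -
    have lin: "linear (\<lambda>v. G w v - G z v)" using C2_jetD(4)[OF j(1)] w z by (intro linear_compose_sub) auto
    have "Q w v - Q z v = (G w (v, 0) - G z (v, 0)) \<bullet> (v, 0)"
      unfolding Q_def C2_jet_hess_X_inner(1)[OF j w] C2_jet_hess_X_inner(1)[OF j z] by (simp add: inner_diff_left)
    also have "\<bar>\<dots>\<bar> \<le> norm (G w (v, 0) - G z (v, 0)) * norm (v, 0 :: (real^'m) \<times> real)"
      by (rule Cauchy_Schwarz_ineq2)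
    also have "\<dots> \<le> (E w * norm (v, 0 :: (real^'m) \<times> real)) * norm (v, 0 :: (real^'m) \<times> real)"
      unfolding E_def by (intro mult_right_mono linear_norm_le_sum_Basis[OF lin]) auto
    finally show ?thesis by (simp add: norm_Pair power2_eq_square mult.assoc)
  qed
  have sym: "(hess_X \<phi> z *v x) \<bullet> y = (hess_X \<phi> z *v y) \<bullet> x" for x y by (rule C2_jet_hess_X_inner(2)[OF j z])
  have tr: "laplace_X \<phi> w = (\<Sum>b\<in>Basis. Q w b)" for w
    unfolding laplace_X_def Q_def trace_eq_sum_Basis ..
  have trE: "laplace_X \<phi> z - real CARD('m) * E w \<le> laplace_X \<phi> w" if w: "w \<in> D" for w
  proof -
    have "(\<Sum>b\<in>Basis. Q z b - E w) \<le> (\<Sum>b\<in>Basis. Q w b)"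
    proof (rule sum_mono)
      fix b :: "real^'m" assume "b \<in> Basis"
      then show "Q z b - E w \<le> Q w b" using QE[OF w, of b] by simp
    qed
    then show ?thesis unfolding tr by (simp add: sum_subtractf)
  qed
  have q: "\<bar>inf_laplace_X \<phi> w - Q z (grad_X \<phi> w) / (norm (grad_X \<phi> w))\<^sup>2\<bar> \<le> E w"
    if w: "w \<in> D" and n: "grad_X \<phi> w \<noteq> 0" for w
  proof -
    have "inf_laplace_X \<phi> w - Q z (grad_X \<phi> w) / (norm (grad_X \<phi> w))\<^sup>2
      = (Q w (grad_X \<phi> w) - Q z (grad_X \<phi> w)) / (norm (grad_X \<phi> w))\<^sup>2"
      unfolding inf_laplace_X_def Q_def by (simp add: diff_divide_distrib)
    then show ?thesis using QE[OF w, of "grad_X \<phi> w"] n by (simp add: divide_le_eq)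
  qed
  have ray: "min_eigenvalue (k *\<^sub>R hess_X \<phi> z) \<le> k * (Q z v / (norm v)\<^sup>2)" if "v \<noteq> 0" for k v
  proof -
    have "min_eigenvalue (k *\<^sub>R hess_X \<phi> z) * (norm v)\<^sup>2 \<le> ((k *\<^sub>R hess_X \<phi> z) *v v) \<bullet> v"
      by (rule min_eigenvalue_symmetric(3)) (simp add: scaleR_matrix_vector_assoc[symmetric] sym)
    then show ?thesis using that unfolding Q_def by (simp add: scaleR_matrix_vector_assoc[symmetric] field_simps)
  qed
  show ?thesis
  proof (cases "p = \<infinity>")
    case True
    have "diffusion_lower p \<phi> z - 1 * E w \<le> diffusion p \<phi> w" if "w \<in> D" "grad_X \<phi> w \<noteq> 0" for w
      using ray[OF that(2), of 1] q[OF that] True unfolding diffusion_lower_def diffusion_def by simp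
    then show ?thesis by blast
  next
    case False
    define k where "k = real_of_ereal p - 2"
    have "diffusion_lower p \<phi> z - (\<bar>k\<bar> + real CARD('m)) * E w \<le> diffusion p \<phi> w" if "w \<in> D" "grad_X \<phi> w \<noteq> 0" for w
    proof -
      define q0 where "q0 = Q z (grad_X \<phi> w) / (norm (grad_X \<phi> w))\<^sup>2"
      have "\<bar>k * (inf_laplace_X \<phi> w - q0)\<bar> \<le> \<bar>k\<bar> * E w"
        using q[OF that] unfolding abs_mult q0_def by (intro mult_left_mono) auto
      then have "k * inf_laplace_X \<phi> w \<ge> k * q0 - \<bar>k\<bar> * E w" by (simp add: right_diff_distrib)
      then show ?thesis
        using ray[OF that(2), of k] trE[OF that(1)] False
        unfolding diffusion_lower_def diffusion_def k_def[symmetric] q0_def by (simp add: distrib_right)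
    qed
    then show ?thesis by blast
  qed
qed

text \<open>Testing the smallest eigenvalue with a basis vector \<open>e\<close>, the sum \<open>(p - 2) Q e\<close> plus the trace is
\<open>(p - 1) Q e\<close> plus the other diagonal entries. This is where \<open>p > 1\<close> enters for \<open>p < 2\<close>.\<close>

lemma diffusion_lower_nonpos:
  fixes \<phi> :: "'m::finite point \<Rightarrow> real"
  assumes sym: "\<And>x y. (hess_X \<phi> z *v x) \<bullet> y = (hess_X \<phi> z *v y) \<bullet> x"
    and neg: "\<And>h. (hess_X \<phi> z *v h) \<bullet> h \<le> 0" and p: "1 < p"
  shows "diffusion_lower p \<phi> z \<le> 0"
proof -
  define Q where "Q v = (hess_X \<phi> z *v v) \<bullet> v" for v
  obtain e :: "real^'m" where e: "e \<in> Basis" using nonempty_Basis by blast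
  have ray: "min_eigenvalue (k *\<^sub>R hess_X \<phi> z) \<le> k * Q e" for k
  proof -
    have "min_eigenvalue (k *\<^sub>R hess_X \<phi> z) * (norm e)\<^sup>2 \<le> ((k *\<^sub>R hess_X \<phi> z) *v e) \<bullet> e"
      by (rule min_eigenvalue_symmetric(3)) (simp add: scaleR_matrix_vector_assoc[symmetric] sym)
    then show ?thesis using e unfolding Q_def by (simp add: scaleR_matrix_vector_assoc[symmetric])
  qed
  show ?thesis
  proof (cases "p = \<infinity>")
    case True
    then show ?thesis using ray[of 1] neg[of e] unfolding diffusion_lower_def Q_def by simp
  next
    case False
    have p1: "real_of_ereal p > 1" using p False by (cases p) auto
    have "laplace_X \<phi> z = (\<Sum>b\<in>Basis. Q b)" unfolding laplace_X_def Q_def trace_eq_sum_Basis ..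
    also have "\<dots> = Q e + (\<Sum>b\<in>Basis - {e}. Q b)" using e by (simp add: sum.remove)
    also have "(\<Sum>b\<in>Basis - {e}. Q b) \<le> 0" using neg unfolding Q_def by (intro sum_nonpos) auto
    finally have "diffusion_lower p \<phi> z \<le> (real_of_ereal p - 2) * Q e + Q e"
      using ray[of "real_of_ereal p - 2"] False unfolding diffusion_lower_def by simp
    also have "\<dots> = (real_of_ereal p - 1) * Q e" by (simp add: algebra_simps)
    also have "\<dots> \<le> 0" using p1 neg[of e] unfolding Q_def by (simp add: mult_nonneg_nonpos)
    finally show ?thesis .
  qed
qed

text \<open>Here \<open>f a\<close> is the minimum of \<open>u\<close> minus the shifted test function. Comparing with the minimizer for \<open>a\<close>
bounds \<open>f b - f a\<close> by an increment of \<open>\<phi>\<close> in the \<open>X\<close> direction from a point where the \<open>X\<close>-gradient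
vanishes, hence by \<open>o(|b - a|)\<close>, uniformly. So \<open>f\<close> is differentiable with derivative zero, although
\<open>u\<close> is merely continuous.\<close>

lemma shifted_minimum_constant:
  fixes \<phi> u :: "'m::finite point \<Rightarrow> real" and f :: "real^'m \<Rightarrow> real"
  assumes j: "C2_jet D \<phi> g G" and r: "cball z (2 * r) \<subseteq> D" "\<rho> \<le> r"
    and att: "\<And>a. norm a < \<rho> \<Longrightarrow> \<exists>w\<in>cball z r. f a = u w - \<phi> (w + (a, 0)) \<and> fst (g (w + (a, 0))) = 0"
    and min: "\<And>a w. norm a < \<rho> \<Longrightarrow> w \<in> cball z r \<Longrightarrow> f a \<le> u w - \<phi> (w + (a, 0))"
    and a: "norm a < \<rho>"
  shows "f a = f 0"
proof -
  have "uniformly_continuous_on (cball z (2 * r)) g"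
    by (intro compact_uniformly_continuous continuous_on_subset[OF C2_jetD(6)[OF j] r(1)]) auto
  have in2: "w + (a, 0) \<in> cball z (2 * r)" if "w \<in> cball z r" "norm a < \<rho>" for w and a :: "real^'m"
  proof -
    have "dist z (w + (a, 0)) \<le> dist z w + dist w (w + (a, 0))" by (rule dist_triangle)
    also have "dist w (w + (a, 0)) = norm a" by (simp add: dist_norm norm_Pair)
    finally show ?thesis using that r(2) by simp
  qed
  have half: "f b - f a \<le> e * norm (b - a)"
    if e: "e > 0" and d: "\<And>x y. x \<in> cball z (2 * r) \<Longrightarrow> y \<in> cball z (2 * r) \<Longrightarrow> dist y x < d \<Longrightarrow> dist (g y) (g x) < e"
      and ab: "norm a < \<rho>" "norm b < \<rho>" "norm (b - a) < d" for a b e d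
  proof -
    obtain w where w: "w \<in> cball z r" "f a = u w - \<phi> (w + (a, 0))" "fst (g (w + (a, 0))) = 0"
      using att[OF ab(1)] by blast
    define k :: "'m point" where "k = (b - a, 0)"
    have seg: "w + (a, 0) + s *\<^sub>R k \<in> cball z (2 * r)" if "0 \<le> s" "s \<le> 1" for s
    proof -
      have "a + s *\<^sub>R (b - a) \<in> ball 0 \<rho>"
        using convexD[OF convex_ball[of "0::real^'m" \<rho>], of a b "1 - s" s] ab that by (simp add: algebra_simps)
      then have "norm (a + s *\<^sub>R (b - a)) < \<rho>" by simp
      from in2[OF w(1) this] show ?thesis unfolding k_def by (simp add: add.assoc)
    qed
    have "\<exists>\<xi>>0. \<xi> < 1 \<and> \<phi> (w + (a, 0) + 1 *\<^sub>R k) - \<phi> (w + (a, 0) + 0 *\<^sub>R k) = (1 - 0) * (g (w + (a, 0) + \<xi> *\<^sub>R k) \<bullet> k)"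
    proof (rule MVT2)
      fix s :: real assume s: "0 \<le> s" "s \<le> 1"
      have "((\<lambda>s. w + (a, 0) + s *\<^sub>R k) has_derivative (\<lambda>h. h *\<^sub>R k)) (at s)"
        by (auto intro!: derivative_eq_intros)
      from has_derivative_compose[OF this C2_jetD(1)[OF j]] seg[OF s] r(1)
      have "((\<lambda>s. \<phi> (w + (a, 0) + s *\<^sub>R k)) has_derivative (\<lambda>h. g (w + (a, 0) + s *\<^sub>R k) \<bullet> h *\<^sub>R k)) (at s)" by blast
      then show "((\<lambda>s. \<phi> (w + (a, 0) + s *\<^sub>R k)) has_real_derivative g (w + (a, 0) + s *\<^sub>R k) \<bullet> k) (at s)"
        unfolding has_field_derivative_def by (rule has_derivative_eq_rhs) (auto simp: mult.commute)
    qed simp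
    then obtain \<xi> where \<xi>: "0 < \<xi>" "\<xi> < 1" "\<phi> (w + (b, 0)) - \<phi> (w + (a, 0)) = g (w + (a, 0) + \<xi> *\<^sub>R k) \<bullet> k"
      unfolding k_def by (auto simp: add.assoc)
    let ?x = "w + (a, 0) + \<xi> *\<^sub>R k"
    have "dist ?x (w + (a, 0)) = \<xi> * norm (b - a)" unfolding k_def using \<xi>(1) by (simp add: dist_norm norm_Pair)
    also have "\<dots> \<le> norm (b - a)" using \<xi> by (simp add: mult_left_le_one_le)
    finally have "dist ?x (w + (a, 0)) < d" using ab(3) by linarith
    then have "dist (g ?x) (g (w + (a, 0))) < e" using d[OF in2[OF w(1) ab(1)] seg] \<xi> by simp
    then have "norm (fst (g ?x) - 0) < e"
      using norm_fst_le[of "fst (g ?x - g (w + (a, 0)))" "snd (g ?x - g (w + (a, 0)))"] w(3)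
      unfolding dist_norm prod.collapse by simp
    then have "\<bar>fst (g ?x) \<bullet> (b - a)\<bar> \<le> e * norm (b - a)"
      by (intro order_trans[OF Cauchy_Schwarz_ineq2] mult_right_mono) auto
    moreover have "g ?x \<bullet> k = fst (g ?x) \<bullet> (b - a)" unfolding k_def by (simp add: inner_prod_def)
    ultimately show ?thesis using min[OF ab(2) w(1)] w(2) \<xi>(3) by linarith
  qed
  have "(f has_derivative (\<lambda>h. 0)) (at a within ball 0 \<rho>)" if a: "a \<in> ball 0 \<rho>" for a
    unfolding has_derivative_within_alt
  proof (intro conjI allI impI bounded_linear_zero)
    fix e :: real assume e: "e > 0"
    then obtain d where d: "d > 0" "\<And>x y. x \<in> cball z (2 * r) \<Longrightarrow> y \<in> cball z (2 * r) \<Longrightarrow> dist y x < d \<Longrightarrow> dist (g y) (g x) < e"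
      using \<open>uniformly_continuous_on (cball z (2 * r)) g\<close> unfolding uniformly_continuous_on_def by blast
    show "\<exists>d>0. \<forall>y\<in>ball 0 \<rho>. norm (y - a) < d \<longrightarrow> norm (f y - f a - 0) \<le> e * norm (y - a)"
    proof (intro exI conjI ballI impI)
      fix b assume b: "b \<in> ball 0 \<rho>" "norm (b - a) < d"
      show "norm (f b - f a - 0) \<le> e * norm (b - a)"
        using half[OF e d(2), where a = a and b = b] half[OF e d(2), where a = b and b = a] a b by (simp add: norm_minus_commute abs_le_iff)
    qed (rule d(1))
  qed
  from has_derivative_zero_constant[OF convex_ball this]
  obtain c where "\<And>x. x \<in> ball 0 \<rho> \<Longrightarrow> f x = c" by blast
  moreover have "a \<in> ball 0 \<rho>" "0 \<in> ball (0::real^'m) \<rho>" using a le_less_trans[OF norm_ge_zero a] by auto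
  ultimately show ?thesis by metis
qed

lemma C2_jet_fixed_X:
  fixes \<phi> :: "'m::finite point \<Rightarrow> real" and V :: "'m point set"
  assumes j: "C2_jet D \<phi> g G" and V: "\<And>w. w \<in> V \<Longrightarrow> (X0, snd w) \<in> D"
  shows "C2_jet V (\<lambda>w. \<phi> (X0, snd w)) (\<lambda>w. (0, snd (g (X0, snd w)))) (\<lambda>w h. (0, snd (G (X0, snd w) (0, snd h))))"
  unfolding C2_jet_def
proof (intro conjI ballI)
  have P: "((\<lambda>w. (X0, snd w)) has_derivative (\<lambda>h. (0, snd h))) (at w)" for w
    by (auto intro!: derivative_eq_intros)
  fix w assume w: "w \<in> V"
  show "((\<lambda>w. \<phi> (X0, snd w)) has_derivative (\<bullet>) (0, snd (g (X0, snd w)))) (at w)"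
    using has_derivative_compose[OF P C2_jetD(1)[OF j V[OF w]]]
    by (rule has_derivative_eq_rhs) (auto simp: inner_prod_def)
  show "((\<lambda>w. (0, snd (g (X0, snd w)))) has_derivative (\<lambda>h. (0, snd (G (X0, snd w) (0, snd h))))) (at w)"
    using has_derivative_compose[OF P C2_jetD(2)[OF j V[OF w]]]
    by (intro has_derivative_Pair has_derivative_const has_derivative_snd)
next
  fix b :: "'m point" assume "b \<in> Basis"
  show "continuous_on V (\<lambda>w. (0, snd (G (X0, snd w) (0, snd b))))"
    by (intro continuous_intros continuous_on_compose2[OF C2_jet_continuous_hessian[OF j]]) (use V in auto)
qed

text \<open>Suppose the inequality fails at \<open>z\<close>. By continuity the unrelaxed inequality then fails at all nearby
points with nonzero gradient. Shift \<open>\<phi>\<close> by \<open>a\<close> in the \<open>X\<close> direction and move it vertically until it touches \<open>u\<close> from below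
near \<open>z\<close>. Nondegenerate tests hold at the contact point, so the gradient has to vanish there, for
every small \<open>a\<close>. Then the vertical adjustment does not depend on \<open>a\<close>, and it is zero for \<open>a = 0\<close>:
\<open>\<phi> (X + a, Y, t) \<le> u (X, Y, t)\<close>. With
\<open>X\<close> fixed at the first component of \<open>z\<close>, this says that \<open>\<phi>\<close> has a maximum in \<open>X\<close>, so its Hessian is
nonpositive and the right side of the inequality is at most zero. With \<open>a\<close> chosen such that \<open>X + a\<close>
is that component, it says that \<open>\<phi>\<close> with fixed \<open>X\<close> touches \<open>u\<close>, a test function with vanishing
gradient and Hessian, so the left side is at least zero. This is a contradiction.\<close>

lemma degenerate_test_inequality:
  fixes D :: "'m::finite point set"
  assumes D: "open D" and u: "continuous_on D u" and p: "1 < p"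
    and t: "touches_below D \<phi> u z" and g0: "grad_X \<phi> z = 0"
    and test: "\<And>\<psi> z. touches_below D \<psi> u z \<Longrightarrow> grad_X \<psi> z \<noteq> 0 \<or> hess_X \<psi> z = 0 \<Longrightarrow> diffusion p \<psi> z \<le> transport p \<psi> z"
  shows "diffusion_lower p \<phi> z \<le> transport p \<phi> z"
proof (rule ccontr)
  assume "\<not> diffusion_lower p \<phi> z \<le> transport p \<phi> z"
  then have contra: "transport p \<phi> z < diffusion_lower p \<phi> z" by simp
  have z: "z \<in> D" "u z = \<phi> z" "\<And>w. w \<in> D \<Longrightarrow> w \<noteq> z \<Longrightarrow> \<phi> w < u w" and \<phi>: "C2_on D \<phi>"
    using t unfolding touches_below_def by auto
  have below: "\<phi> w \<le> u w" if "w \<in> D" for w using z(2) z(3)[of w] that by (cases "w = z") auto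
  obtain g G where j: "C2_jet D \<phi> g G" using \<phi> unfolding C2_on_iff_jet by blast
  note P = C2_jet_partials[OF j D]
  define c where "c = (if p = \<infinity> then 1 else real CARD('m) + real_of_ereal p)"
  have tr: "transport p \<psi> w = c * (d_t \<psi> w - fst w \<bullet> grad_Y \<psi> w)" for \<psi> :: "'m point \<Rightarrow> real" and w
    unfolding transport_def c_def ..
  define E where "E w = (\<Sum>b\<in>Basis. norm (G w b - G z b))" for w
  obtain C where C: "\<And>w. w \<in> D \<Longrightarrow> grad_X \<phi> w \<noteq> 0 \<Longrightarrow> diffusion_lower p \<phi> z - C * E w \<le> diffusion p \<phi> w"
    using diffusion_ge_diffusion_lower[OF j D z(1), of p] unfolding E_def by blast
  \<comment> \<open>the transport part takes its \<open>X\<close> from the contact point and its derivatives from the shifted point, so both vary\<close>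
  define F where "F q = c * (snd (snd (g (fst q))) - snd q \<bullet> fst (snd (g (fst q)))) + C * E (fst q)" for q :: "'m point \<times> (real^'m)"
  have gc: "continuous_on (D \<times> UNIV) (\<lambda>q. g (fst q))" "continuous_on (D \<times> UNIV) (\<lambda>q. G (fst q) b)"
    for b
    by (intro continuous_on_compose2[OF C2_jetD(6)[OF j]] continuous_on_compose2[OF C2_jet_continuous_hessian[OF j]] continuous_intros; auto)+
  have "continuous_on (D \<times> UNIV) F" unfolding F_def E_def by (intro continuous_intros gc)
  moreover have "(z, fst z) \<in> D \<times> UNIV" using z(1) by simp
  ultimately obtain \<rho>0 where \<rho>0: "\<rho>0 > 0"
    "\<And>q. q \<in> D \<times> UNIV \<Longrightarrow> dist q (z, fst z) < \<rho>0 \<Longrightarrow> dist (F q) (F (z, fst z)) < diffusion_lower p \<phi> z - transport p \<phi> z"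
    using contra unfolding continuous_on_iff by (metis diff_gt_0_iff_gt)
  have Fz: "F (z, fst z) = transport p \<phi> z" unfolding F_def E_def tr P(2,3)[OF z(1)] by simp
  have strict: "c * (d_t \<phi> w - X \<bullet> grad_Y \<phi> w) < diffusion p \<phi> w"
    if w: "w \<in> D" "grad_X \<phi> w \<noteq> 0" "dist w z + dist X (fst z) < \<rho>0" for w X
  proof -
    have "dist (w, X) (z, fst z) \<le> dist w z + dist X (fst z)"
      unfolding dist_Pair_Pair by (rule sqrt_sum_squares_le_sum) auto
    then have "F (w, X) < diffusion_lower p \<phi> z"
      using \<rho>0(2)[of "(w, X)"] w unfolding Fz by (simp add: dist_real_def abs_less_iff)
    then show ?thesis using C[OF w(1,2)] unfolding F_def P(2,3)[OF w(1)] by simp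
  qed
  obtain r0 where r0: "r0 > 0" "cball z r0 \<subseteq> D" using D z(1) open_contains_cball by blast
  \<comment> \<open>two steps of length \<open>r\<close> from \<open>z\<close> stay in \<open>D\<close>, and three of them within the distance \<open>\<rho>0\<close>\<close>
  define r where "r = min (r0 / 2) (\<rho>0 / 4)"
  have r: "r > 0" "cball z (2 * r) \<subseteq> D" "3 * r < \<rho>0" using r0 \<rho>0(1) unfolding r_def by (auto simp: min_def split: if_splits)
  let ?B = "cball z r"
  have BD: "?B \<subseteq> D" using r by auto
  have shift_in: "w + (a, 0) \<in> cball z (2 * r)" if "w \<in> ?B" "norm a \<le> r" for w and a :: "real^'m"
  proof -
    have "dist z (w + (a, 0)) \<le> dist z w + dist w (w + (a, 0))" by (rule dist_triangle)
    also have "dist w (w + (a, 0)) = norm a" by (simp add: dist_norm norm_Pair)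
    finally show ?thesis using that by simp
  qed
  have cshift: "continuous_on ?B (\<lambda>w. u w - \<phi> (w + (a, 0)))" if "norm a \<le> r" for a
    by (intro continuous_intros continuous_on_subset[OF u BD] continuous_on_compose2[OF C2_jetD(5)[OF j]])
      (use shift_in that r(2) in auto)
  have "\<exists>w\<in>?B. \<forall>w'\<in>?B. u w - \<phi> (w + (a, 0)) \<le> u w' - \<phi> (w' + (a, 0))" if "norm a \<le> r" for a
    using continuous_attains_inf[OF _ _ cshift[OF that]] r(1) by auto
  then obtain m where m: "\<And>a. norm a \<le> r \<Longrightarrow> m a \<in> ?B"
    "\<And>a w. norm a \<le> r \<Longrightarrow> w \<in> ?B \<Longrightarrow> u (m a) - \<phi> (m a + (a, 0)) \<le> u w - \<phi> (w + (a, 0))"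
    by metis
  define f where "f a = u (m a) - \<phi> (m a + (a, 0))" for a
  have S: "compact (sphere z r)" "sphere z r \<noteq> {}" "sphere z r \<subseteq> D" using r BD by (auto simp: sphere_eq_empty)
  have "continuous_on (sphere z r) (\<lambda>w. u w - \<phi> w)"
    by (intro continuous_intros continuous_on_subset[OF u S(3)] continuous_on_subset[OF C2_jetD(5)[OF j] S(3)])
  then obtain s where s: "s \<in> sphere z r" "\<And>w. w \<in> sphere z r \<Longrightarrow> u s - \<phi> s \<le> u w - \<phi> w"
    using continuous_attains_inf[OF S(1,2)] by blast
  define \<delta> where "\<delta> = u s - \<phi> s"
  have \<delta>: "\<delta> > 0" unfolding \<delta>_def using z(3)[of s] s(1) S(3) r(1) by auto
  have "uniformly_continuous_on (cball z (2 * r)) \<phi>"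
    by (intro compact_uniformly_continuous continuous_on_subset[OF C2_jetD(5)[OF j] r(2)]) auto
  then obtain \<rho>1 where \<rho>1: "\<rho>1 > 0" "\<And>x y. x \<in> cball z (2 * r) \<Longrightarrow> y \<in> cball z (2 * r) \<Longrightarrow> dist y x < \<rho>1 \<Longrightarrow> dist (\<phi> y) (\<phi> x) < \<delta> / 2"
    unfolding uniformly_continuous_on_def using \<delta> by (meson half_gt_zero)
  define \<rho> where "\<rho> = min \<rho>1 r"
  have \<rho>: "\<rho> > 0" "\<rho> \<le> r" "\<rho> \<le> \<rho>1" unfolding \<rho>_def using \<rho>1 r by auto
  have close: "\<bar>\<phi> (w + (a, 0)) - \<phi> w\<bar> < \<delta> / 2" if "w \<in> ?B" "norm a < \<rho>" for w a
  proof -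
    have "dist (w + (a, 0)) w < \<rho>1" using that \<rho> by (simp add: dist_norm norm_Pair)
    moreover have "w \<in> cball z (2 * r)" using that(1) r(1) by simp
    ultimately show ?thesis using \<rho>1(2)[OF _ shift_in[OF that(1)], of w a] that \<rho> by (simp add: dist_real_def)
  qed
  \<comment> \<open>on the sphere \<open>u - \<phi>\<close> is at least \<open>\<delta>\<close>, so small shifts keep the minimizer inside\<close>
  have interior: "m a \<in> ball z r" if a: "norm a < \<rho>" for a
  proof (rule ccontr)
    assume "m a \<notin> ball z r"
    have mB: "m a \<in> ?B" using m(1)[of a] a \<rho> by simp
    with \<open>m a \<notin> ball z r\<close> have mS: "m a \<in> sphere z r" by auto
    have "u (m a) - \<phi> (m a) \<ge> \<delta>" unfolding \<delta>_def by (rule s(2)[OF mS])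
    then have "f a > \<delta> / 2" using close[OF mB a] unfolding f_def by linarith
    moreover have "f a \<le> u z - \<phi> (z + (a, 0))" unfolding f_def using m(2)[of a z] a \<rho> r(1) by simp
    moreover have "\<phi> (z + (a, 0)) > u z - \<delta> / 2" 
    proof -
      have "z \<in> ?B" using r(1) by simp
      from close[OF this a] show ?thesis using z(2) by linarith
    qed
    ultimately show False by linarith
  qed
  have critical: "fst (g (m a + (a, 0))) = 0" if a: "norm a < \<rho>" for a
  proof (rule ccontr)
    assume ne: "fst (g (m a + (a, 0))) \<noteq> 0"
    let ?w = "m a + (a, 0)"
    have a': "norm a \<le> r" using a \<rho> by simp
    have w: "?w \<in> D" "dist ?w z \<le> 2 * r" using shift_in[OF m(1)[OF a'] a'] r(2) by (auto simp: dist_commute)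
    have jV: "C2_jet (ball z r) (\<lambda>w. \<phi> (w + (a, 0)) + f a) (\<lambda>w. g (w + (a, 0)) + 0) (\<lambda>w h. G (w + (a, 0)) h + 0)"
      by (intro C2_jet_add[OF C2_jet_translate[OF j] C2_jet_const]) (use shift_in[OF _ a'] r(2) in auto)
    let ?\<psi> = "\<lambda>w. \<phi> (w + (a, 0)) + f a"
    have jV': "C2_jet (ball z r) ?\<psi> (\<lambda>w. g (w + (a, 0))) (\<lambda>w. G (w + (a, 0)))" using jV by simp
    note S = same_jet_same_operators[OF j D w(1) jV' open_ball interior[OF a] refl refl]
    have "diffusion p ?\<psi> (m a) \<le> transport p ?\<psi> (m a)"
    proof (rule local_test_inequality[OF D \<phi> below open_ball _ interior[OF a] jV'])
      show "ball z r \<subseteq> D" using BD by auto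
      show "?\<psi> w \<le> u w" if "w \<in> ball z r" for w using m(2)[OF a', of w] that unfolding f_def by simp
      show "?\<psi> (m a) = u (m a)" unfolding f_def by simp
      show "grad_X ?\<psi> (m a) \<noteq> 0 \<or> hess_X ?\<psi> (m a) = 0" unfolding S P(1)[OF w(1)] using ne by simp
    qed (use test in auto)
    then have "diffusion p \<phi> ?w \<le> c * (d_t \<phi> ?w - fst (m a) \<bullet> grad_Y \<phi> ?w)" unfolding tr S .
    moreover have "c * (d_t \<phi> ?w - fst (m a) \<bullet> grad_Y \<phi> ?w) < diffusion p \<phi> ?w"
    proof (rule strict[OF w(1)])
      show "grad_X \<phi> ?w \<noteq> 0" unfolding P(1)[OF w(1)] by (rule ne)
      have "dist (fst (m a)) (fst z) \<le> dist (m a) z" by (rule dist_fst_le)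
      also have "\<dots> \<le> r" using m(1)[OF a'] by (simp add: dist_commute)
      finally show "dist ?w z + dist (fst (m a)) (fst z) < \<rho>0" using w(2) r(3) by linarith
    qed
    ultimately show False by linarith
  qed
  have const: "f a = f 0" if a: "norm a < \<rho>" for a
  proof (rule shifted_minimum_constant[OF j r(2) \<rho>(2) _ _ a, of f u])
    fix a :: "real^'m" assume a: "norm a < \<rho>"
    then have a': "norm a \<le> r" using \<rho> by simp
    show "\<exists>w\<in>?B. f a = u w - \<phi> (w + (a, 0)) \<and> fst (g (w + (a, 0))) = 0"
      using m(1)[OF a'] critical[OF a] unfolding f_def by blast
    fix w assume "w \<in> ?B"
    then show "f a \<le> u w - \<phi> (w + (a, 0))" using m(2)[OF a'] unfolding f_def by blast
  qed
  \<comment> \<open>the unshifted function lies below \<open>u\<close>, so the constant value of \<open>f\<close> is nonnegative\<close>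
  have "f 0 \<ge> 0"
  proof -
    have "m 0 \<in> D" using m(1)[of 0] r(1) BD by auto
    then show ?thesis unfolding f_def using below[of "m 0"] by (simp add: zero_prod_def[symmetric])
  qed
  then have dom: "\<phi> (w + (a, 0)) \<le> u w" if "w \<in> ?B" "norm a < \<rho>" for w a
    using const[OF that(2)] m(2)[of a w] that \<rho> unfolding f_def by simp
  \<comment> \<open>\<open>\<phi>\<close> has a maximum in the \<open>X\<close> direction at \<open>z\<close>\<close>
  have neg: "(hess_X \<phi> z *v h) \<bullet> h \<le> 0" for h
  proof (rule ccontr)
    assume "\<not> (hess_X \<phi> z *v h) \<bullet> h \<le> 0"
    then have q: "(hess_X \<phi> z *v h) \<bullet> h > 0" (is "?q > 0") by simp
    \<comment> \<open>small enough for the quadratic term to exceed the Taylor remainder\<close>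
    define e where "e = ?q / (4 * ((norm h)\<^sup>2 + 1))"
    have pos1: "(norm h)\<^sup>2 + 1 > 0" by (simp add: add_nonneg_pos)
    have e: "e > 0" unfolding e_def using q pos1 by (intro divide_pos_pos) auto
    have e2: "2 * e * (norm h)\<^sup>2 < ?q"
    proof -
      have "2 * e * (norm h)\<^sup>2 \<le> 2 * e * ((norm h)\<^sup>2 + 1)" using e by simp
      also have "\<dots> = ?q / 2" unfolding e_def using pos1 by (simp add: field_simps)
      finally show ?thesis using q by linarith
    qed
    obtain d where d: "d > 0" "\<And>k. norm k < d \<Longrightarrow> \<bar>\<phi> (z + k) - \<phi> z - g z \<bullet> k - (G z k \<bullet> k) / 2\<bar> \<le> e * (norm k)\<^sup>2"
      using C2_jet_taylor[OF j D z(1) e] by blast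
    define \<sigma> where "\<sigma> = min d \<rho> / (2 * (norm h + 1))"
    have \<sigma>: "\<sigma> > 0" "\<sigma> * norm h < min d \<rho>"
    proof -
      have n: "norm h + 1 > 0" "min d \<rho> > 0" using d(1) \<rho>(1) by (auto simp: add_nonneg_pos)
      then show s0: "\<sigma> > 0" unfolding \<sigma>_def by (intro divide_pos_pos) auto
      have "\<sigma> * norm h \<le> \<sigma> * (norm h + 1)" using s0 by simp
      also have "\<dots> = min d \<rho> / 2" unfolding \<sigma>_def using n by (simp add: field_simps)
      finally show "\<sigma> * norm h < min d \<rho>" using n by linarith
    qed
    define k :: "'m point" where "k = (\<sigma> *\<^sub>R h, 0)"
    have nk: "norm k = \<sigma> * norm h" unfolding k_def using \<sigma>(1) by (simp add: norm_Pair)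
    have "g z \<bullet> k = 0" using g0 unfolding P(1)[OF z(1)] k_def by (simp add: inner_prod_def)
    moreover have "G z k \<bullet> k = \<sigma>\<^sup>2 * ?q"
      unfolding k_def C2_jet_hess_X_inner(1)[OF j D z(1), symmetric]
      by (simp add: matrix_vector_mult_scaleR power2_eq_square)
    moreover have "\<phi> (z + k) \<le> \<phi> z" using dom[of z "\<sigma> *\<^sub>R h"] r(1) \<sigma> z(2) unfolding k_def by simp
    ultimately have "\<sigma>\<^sup>2 * ?q / 2 \<le> e * (\<sigma> * norm h)\<^sup>2" using d(2)[of k] \<sigma>(2) unfolding nk by (simp add: abs_le_iff)
    then have "\<sigma>\<^sup>2 * ?q \<le> \<sigma>\<^sup>2 * (2 * e * (norm h)\<^sup>2)" by (simp add: power_mult_distrib mult_ac)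
    then show False using e2 \<sigma>(1) by simp
  qed
  have "diffusion_lower p \<phi> z \<le> 0"
    by (rule diffusion_lower_nonpos[OF C2_jet_hess_X_inner(2)[OF j D z(1)] neg p])
  moreover have "0 \<le> transport p \<phi> z"
  proof -
    let ?V = "ball z \<rho>" and ?\<psi> = "\<lambda>w. \<phi> (fst z, snd w)"
    have eq: "(fst z, snd w) = w + (fst z - fst w, 0)" for w :: "'m point" by (simp add: prod_eq_iff)
    have na: "norm (fst z - fst w) < \<rho>" "w \<in> ?B" if "w \<in> ?V" for w
      using that dist_fst_le[of z w] \<rho>(2) by (auto simp: dist_norm)
    have in_D: "(fst z, snd w) \<in> D" if "w \<in> ?V" for w
      unfolding eq using shift_in[of w "fst z - fst w"] na[OF that] \<rho>(2) r(2) by auto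
    have jV: "C2_jet ?V ?\<psi> (\<lambda>w. (0, snd (g (fst z, snd w)))) (\<lambda>w h. (0, snd (G (fst z, snd w) (0, snd h))))"
      by (rule C2_jet_fixed_X[OF j]) (rule in_D)
    have zV: "z \<in> ?V" using \<rho>(1) by simp
    note PV = C2_jet_partials[OF jV open_ball zV]
    have gX: "grad_X ?\<psi> z = 0" unfolding PV by simp
    have hX: "hess_X ?\<psi> z = 0" unfolding matrix_eq PV by simp
    have "diffusion p ?\<psi> z \<le> transport p ?\<psi> z"
    proof (rule local_test_inequality[OF D \<phi> below open_ball _ zV jV])
      show "?V \<subseteq> D" using na(2) BD by blast
      show "?\<psi> w \<le> u w" if "w \<in> ?V" for w unfolding eq by (rule dom[OF na(2)[OF that] na(1)[OF that]])
      show "grad_X ?\<psi> z \<noteq> 0 \<or> hess_X ?\<psi> z = 0" using hX by simp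
    qed (use test z(2) in auto)
    moreover have "transport p ?\<psi> z = transport p \<phi> z" unfolding tr PV P(2,3)[OF z(1)] by simp
    ultimately show ?thesis unfolding diffusion_degenerate(1)[OF gX hX] by simp
  qed
  ultimately show False using contra by linarith
qed

section \<open>Both halves of the equivalence\<close>

text \<open>The half of the mean value formula that concerns contact from below. The other half is this one for
\<open>- u\<close>.\<close>

definition mean_value_formula_below ::
  "ereal \<Rightarrow> 'm::finite point set \<Rightarrow> ('m point \<Rightarrow> real) \<Rightarrow> 'm point \<Rightarrow> bool" where
  "mean_value_formula_below p D u z \<longleftrightarrow>
     (\<forall>\<phi>. touches_below D \<phi> u z \<and>
          (grad_X \<phi> z \<noteq> 0 \<or> grad_X \<phi> z = 0 \<and> hess_X \<phi> z = 0) \<longrightarrow>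
        (\<exists>r \<in> o[at_right 0](\<lambda>\<epsilon>. \<epsilon>\<^sup>2).
           \<forall>\<^sub>F \<epsilon> in at_right 0. \<phi> z \<ge> mean_value p \<epsilon> \<phi> z + r \<epsilon>))"

lemma mean_value_formula_below_iff_supersolution:
  fixes D :: "'m::finite point set" and u :: "'m point \<Rightarrow> real" and p :: ereal
  assumes D: "open D" and p: "1 < p" and u: "continuous_on D u"
  shows "(\<forall>z\<in>D. mean_value_formula_below p D u z) \<longleftrightarrow> viscosity_supersolution p D u"
proof
  assume M: "\<forall>z\<in>D. mean_value_formula_below p D u z"
  have test: "diffusion p \<psi> z \<le> transport p \<psi> z"
    if t: "touches_below D \<psi> u z" and nd: "grad_X \<psi> z \<noteq> 0 \<or> hess_X \<psi> z = 0" for \<psi> z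
  proof -
    have zD: "z \<in> D" "C2_on D \<psi>" using t unfolding touches_below_def by auto
    then have "\<exists>r \<in> o[at_right 0](\<lambda>\<epsilon>. \<epsilon>\<^sup>2). \<forall>\<^sub>F \<epsilon> in at_right 0. \<psi> z \<ge> mean_value p \<epsilon> \<psi> z + r \<epsilon>"
      using M t nd unfolding mean_value_formula_below_def by blast
    then show ?thesis unfolding mean_value_inequality_iff[OF D zD(2,1) p nd] .
  qed
  have "lower_semicontinuous_on D u" unfolding lower_semicontinuous_on_def
  proof
    fix a
    have "{z \<in> D. a < u z} = D \<inter> u -` {a<..}" by auto
    then show "openin (top_of_set D) {z \<in> D. a < u z}"
      using continuous_openin_preimage_gen[OF u open_greaterThan[of a]] by simp
  qed
  then show "viscosity_supersolution p D u"
    unfolding viscosity_supersolution_def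
    using test degenerate_test_inequality[OF D u p _ _ test] by blast
next
  assume S: "viscosity_supersolution p D u"
  show "\<forall>z\<in>D. mean_value_formula_below p D u z"
    unfolding mean_value_formula_below_def
  proof (intro ballI allI impI)
    fix z \<phi> assume z: "z \<in> D" and "touches_below D \<phi> u z \<and>
          (grad_X \<phi> z \<noteq> 0 \<or> grad_X \<phi> z = 0 \<and> hess_X \<phi> z = 0)"
    then have t: "touches_below D \<phi> u z" and nd: "grad_X \<phi> z \<noteq> 0 \<or> hess_X \<phi> z = 0" by auto
    have C2: "C2_on D \<phi>" using t unfolding touches_below_def by auto
    have "diffusion p \<phi> z \<le> transport p \<phi> z"
    proof (cases "grad_X \<phi> z = 0")
      case True
      then have "diffusion_lower p \<phi> z \<le> transport p \<phi> z" using S t unfolding viscosity_supersolution_def by blast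
      then show ?thesis using True nd diffusion_degenerate[of \<phi> z p] by simp
    next
      case False
      then show ?thesis using S t unfolding viscosity_supersolution_def by blast
    qed
    then show "\<exists>r \<in> o[at_right 0](\<lambda>\<epsilon>. \<epsilon>\<^sup>2). \<forall>\<^sub>F \<epsilon> in at_right 0. \<phi> z \<ge> mean_value p \<epsilon> \<phi> z + r \<epsilon>"
      unfolding mean_value_inequality_iff[OF D C2 z p nd] .
  qed
qed

lemma touches_below_uminus: "touches_below D (\<lambda>w. - \<phi> w) (\<lambda>w. - u w) z \<longleftrightarrow> touches_above D \<phi> u z"
proof -
  have n: "C2_on D (\<lambda>w. - \<phi> w)" if "C2_on D \<phi>" for \<phi> :: "'a \<Rightarrow> real"
    using that C2_jet_minus unfolding C2_on_iff_jet by blast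
  have "C2_on D (\<lambda>w. - \<phi> w) \<longleftrightarrow> C2_on D \<phi>" using n[of \<phi>] n[of "\<lambda>w. - \<phi> w"] by auto
  then show ?thesis unfolding touches_below_def touches_above_def by simp
qed

lemma matrix_uminus_vector_mult: "(- A) *v x = - (A *v x)" for A :: "real^'n^'m"
  using matrix_vector_mult_diff_rdistrib[of 0 A x] by simp

lemma operators_uminus:
  fixes \<phi> :: "'m::finite point \<Rightarrow> real"
  assumes "open D" "C2_on D \<phi>" "z \<in> D"
  shows "grad_X (\<lambda>w. - \<phi> w) z = - grad_X \<phi> z" "hess_X (\<lambda>w. - \<phi> w) z = - hess_X \<phi> z"
    "transport p (\<lambda>w. - \<phi> w) z = - transport p \<phi> z" "diffusion p (\<lambda>w. - \<phi> w) z = - diffusion p \<phi> z"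
    "diffusion_lower p (\<lambda>w. - \<phi> w) z = - diffusion_upper p \<phi> z"
proof -
  obtain g G where j: "C2_jet D \<phi> g G" using assms(2) unfolding C2_on_iff_jet by blast
  note P = C2_jet_partials[OF j assms(1,3)] and N = C2_jet_partials[OF C2_jet_minus[OF j] assms(1,3)]
  show g: "grad_X (\<lambda>w. - \<phi> w) z = - grad_X \<phi> z" unfolding P N by simp
  show h: "hess_X (\<lambda>w. - \<phi> w) z = - hess_X \<phi> z" unfolding matrix_eq matrix_uminus_vector_mult P N by simp
  show "transport p (\<lambda>w. - \<phi> w) z = - transport p \<phi> z"
    unfolding transport_def P N by (simp add: algebra_simps)
  have l: "laplace_X (\<lambda>w. - \<phi> w) z = - laplace_X \<phi> z"
    unfolding laplace_X_def h trace_def by (simp add: sum_negf)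
  have i: "inf_laplace_X (\<lambda>w. - \<phi> w) z = - inf_laplace_X \<phi> z"
    unfolding inf_laplace_X_def h g matrix_uminus_vector_mult by (simp add: linear_neg[OF matrix_vector_mul_linear])
  show "diffusion p (\<lambda>w. - \<phi> w) z = - diffusion p \<phi> z" unfolding diffusion_def l i by simp
  have m: "max_eigenvalue (k *\<^sub>R hess_X \<phi> z) = - min_eigenvalue (k *\<^sub>R (- hess_X \<phi> z))" for k
    using max_eigenvalue_eq_min[of "k *\<^sub>R hess_X \<phi> z"] C2_jet_hess_X_inner(2)[OF j assms(1,3)]
    by (simp add: scaleR_matrix_vector_assoc[symmetric])
  show "diffusion_lower p (\<lambda>w. - \<phi> w) z = - diffusion_upper p \<phi> z"
    unfolding diffusion_lower_def diffusion_upper_def h l m using m[of 1] by simp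
qed

lemma set_integral_uminus: "(LINT x:A|M. - f x) = - (LINT x:A|M. f x)" for f :: "'a \<Rightarrow> real"
  unfolding set_lebesgue_integral_def by simp

text \<open>Changing the sign exchanges supremum and infimum, so their sum changes sign as well.\<close>

lemma mean_value_uminus: "mean_value p \<epsilon> (\<lambda>w. - \<phi> w) z = - mean_value p \<epsilon> \<phi> z"
proof -
  obtain X Y t where z: "z = (X, Y, t)" using prod_cases3 by blast
  have SI: "(SUP x\<in>A. - f x) + (INF x\<in>A. - f x) = - ((SUP x\<in>A. f x) + (INF x\<in>A. f x))" for f :: "'b \<Rightarrow> real" and A
    unfolding INF_eq_uminus_SUP by simp
  show ?thesis unfolding mean_value_def z prod.case SI set_integral_uminus by simp
qed

theorem theorem3p1:
  fixes D :: "'m::finite point set" and u :: "'m point \<Rightarrow> real" and p :: ereal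
  assumes "open D" and "1 < p" and "continuous_on D u"
  shows "(\<forall>z\<in>D. mean_value_formula_viscosity p D u z) \<longleftrightarrow> viscosity_solution p D u"
proof -
  let ?v = "\<lambda>w. - u w"
  \<comment> \<open>quantification over test functions is invariant under the sign change\<close>
  have all_neg: "(\<forall>\<phi>. P \<phi>) \<longleftrightarrow> (\<forall>\<phi>. P (\<lambda>w. - \<phi> w))" for P :: "('m point \<Rightarrow> real) \<Rightarrow> bool"
  proof safe
    fix \<phi> assume "\<forall>\<phi>. P (\<lambda>w. - \<phi> w)"
    from this[rule_format, of "\<lambda>w. - \<phi> w"] show "P \<phi>" by simp
  qed blast
  have smallo_neg: "(\<exists>r \<in> o[at_right 0](\<lambda>\<epsilon>. \<epsilon>\<^sup>2). \<forall>\<^sub>F \<epsilon> in at_right 0. - a \<ge> - M \<epsilon> + r \<epsilon>)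
      \<longleftrightarrow> (\<exists>r \<in> o[at_right 0](\<lambda>\<epsilon>. \<epsilon>\<^sup>2). \<forall>\<^sub>F \<epsilon> in at_right 0. a \<le> M \<epsilon> + r \<epsilon>)" (is "?L \<longleftrightarrow> ?R")
    for a :: real and M :: "real \<Rightarrow> real"
  proof
    assume ?L
    then obtain r where r: "r \<in> o[at_right 0](\<lambda>\<epsilon>. \<epsilon>\<^sup>2)" "\<forall>\<^sub>F \<epsilon> in at_right 0. - a \<ge> - M \<epsilon> + r \<epsilon>" by blast
    from r(2) have "\<forall>\<^sub>F \<epsilon> in at_right 0. a \<le> M \<epsilon> + - r \<epsilon>" by eventually_elim simp
    moreover have "(\<lambda>\<epsilon>. - r \<epsilon>) \<in> o[at_right 0](\<lambda>\<epsilon>. \<epsilon>\<^sup>2)" using r(1) by simp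
    ultimately show ?R by (intro bexI[of _ "\<lambda>\<epsilon>. - r \<epsilon>"])
  next
    assume ?R
    then obtain r where r: "r \<in> o[at_right 0](\<lambda>\<epsilon>. \<epsilon>\<^sup>2)" "\<forall>\<^sub>F \<epsilon> in at_right 0. a \<le> M \<epsilon> + r \<epsilon>" by blast
    from r(2) have "\<forall>\<^sub>F \<epsilon> in at_right 0. - a \<ge> - M \<epsilon> + - r \<epsilon>" by eventually_elim simp
    moreover have "(\<lambda>\<epsilon>. - r \<epsilon>) \<in> o[at_right 0](\<lambda>\<epsilon>. \<epsilon>\<^sup>2)" using r(1) by simp
    ultimately show ?L by (intro bexI[of _ "\<lambda>\<epsilon>. - r \<epsilon>"])
  qed
  have C2: "C2_on D \<phi>" "z \<in> D" if "touches_above D \<phi> u z" for \<phi> z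
    using that unfolding touches_above_def by auto
  have "mean_value_formula_viscosity p D u z \<longleftrightarrow> mean_value_formula_below p D u z \<and> mean_value_formula_below p D ?v z" for z
  proof -
    have "mean_value_formula_below p D ?v z \<longleftrightarrow>
      (\<forall>\<phi>. touches_above D \<phi> u z \<and> (grad_X \<phi> z \<noteq> 0 \<or> grad_X \<phi> z = 0 \<and> hess_X \<phi> z = 0) \<longrightarrow>
        (\<exists>r \<in> o[at_right 0](\<lambda>\<epsilon>. \<epsilon>\<^sup>2). \<forall>\<^sub>F \<epsilon> in at_right 0. \<phi> z \<le> mean_value p \<epsilon> \<phi> z + r \<epsilon>))"
      unfolding mean_value_formula_below_def
      by (subst all_neg, unfold touches_below_uminus mean_value_uminus smallo_neg)
        (auto simp: operators_uminus(1,2)[OF assms(1) C2])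
    then show ?thesis unfolding mean_value_formula_viscosity_def mean_value_formula_below_def[of p D u z] by simp
  qed
  moreover have "viscosity_supersolution p D ?v \<longleftrightarrow> viscosity_subsolution p D u"
  proof -
    have "lower_semicontinuous_on D ?v \<longleftrightarrow> upper_semicontinuous_on D u"
    proof -
      have e: "{z \<in> D. a < - u z} = {z \<in> D. u z < - a}" for a by auto
      show ?thesis unfolding lower_semicontinuous_on_def upper_semicontinuous_on_def e
      proof safe
        fix a assume "\<forall>a. openin (top_of_set D) {z \<in> D. u z < - a}"
        from this[rule_format, of "- a"] show "openin (top_of_set D) {z \<in> D. u z < a}" by simp
      qed blast
    qed
    moreover have "(\<forall>\<phi> z. touches_below D \<phi> ?v z \<longrightarrow>
        (grad_X \<phi> z \<noteq> 0 \<longrightarrow> transport p \<phi> z \<ge> diffusion p \<phi> z) \<and>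
        (grad_X \<phi> z = 0 \<longrightarrow> transport p \<phi> z \<ge> diffusion_lower p \<phi> z)) \<longleftrightarrow>
      (\<forall>\<phi> z. touches_above D \<phi> u z \<longrightarrow>
        (grad_X \<phi> z \<noteq> 0 \<longrightarrow> transport p \<phi> z \<le> diffusion p \<phi> z) \<and>
        (grad_X \<phi> z = 0 \<longrightarrow> transport p \<phi> z \<le> diffusion_upper p \<phi> z))"
      by (subst all_neg, unfold touches_below_uminus) (simp add: operators_uminus[OF assms(1) C2] cong: imp_cong)
    ultimately show ?thesis unfolding viscosity_supersolution_def viscosity_subsolution_def by simp
  qed
  moreover have "continuous_on D ?v" by (intro continuous_intros assms(3))
  ultimately show ?thesis
    unfolding viscosity_solution_def
    using mean_value_formula_below_iff_supersolution[OF assms] assms(3)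
      mean_value_formula_below_iff_supersolution[OF assms(1,2), of ?v] by auto
qed

end
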